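(* Fix one of the four mobility averages (harmonic, geometric, arithmetic or entropic) described in the context, and let $(\psi_e,c_e^1,\dots,c_e^M)$ be a sufficiently smooth exact $\Omega$-periodic solution on $[0,T]$ of the Poisson--Nernst--Planck system. Let $(\psi^n,c^{1,n},\dots,c^{M,n})$ be the numerical solution of the semi-implicit Slotboom scheme with initial data $c^{l,0}=\mathcal{P}_h c^l_N(\cdot,0)$, $\psi^0=\mathcal{P}_h\psi_N(\cdot,0)$. Define the discrete flux vectors $$J_N^{l,n}=\nabla_hc_N^{l,n}+q^lc_N^{l,n}\nabla_h\psi_N^n,\qquad J^{l,n}=\nabla_hc^{l,n}+q^lc^{l,n}\nabla_h\psi^n,\qquad e^n_{J^l}=J_N^{l,n}-J^{l,n},\quad l=1,\dots,M,$$ where $c_N^{l,n}$ and $\psi_N^n$ denote the restrictions to the grid of $c_N^l(\cdot,t^n)$ and $\psi_N(\cdot,t^n)$. Let $C_1,C_2>0$ be fixed constants. Then there is a constant $C>0$, independent of $\Delta t$ and $h$, such that, under the linear refinement requirement $C_1h\le\Delta t\le C_2h$ and as $\Delta t,h\to0$ (that is, for all sufficiently small such $\Delta t,h$), for all $n\ge1$ with $t^n=n\Delta t\le T$, $$\Big(\Delta t\sum_{l=1}^M\sum_{k=1}^n\|e^k_{J^l}\|_2^2\Big)^{1/2}\le C(\Delta t+h^2).$$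
   Context: **PDE.** $\Omega=(a,b)^3$ with periodic boundary conditions, $\kappa>0$ a constant, $q^l\in\mathbb{R}$ ($l=1,\dots,M$) the valences, $\rho^f=\rho^f(\mathbf{x})$ a given periodic function. The Poisson--Nernst--Planck system is $$\partial_t c^l=\nabla\cdot(\nabla c^l+q^lc^l\nabla\psi)\ (l=1,\dots,M),\qquad -\kappa\Delta\psi=\sum_{l=1}^M q^lc^l+\rho^f,$$ with initial data $c^l(\cdot,0)=c^l_{\rm in}$, compatibility $\int_\Omega(\sum_l q^lc^l_{\rm in}+\rho^f)\,d\mathbf{x}=0$ and normalization $\int_\Omega\psi\,d\mathbf{x}=0$. "Sufficiently smooth" means that the exact solution and $\rho^f$ have continuous space-time derivatives up to some sufficiently high fixed order $m$ (on the closed time interval $[0,T]$, periodic in space). **Grid.** $N=2K+1$ grid points per dimension, $h=(b-a)/N$, cell centres $x_i=a+(i-\frac12)h$, and likewise $y_j,z_k$. $\mathcal{C}_{\rm per}$ is the space of grid functions $u_{i,j,k}$ that are $N$-periodic in each index; $\mathring{\mathcal{C}}_{\rm per}$ is its subspace with zero mean $\overline u=\frac{h^3}{|\Omega|}\sum_{i,j,k=1}^N u_{i,j,k}=0$. Face-centred (staggered) periodic functions live at points $(i+\frac12,j,k)$, $(i,j+\frac12,k)$, $(i,j,k+\frac12)$. Put $D_xf_{i+1/2,j,k}=(f_{i+1,j,k}-f_{i,j,k})/h$, $A_xf_{i+1/2,j,k}=\frac12(f_{i+1,j,k}+f_{i,j,k})$ and $d_xf_{i,j,k}=(f_{i+1/2,j,k}-f_{i-1/2,j,k})/h$,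 similarly in $y,z$; $\nabla_hf=(D_xf,D_yf,D_zf)$, $\nabla_h\cdot\vec f=d_xf^x+d_yf^y+d_zf^z$, $\Delta_h=\nabla_h\cdot\nabla_h$. For a face-centred scalar $\mathcal{D}$, $\mathcal{D}\nabla_hf$ is the pointwise product on faces. For cell-centred $c,\psi$ in the flux, $c\nabla_h\psi=(A_xc\,D_x\psi,\ A_yc\,D_y\psi,\ A_zc\,D_z\psi)$. **Norm.** For a face-centred vector field $\vec f=(f^x,f^y,f^z)$, $\|\vec f\|_2^2=h^3\sum_{i,j,k=1}^N\big(|f^x_{i+1/2,j,k}|^2+|f^y_{i,j+1/2,k}|^2+|f^z_{i,j,k+1/2}|^2\big)$. **Projections.** $\mathcal{P}_N$ is the Fourier projection onto trigonometric polynomials of degree at most $K$ on $\Omega$; $c_N^l=\mathcal{P}_Nc_e^l$, $\psi_N=\mathcal{P}_N\psi_e$, $\rho^f_N=\mathcal{P}_N\rho^f$. $\mathcal{P}_h$ is pointwise restriction to the grid points $(x_i,y_j,z_k)$. **Scheme (Slotboom scheme).** With $t^n=n\Delta t$, given $\psi^n\in\mathring{\mathcal{C}}_{\rm per}$ and $c^{l,n}\in\mathcal{C}_{\rm per}$, find $c^{l,n+1}\in\mathcal{C}_{\rm per}$, $\psi^{n+1}\in\mathring{\mathcal{C}}_{\rm per}$ such that $$\frac{c^{l,n+1}-c^{l,n}}{\Delta t}=\nabla_h\cdot\Big(e^{-q^l\psi^n}\nabla_h\big(c^{l,n+1}e^{q^l\psi^n}\big)\Big)\ (l=1,\dots,M),\qquad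 -\kappa\Delta_h\psi^{n+1}=\sum_{l=1}^Mq^lc^{l,n+1}+\rho^f,\quad\overline{\psi^{n+1}}=0,$$ where the grid function $\rho^f$ is $\mathcal{P}_h\rho^f_N$ (so that the discrete right-hand side has zero mean). **Mobility averages.** With $S=q^l\psi^n$, the face value $e^{-q^l\psi^n}$ at $(i+\frac12,j,k)$ is one of: harmonic mean $\big(\frac{e^{S_{i+1,j,k}}+e^{S_{i,j,k}}}{2}\big)^{-1}$; geometric mean $e^{-(S_{i+1,j,k}+S_{i,j,k})/2}$; arithmetic mean $\frac{e^{-S_{i+1,j,k}}+e^{-S_{i,j,k}}}{2}$; entropic mean $\frac{S_{i+1,j,k}-S_{i,j,k}}{e^{S_{i+1,j,k}}-e^{S_{i,j,k}}}$ (equal to $e^{-S_{i,j,k}}$ when $S_{i+1,j,k}=S_{i,j,k}$). The $y$ and $z$ directions are analogous. *)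

theory Defs
  imports "HOL-Analysis.Analysis"
begin

section \<open>The continuous problem\<close>

definition cube :: "real \<Rightarrow> real \<Rightarrow> (real ^ 3) set" where
  "cube a b = box (vec a) (vec b)"

definition space_periodic :: "real \<Rightarrow> (real ^ 3 \<Rightarrow> real) \<Rightarrow> bool" where
  "space_periodic L u \<longleftrightarrow> (\<forall>x d. u (x + axis d L) = u x)"

text \<open>Continuous derivatives up to order \<open>m\<close> on \<open>S\<close>, relative to \<open>S\<close>. It is used for
  \<open>S = UNIV\<close> and for \<open>S = {0..T} \<times> UNIV\<close> with \<open>T > 0\<close>; in the latter case the time derivatives
  at the end points are one-sided, and derivatives within \<open>S\<close> are unique.\<close>

primrec Ck_on :: "nat \<Rightarrow> 'a::euclidean_space set \<Rightarrow> ('a \<Rightarrow> real) \<Rightarrow> bool" where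
  "Ck_on 0 S f \<longleftrightarrow> continuous_on S f"
| "Ck_on (Suc m) S f \<longleftrightarrow>
     (\<exists>D. (\<forall>z\<in>S. (f has_derivative D z) (at z within S)) \<and>
          (\<forall>e\<in>Basis. Ck_on m S (\<lambda>z. D z e)))"

text \<open>\<open>deriv\<close> is meaningful only where the derivative exists. \<open>PNP_solution\<close> below is therefore
  meant to be used together with \<open>smooth_data m\<close> for \<open>m \<ge> 2\<close>, where all derivatives exist.\<close>

definition partial :: "3 \<Rightarrow> (real ^ 3 \<Rightarrow> real) \<Rightarrow> real ^ 3 \<Rightarrow> real" where
  "partial d u x = deriv (\<lambda>s. u (x + s *\<^sub>R axis d 1)) 0"

definition gradient :: "(real ^ 3 \<Rightarrow> real) \<Rightarrow> real ^ 3 \<Rightarrow> real ^ 3" where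
  "gradient u x = (\<chi> d. partial d u x)"

definition divergence :: "(real ^ 3 \<Rightarrow> real ^ 3) \<Rightarrow> real ^ 3 \<Rightarrow> real" where
  "divergence F x = (\<Sum>d\<in>UNIV. partial d (\<lambda>y. F y $ d) x)"

definition laplacian :: "(real ^ 3 \<Rightarrow> real) \<Rightarrow> real ^ 3 \<Rightarrow> real" where
  "laplacian u = divergence (gradient u)"

text \<open>Species are numbered \<open>1..M\<close>; \<open>c l t x\<close> is the \<open>l\<close>-th concentration and \<open>\<psi> t x\<close> the potential.
  All functions are defined on the whole space and periodic; nothing is required outside \<open>{0..T}\<close>.\<close>

definition PNP_solution ::
  "real \<Rightarrow> real \<Rightarrow> real \<Rightarrow> real \<Rightarrow> nat \<Rightarrow> (nat \<Rightarrow> real) \<Rightarrow> (real ^ 3 \<Rightarrow> real) \<Rightarrow> (nat \<Rightarrow> real ^ 3 \<Rightarrow> real) \<Rightarrow>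
   (nat \<Rightarrow> real \<Rightarrow> real ^ 3 \<Rightarrow> real) \<Rightarrow> (real \<Rightarrow> real ^ 3 \<Rightarrow> real) \<Rightarrow> bool" where
  "PNP_solution a b T \<kappa> M q \<rho> c\<^sub>i\<^sub>n c \<psi> \<longleftrightarrow>
     space_periodic (b - a) \<rho> \<and>
     (\<forall>t\<in>{0..T}. space_periodic (b - a) (\<psi> t)) \<and>
     (\<forall>l\<in>{1..M}. \<forall>t\<in>{0..T}. space_periodic (b - a) (c l t)) \<and>
     (\<forall>l\<in>{1..M}. \<forall>t\<in>{0..T}. \<forall>x.
        ((\<lambda>s. c l s x) has_real_derivative
           divergence (\<lambda>y. gradient (c l t) y + (q l * c l t y) *\<^sub>R gradient (\<psi> t) y) x)
        (at t within {0..T})) \<and>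
     (\<forall>t\<in>{0..T}. \<forall>x. - \<kappa> * laplacian (\<psi> t) x = (\<Sum>l=1..M. q l * c l t x) + \<rho> x) \<and>
     (\<forall>l\<in>{1..M}. \<forall>x. c l 0 x = c\<^sub>i\<^sub>n l x) \<and>
     integral (cube a b) (\<lambda>x. (\<Sum>l=1..M. q l * c\<^sub>i\<^sub>n l x) + \<rho> x) = 0 \<and>
     (\<forall>t\<in>{0..T}. integral (cube a b) (\<psi> t) = 0)"

definition smooth_data ::
  "nat \<Rightarrow> real \<Rightarrow> nat \<Rightarrow> (real ^ 3 \<Rightarrow> real) \<Rightarrow>
   (nat \<Rightarrow> real \<Rightarrow> real ^ 3 \<Rightarrow> real) \<Rightarrow> (real \<Rightarrow> real ^ 3 \<Rightarrow> real) \<Rightarrow> bool" where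
  "smooth_data m T M \<rho> c \<psi> \<longleftrightarrow>
     Ck_on m UNIV \<rho> \<and>
     Ck_on m ({0..T} \<times> UNIV) (\<lambda>(t, x). \<psi> t x) \<and>
     (\<forall>l\<in>{1..M}. Ck_on m ({0..T} \<times> UNIV) (\<lambda>(t, x). c l t x))"


section \<open>Fourier projection\<close>

definition fourier_mode :: "real \<Rightarrow> real \<Rightarrow> int ^ 3 \<Rightarrow> real ^ 3 \<Rightarrow> complex" where
  "fourier_mode a b k x = cis (2 * pi * (\<Sum>d\<in>UNIV. real_of_int (k $ d) * x $ d) / (b - a))"

definition fourier_coeff :: "real \<Rightarrow> real \<Rightarrow> (real ^ 3 \<Rightarrow> real) \<Rightarrow> int ^ 3 \<Rightarrow> complex" where
  "fourier_coeff a b u k =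
     integral (cube a b) (\<lambda>x. complex_of_real (u x) * cnj (fourier_mode a b k x))
       / complex_of_real ((b - a) ^ 3)"

text \<open>Degree at most \<open>K\<close> is meant in each variable separately, matching the \<open>(2 * K + 1) ^ 3\<close>
  grid points. The sum is real for real \<open>u\<close>, so \<open>Re\<close> only changes the type.\<close>

definition fourier_proj :: "real \<Rightarrow> real \<Rightarrow> nat \<Rightarrow> (real ^ 3 \<Rightarrow> real) \<Rightarrow> real ^ 3 \<Rightarrow> real" where
  "fourier_proj a b K u x =
     Re (\<Sum>k\<in>{k. \<forall>d. \<bar>k $ d\<bar> \<le> int K}. fourier_coeff a b u k * fourier_mode a b k x)"


section \<open>Grid functions and difference operators\<close>

text \<open>A cell-centred function is indexed by \<open>p = (i, j, k)\<close>. For a face-centred field \<open>F\<close>,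
  \<open>F d p\<close> is the value of the component in direction \<open>d\<close> at the face \<open>p + axis d (1/2)\<close>.\<close>

type_synonym cell_fun = "int ^ 3 \<Rightarrow> real"
type_synonym face_field = "3 \<Rightarrow> int ^ 3 \<Rightarrow> real"

definition num_points :: "nat \<Rightarrow> nat" where
  "num_points K = 2 * K + 1"

definition mesh :: "real \<Rightarrow> real \<Rightarrow> nat \<Rightarrow> real" where
  "mesh a b K = (b - a) / real (num_points K)"

definition cell_centre :: "real \<Rightarrow> real \<Rightarrow> nat \<Rightarrow> int ^ 3 \<Rightarrow> real ^ 3" where
  "cell_centre a b K p = (\<chi> d. a + (real_of_int (p $ d) - 1 / 2) * mesh a b K)"

definition grid_restrict :: "real \<Rightarrow> real \<Rightarrow> nat \<Rightarrow> (real ^ 3 \<Rightarrow> real) \<Rightarrow> cell_fun" where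
  "grid_restrict a b K u p = u (cell_centre a b K p)"

definition grid_box :: "nat \<Rightarrow> (int ^ 3) set" where
  "grid_box K = {p. \<forall>d. 1 \<le> p $ d \<and> p $ d \<le> int (num_points K)}"

definition C_per :: "nat \<Rightarrow> cell_fun set" where
  "C_per K = {u. \<forall>p d. u (p + axis d (int (num_points K))) = u p}"

definition grid_mean :: "real \<Rightarrow> real \<Rightarrow> nat \<Rightarrow> cell_fun \<Rightarrow> real" where
  "grid_mean a b K u = mesh a b K ^ 3 / (b - a) ^ 3 * (\<Sum>p\<in>grid_box K. u p)"

definition C_per0 :: "real \<Rightarrow> real \<Rightarrow> nat \<Rightarrow> cell_fun set" where
  "C_per0 a b K = {u \<in> C_per K. grid_mean a b K u = 0}"

definition face_avg :: "cell_fun \<Rightarrow> face_field" where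
  "face_avg u d p = (u (p + axis d 1) + u p) / 2"

definition grad_h :: "real \<Rightarrow> cell_fun \<Rightarrow> face_field" where
  "grad_h h u d p = (u (p + axis d 1) - u p) / h"

definition div_h :: "real \<Rightarrow> face_field \<Rightarrow> cell_fun" where
  "div_h h F p = (\<Sum>d\<in>UNIV. (F d p - F d (p - axis d 1)) / h)"

definition laplace_h :: "real \<Rightarrow> cell_fun \<Rightarrow> cell_fun" where
  "laplace_h h u = div_h h (grad_h h u)"

definition face_norm :: "real \<Rightarrow> real \<Rightarrow> nat \<Rightarrow> face_field \<Rightarrow> real" where
  "face_norm a b K F = sqrt (mesh a b K ^ 3 * (\<Sum>p\<in>grid_box K. \<Sum>d\<in>UNIV. \<bar>F d p\<bar>\<^sup>2))"

definition discrete_flux :: "real \<Rightarrow> real \<Rightarrow> cell_fun \<Rightarrow> cell_fun \<Rightarrow> face_field" where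
  "discrete_flux h z c \<psi> d p = grad_h h c d p + z * (face_avg c d p * grad_h h \<psi> d p)"


section \<open>The Slotboom scheme\<close>

datatype mobility = Harmonic | Geometric | Arithmetic | Entropic

fun mobility_mean :: "mobility \<Rightarrow> real \<Rightarrow> real \<Rightarrow> real" where
  "mobility_mean Harmonic r s = inverse ((exp s + exp r) / 2)"
| "mobility_mean Geometric r s = exp (- (s + r) / 2)"
| "mobility_mean Arithmetic r s = (exp (- s) + exp (- r)) / 2"
| "mobility_mean Entropic r s = (if s = r then exp (- r) else (s - r) / (exp s - exp r))"

definition mobility_face :: "mobility \<Rightarrow> cell_fun \<Rightarrow> face_field" where
  "mobility_face \<mu> S d p = mobility_mean \<mu> (S p) (S (p + axis d 1))"

definition slotboom_step ::
  "mobility \<Rightarrow> real \<Rightarrow> real \<Rightarrow> real \<Rightarrow> nat \<Rightarrow> (nat \<Rightarrow> real) \<Rightarrow> (real ^ 3 \<Rightarrow> real) \<Rightarrow> nat \<Rightarrow> real \<Rightarrow>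
   (nat \<Rightarrow> cell_fun) \<Rightarrow> cell_fun \<Rightarrow> (nat \<Rightarrow> cell_fun) \<Rightarrow> cell_fun \<Rightarrow> bool" where
  "slotboom_step \<mu> a b \<kappa> M q \<rho> K \<Delta>t c \<psi> c' \<psi>' \<longleftrightarrow>
     (let h = mesh a b K in
       (\<forall>l\<in>{1..M}. c' l \<in> C_per K) \<and> \<psi>' \<in> C_per0 a b K \<and>
       (\<forall>l\<in>{1..M}. \<forall>p.
          (c' l p - c l p) / \<Delta>t =
            div_h h (\<lambda>d r. mobility_face \<mu> (\<lambda>s. q l * \<psi> s) d r *
                            grad_h h (\<lambda>s. c' l s * exp (q l * \<psi> s)) d r) p) \<and>
       (\<forall>p. - \<kappa> * laplace_h h \<psi>' p =
              (\<Sum>l=1..M. q l * c' l p) + grid_restrict a b K (fourier_proj a b K \<rho>) p))"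

text \<open>\<open>cn l n\<close> and \<open>\<psi>n n\<close> are the grid functions at time level \<open>n\<close>; \<open>c\<close> and \<open>\<psi>\<close> are the exact
  solution, which enters through the initial data only. Levels beyond time \<open>T\<close> are unconstrained.\<close>

definition slotboom_solution ::
  "mobility \<Rightarrow> real \<Rightarrow> real \<Rightarrow> real \<Rightarrow> real \<Rightarrow> nat \<Rightarrow> (nat \<Rightarrow> real) \<Rightarrow> (real ^ 3 \<Rightarrow> real) \<Rightarrow>
   (nat \<Rightarrow> real \<Rightarrow> real ^ 3 \<Rightarrow> real) \<Rightarrow> (real \<Rightarrow> real ^ 3 \<Rightarrow> real) \<Rightarrow> nat \<Rightarrow> real \<Rightarrow>
   (nat \<Rightarrow> nat \<Rightarrow> cell_fun) \<Rightarrow> (nat \<Rightarrow> cell_fun) \<Rightarrow> bool" where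
  "slotboom_solution \<mu> a b T \<kappa> M q \<rho> c \<psi> K \<Delta>t cn \<psi>n \<longleftrightarrow>
     (\<forall>l\<in>{1..M}. cn l 0 = grid_restrict a b K (fourier_proj a b K (c l 0))) \<and>
     \<psi>n 0 = grid_restrict a b K (fourier_proj a b K (\<psi> 0)) \<and>
     (\<forall>n. real (Suc n) * \<Delta>t \<le> T \<longrightarrow>
        slotboom_step \<mu> a b \<kappa> M q \<rho> K \<Delta>t
          (\<lambda>l. cn l n) (\<psi>n n) (\<lambda>l. cn l (Suc n)) (\<psi>n (Suc n)))"

text \<open>The flux error at level \<open>n\<close>: discrete flux of the projected exact solution at time \<open>n * \<Delta>t\<close>
  minus discrete flux of the numerical solution.\<close>

definition flux_error ::
  "real \<Rightarrow> real \<Rightarrow> (nat \<Rightarrow> real) \<Rightarrow> (nat \<Rightarrow> real \<Rightarrow> real ^ 3 \<Rightarrow> real) \<Rightarrow> (real \<Rightarrow> real ^ 3 \<Rightarrow> real) \<Rightarrow>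
   nat \<Rightarrow> real \<Rightarrow> (nat \<Rightarrow> nat \<Rightarrow> cell_fun) \<Rightarrow> (nat \<Rightarrow> cell_fun) \<Rightarrow> nat \<Rightarrow> nat \<Rightarrow> face_field" where
  "flux_error a b q c \<psi> K \<Delta>t cn \<psi>n l n d p =
     discrete_flux (mesh a b K) (q l)
       (grid_restrict a b K (fourier_proj a b K (c l (real n * \<Delta>t))))
       (grid_restrict a b K (fourier_proj a b K (\<psi> (real n * \<Delta>t)))) d p
     - discrete_flux (mesh a b K) (q l) (cn l n) (\<psi>n n) d p"

end

theory Submission
  imports Defs
begin

text \<open>Because \<open>\<Delta>t \<ge> C\<^sub>1 h\<close>, an error of order \<open>h\<close> suffices, and no higher-order asymptotic expansion is
  needed. The Fourier projection of a smooth function is uniformly accurate of order \<open>h\<^sup>2\<close>, so the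
  scheme may be compared with the exact solution itself. As long as the discrete gradient of the
  numerical potential stays bounded, an energy estimate and Gronwall's inequality bound the errors of
  the concentrations in \<open>\<ell>\<^sup>2\<close> and of their gradients in \<open>\<ell>\<^sup>2(\<ell>\<^sup>2)\<close> by a multiple of \<open>h\<close>. This
  boundedness is propagated by induction over the time levels: summation by parts controls all second
  differences of the potential error \<open>\<phi>\<close> by \<open>\<Delta>\<^sub>h \<phi>\<close> in \<open>\<ell>\<^sup>2\<close>, and a one-dimensional interpolation
  inequality, used in two directions, bounds the maximum of its discrete gradient by a multiple of
  \<open>h\<^bsup>-3/4\<^esup> \<parallel>\<Delta>\<^sub>h \<phi>\<parallel>\<close>, which is \<open>O(h\<^bsup>1/4\<^esup>)\<close>.\<close>

section \<open>Periodic grid functions\<close>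

text \<open>The mobility is lagged, and this orders the argument: the step to level
  \<open>n + 1\<close> sees only the old potential, so a gradient bound at level \<open>n\<close>
  already gives the energy inequality of that step, and only afterwards does the Poisson equation
  bound the new potential. The constants do not grow along the induction, because Gronwall's
  inequality is rerun from level 0 each time and returns the same \<open>C\<^sub>V\<close>. Since
  the concentration error is O(h) in the mean, the maximum estimate for the gradient may lose any
  power of h below the first. The four averages enter through three facts only: the weight is 1 at
  0, it is Lipschitz near 0, and the difference of its values at x and -x equals x up to second
  order. The Fourier projection enters only through the initial data, the fixed charge and the flux
  in the final statement.\<close>

lemma C_per_plus_axis: "u \<in> C_per K \<Longrightarrow> u (p + axis d (int (num_points K))) = u p"
  by (simp add: C_per_def)

lemma C_per_minus_axis: "u \<in> C_per K \<Longrightarrow> u (p - axis d (int (num_points K))) = u p"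
  using C_per_plus_axis[of u K "p - axis d (int (num_points K))" d] by simp

lemma C_per_shift: "u \<in> C_per K \<Longrightarrow> (\<lambda>p. u (p + z)) \<in> C_per K"
  by (auto simp: C_per_def) (metis add.assoc add.commute)

lemma C_per_shift_minus: "u \<in> C_per K \<Longrightarrow> (\<lambda>p. u (p - z)) \<in> C_per K"
  using C_per_shift[of u K "- z"] by simp

lemma C_per_compose1: "u \<in> C_per K \<Longrightarrow> (\<lambda>p. f (u p)) \<in> C_per K"
  by (auto simp: C_per_def)

lemma C_per_compose2: "u \<in> C_per K \<Longrightarrow> v \<in> C_per K \<Longrightarrow> (\<lambda>p. f (u p) (v p)) \<in> C_per K"
  by (auto simp: C_per_def)

lemma C_per_compose4:
  "u \<in> C_per K \<Longrightarrow> v \<in> C_per K \<Longrightarrow> w \<in> C_per K \<Longrightarrow> z \<in> C_per K \<Longrightarrow>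
    (\<lambda>p. f (u p) (v p) (w p) (z p)) \<in> C_per K"
  by (auto simp: C_per_def)

text \<open>An upper bound is enough, since the counts enter only as factors in estimates. The same
  box serves the grid points and, centred at 0, the Fourier modes.\<close>

lemma card_int_box_le:
  "card {p::int ^ 3. \<forall>d. lo \<le> p $ d \<and> p $ d \<le> hi} \<le> nat (hi - lo + 1) ^ 3"
  "finite {p::int ^ 3. \<forall>d. lo \<le> p $ d \<and> p $ d \<le> hi}"
proof -
  let ?f = "\<lambda>(x, y, z). vector [x, y, z] :: int ^ 3"
  let ?A = "{lo..hi} \<times> {lo..hi} \<times> {lo..hi}"
  have sub: "{p::int ^ 3. \<forall>d. lo \<le> p $ d \<and> p $ d \<le> hi} \<subseteq> ?f ` ?A"
  proof
    fix p :: "int ^ 3" assume "p \<in> {p. \<forall>d. lo \<le> p $ d \<and> p $ d \<le> hi}"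
    then have "p = ?f (p $ 1, p $ 2, p $ 3)" "(p $ 1, p $ 2, p $ 3) \<in> ?A"
      by (auto simp: vec_eq_iff forall_3 vector_3)
    then show "p \<in> ?f ` ?A" by blast
  qed
  have "card {p::int ^ 3. \<forall>d. lo \<le> p $ d \<and> p $ d \<le> hi} \<le> card (?f ` ?A)"
    by (rule card_mono[OF _ sub]) simp
  also have "\<dots> \<le> card ?A" by (rule card_image_le) simp
  also have "\<dots> = nat (hi - lo + 1) ^ 3"
    by (simp add: card_cartesian_product power3_eq_cube algebra_simps)
  finally show "card {p::int ^ 3. \<forall>d. lo \<le> p $ d \<and> p $ d \<le> hi} \<le> nat (hi - lo + 1) ^ 3" .
  show "finite {p::int ^ 3. \<forall>d. lo \<le> p $ d \<and> p $ d \<le> hi}"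
    by (rule finite_subset[OF sub]) simp
qed

lemma finite_grid_box [simp]: "finite (grid_box K)"
  unfolding grid_box_def by (rule card_int_box_le)

lemma card_grid_box_le: "card (grid_box K) \<le> num_points K ^ 3"
  unfolding grid_box_def using card_int_box_le(1)[of 1 "int (num_points K)"] by simp

lemma num_points_pos [simp]: "num_points K > 0"
  by (simp add: num_points_def)

lemma sum_grid_box_shift:
  assumes u: "u \<in> C_per K"
  shows "(\<Sum>p\<in>grid_box K. u (p + axis d 1)) = (\<Sum>p\<in>grid_box K. u p)"
proof -
  let ?N = "int (num_points K)"
  \<comment> \<open>\<open>f\<close> and \<open>g\<close> are the cyclic shift of the box and its
    inverse: \<open>f\<close> jumps only on the last layer, by \<open>1 - N\<close>, and
    \<open>g\<close> only on the first, by \<open>N - 1\<close>.\<close>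
  define f :: "int ^ 3 \<Rightarrow> int ^ 3" where "f p = p + axis d (if p $ d < ?N then 1 else 1 - ?N)" for p
  define g :: "int ^ 3 \<Rightarrow> int ^ 3" where "g p = p + axis d (if p $ d > 1 then - 1 else ?N - 1)" for p
  have N: "?N > 0" by simp
  show ?thesis
  proof (rule sum.reindex_bij_witness[of _ g f])
    fix p :: "int ^ 3" assume p: "p \<in> grid_box K"
    then have pd: "1 \<le> p $ d" "p $ d \<le> ?N" by (auto simp: grid_box_def)
    show "f p \<in> grid_box K" "g p \<in> grid_box K"
      using p pd N by (auto simp: f_def g_def grid_box_def axis_def; smt (verit))+
    show "g (f p) = p" "f (g p) = p"
      using pd N by (auto simp: f_def g_def vec_eq_iff axis_def)
    show "u (f p) = u (p + axis d 1)"
    proof (cases "p $ d < ?N")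
      case False
      have "f p = (p + axis d 1) - axis d ?N"
        using False by (auto simp: f_def vec_eq_iff axis_def)
      then show ?thesis using C_per_minus_axis[OF u] by simp
    qed (simp add: f_def)
  qed
qed

lemma sum_grid_box_shift_minus:
  assumes u: "u \<in> C_per K"
  shows "(\<Sum>p\<in>grid_box K. u (p - axis d 1)) = (\<Sum>p\<in>grid_box K. u p)"
  using sum_grid_box_shift[OF C_per_shift_minus[OF u], of d "axis d 1"] by simp

lemma axis_0 [simp]: "axis d 0 = 0"
  by (simp add: vec_eq_iff axis_def)

lemma sum_grid_box_shift_axis:
  assumes u: "u \<in> C_per K"
  shows "(\<Sum>p\<in>grid_box K. u (p + axis d i)) = (\<Sum>p\<in>grid_box K. u p)"
proof (induction i rule: int_induct[where k = 0])
  case base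
  show ?case by simp
next
  case (step1 i)
  have "p + axis d 1 + axis d i = p + axis d (i + 1)" for p :: "int ^ 3"
    by (simp add: vec_eq_iff axis_def)
  with step1 sum_grid_box_shift[OF C_per_shift[OF u], of d "axis d i"] show ?case by simp
next
  case (step2 i)
  have "p - axis d 1 + axis d i = p + axis d (i - 1)" for p :: "int ^ 3"
    by (simp add: vec_eq_iff axis_def)
  with step2 sum_grid_box_shift_minus[OF C_per_shift[OF u], of d "axis d i"] show ?case by simp
qed

lemma sum_grid_box_translate:
  assumes u: "u \<in> C_per K"
  shows "(\<Sum>p\<in>grid_box K. u (p + z)) = (\<Sum>p\<in>grid_box K. u p)"
proof -
  have z: "z = axis 1 (z $ 1) + axis 2 (z $ 2) + axis 3 (z $ 3)"
    by (simp add: vec_eq_iff forall_3 axis_def)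
  have "(\<Sum>p\<in>grid_box K. u (p + z)) =
      (\<Sum>p\<in>grid_box K. u (p + axis 3 (z $ 3) + (axis 1 (z $ 1) + axis 2 (z $ 2))))"
    by (subst z) (simp only: ac_simps)
  also have "\<dots> = (\<Sum>p\<in>grid_box K. u (p + axis 2 (z $ 2) + axis 1 (z $ 1)))"
    by (subst sum_grid_box_shift_axis[OF C_per_shift[OF u]]) (simp only: ac_simps)
  also have "\<dots> = (\<Sum>p\<in>grid_box K. u (p + axis 1 (z $ 1)))"
    by (subst sum_grid_box_shift_axis[OF C_per_shift[OF u]]) (rule refl)
  also have "\<dots> = (\<Sum>p\<in>grid_box K. u p)"
    by (rule sum_grid_box_shift_axis[OF u])
  finally show ?thesis .
qed

text \<open>Translating \<open>p\<close> to the corner \<open>vec 1\<close> moves the plane into the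
  box, and the sum over the box does not notice the translation. This carries estimates on lines and
  planes through an arbitrary point over to norms on the whole grid.\<close>

lemma sum_plane_le_sum_grid_box:
  assumes u: "u \<in> C_per K" and nn: "\<And>p. 0 \<le> u p" and de: "d \<noteq> e"
  shows "(\<Sum>i<num_points K. \<Sum>j<num_points K. u (p + axis d (int i) + axis e (int j)))
    \<le> (\<Sum>p\<in>grid_box K. u p)"
proof -
  let ?N = "num_points K"
  let ?f = "\<lambda>(i, j). vec 1 + axis d (int i) + axis e (int j) :: int ^ 3"
  define v where "v r = u (r + (p - vec 1))" for r
  have v: "v \<in> C_per K" unfolding v_def by (rule C_per_shift[OF u])
  have inj: "inj_on ?f ({..<?N} \<times> {..<?N})"
  proof (rule inj_onI, clarify)
    fix i j i' j' :: nat
    assume "vec 1 + axis d (int i) + axis e (int j) = vec 1 + axis d (int i') + axis e (int j')"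
    then have "(axis d (int i) + axis e (int j)) $ k = (axis d (int i') + axis e (int j')) $ k" for k
      by simp
    from this[of d] this[of e] de show "i = i' \<and> j = j'" by (simp add: axis_def)
  qed
  have sub: "?f ` ({..<?N} \<times> {..<?N}) \<subseteq> grid_box K"
    using de by (auto simp: grid_box_def axis_def)
  have "(\<Sum>i<?N. \<Sum>j<?N. u (p + axis d (int i) + axis e (int j))) =
      (\<Sum>(i, j)\<in>{..<?N} \<times> {..<?N}. v (?f (i, j)))"
    unfolding sum.cartesian_product
    by (intro sum.cong refl) (auto simp: v_def intro!: arg_cong[where f = u])
  also have "\<dots> = (\<Sum>r\<in>?f ` ({..<?N} \<times> {..<?N}). v r)"
    by (subst sum.reindex[OF inj]) (auto intro!: sum.cong)
  also have "\<dots> \<le> (\<Sum>r\<in>grid_box K. v r)"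
    by (rule sum_mono2[OF _ sub]) (auto simp: v_def nn)
  also have "\<dots> = (\<Sum>r\<in>grid_box K. u r)"
    unfolding v_def by (rule sum_grid_box_translate[OF u])
  finally show ?thesis .
qed


section \<open>Discrete integration by parts and elliptic estimates\<close>

text \<open>Differences without the factor \<open>1 / h\<close>: the estimates along lines are then
  free of scaling, and \<open>h\<close> returns only through \<open>laplace_h\<close> and
  \<open>grad_h\<close>.\<close>

definition fdiff :: "3 \<Rightarrow> cell_fun \<Rightarrow> cell_fun" where
  "fdiff d u p = u (p + axis d 1) - u p"

definition bdiff :: "3 \<Rightarrow> cell_fun \<Rightarrow> cell_fun" where
  "bdiff d u p = u p - u (p - axis d 1)"

lemma C_per_fdiff [simp]: "u \<in> C_per K \<Longrightarrow> fdiff d u \<in> C_per K"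
  unfolding fdiff_def[abs_def] by (rule C_per_compose2[where f = "(-)", OF C_per_shift])

lemma C_per_bdiff [simp]: "u \<in> C_per K \<Longrightarrow> bdiff d u \<in> C_per K"
  unfolding bdiff_def[abs_def] by (rule C_per_compose2[where f = "(-)", OF _ C_per_shift_minus])

lemma fdiff_commute: "fdiff d (fdiff e u) = fdiff e (fdiff d u)"
  by (auto simp: fdiff_def ac_simps)

lemma fdiff_bdiff: "fdiff d (bdiff e u) = bdiff e (fdiff d u)"
  by (auto simp: fdiff_def bdiff_def algebra_simps)

lemma grad_h_fdiff: "grad_h h u d p = fdiff d u p / h"
  by (simp add: grad_h_def fdiff_def)

lemma laplace_h_fdiff: "laplace_h h u p = (\<Sum>d\<in>UNIV. bdiff d (fdiff d u) p) / h\<^sup>2"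
  unfolding laplace_h_def div_h_def sum_divide_distrib
  by (intro sum.cong refl) (simp add: grad_h_fdiff bdiff_def power2_eq_square diff_divide_distrib)

lemma summation_by_parts:
  assumes F: "F \<in> C_per K" and u: "u \<in> C_per K"
  shows "(\<Sum>p\<in>grid_box K. bdiff d F p * u p) = - (\<Sum>p\<in>grid_box K. F p * fdiff d u p)"
proof -
  have "(\<Sum>p\<in>grid_box K. F (p - axis d 1) * u p) = (\<Sum>p\<in>grid_box K. F p * u (p + axis d 1))"
    using sum_grid_box_shift_minus[OF C_per_compose2[where f = "(*)", OF F C_per_shift[OF u]],
      of d "axis d 1"] by simp
  then show ?thesis
    by (simp add: bdiff_def fdiff_def algebra_simps sum_subtractf)
qed

lemma summation_by_parts_div_h:
  assumes F: "\<And>d. F d \<in> C_per K" and u: "u \<in> C_per K"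
  shows "(\<Sum>p\<in>grid_box K. div_h h F p * u p) = - (\<Sum>p\<in>grid_box K. \<Sum>d\<in>UNIV. F d p * grad_h h u d p)"
proof -
  have "(\<Sum>p\<in>grid_box K. div_h h F p * u p) = (\<Sum>p\<in>grid_box K. \<Sum>d\<in>UNIV. bdiff d (F d) p * u p / h)"
    by (simp add: div_h_def bdiff_def sum_distrib_right)
  also have "\<dots> = (\<Sum>d\<in>UNIV. (\<Sum>p\<in>grid_box K. bdiff d (F d) p * u p) / h)"
    by (subst sum.swap) (simp add: sum_divide_distrib)
  also have "\<dots> = - (\<Sum>d\<in>UNIV. \<Sum>p\<in>grid_box K. F d p * grad_h h u d p)"
    by (simp add: summation_by_parts[OF F u] sum_negf sum_divide_distrib grad_h_fdiff)
  finally show ?thesis by (subst sum.swap) simp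
qed

text \<open>Discrete form of the identity that the integral of u_dd u_ee is the integral of
  (u_de)^2: two summations by parts, with commuting differences and no boundary terms because of
  periodicity.\<close>

lemma sum_bdiff_fdiff_mult:
  assumes u: "u \<in> C_per K"
  shows "(\<Sum>p\<in>grid_box K. bdiff d (fdiff d u) p * bdiff e (fdiff e u) p) =
    (\<Sum>p\<in>grid_box K. (fdiff e (fdiff d u) p)\<^sup>2)"
proof -
  have "(\<Sum>p\<in>grid_box K. bdiff d (fdiff d u) p * bdiff e (fdiff e u) p) =
      - (\<Sum>p\<in>grid_box K. bdiff e (fdiff d (fdiff e u)) p * fdiff d u p)"
    using u by (subst summation_by_parts) (auto simp: fdiff_bdiff mult.commute)
  also have "\<dots> = (\<Sum>p\<in>grid_box K. fdiff d (fdiff e u) p * fdiff e (fdiff d u) p)"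
    using u by (subst summation_by_parts) auto
  finally show ?thesis by (simp add: fdiff_commute[of d e] power2_eq_square)
qed

text \<open>The squared Laplacian expands into nine products, and each of them, the mixed ones
  included, sums to a square. Hence every single second difference is controlled with constant
  1.\<close>

lemma sum_laplace_h_squared:
  assumes u: "u \<in> C_per K" and h: "h \<noteq> 0"
  shows "(\<Sum>d\<in>UNIV. \<Sum>e\<in>UNIV. \<Sum>p\<in>grid_box K. (fdiff e (fdiff d u) p)\<^sup>2) =
    h ^ 4 * (\<Sum>p\<in>grid_box K. (laplace_h h u p)\<^sup>2)"
proof -
  have "h ^ 4 * (\<Sum>p\<in>grid_box K. (laplace_h h u p)\<^sup>2) =
      (\<Sum>p\<in>grid_box K. (\<Sum>d\<in>UNIV. bdiff d (fdiff d u) p)\<^sup>2)"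
    using h by (simp add: laplace_h_fdiff sum_distrib_left power_divide flip: power_mult)
  also have "\<dots> = (\<Sum>p\<in>grid_box K. \<Sum>d\<in>UNIV. \<Sum>e\<in>UNIV.
      bdiff d (fdiff d u) p * bdiff e (fdiff e u) p)"
    by (simp add: power2_eq_square sum_product)
  also have "\<dots> = (\<Sum>d\<in>UNIV. \<Sum>e\<in>UNIV. \<Sum>p\<in>grid_box K.
      bdiff d (fdiff d u) p * bdiff e (fdiff e u) p)"
    by (subst sum.swap, intro sum.cong refl, rule sum.swap)
  finally show ?thesis by (simp add: sum_bdiff_fdiff_mult[OF u])
qed

lemma sum_fdiff_fdiff_squared_le:
  assumes u: "u \<in> C_per K" and h: "h \<noteq> 0"
  shows "(\<Sum>p\<in>grid_box K. (fdiff e (fdiff d u) p)\<^sup>2) \<le> h ^ 4 * (\<Sum>p\<in>grid_box K. (laplace_h h u p)\<^sup>2)"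
proof -
  have "(\<Sum>p\<in>grid_box K. (fdiff e (fdiff d u) p)\<^sup>2) \<le>
      (\<Sum>e\<in>UNIV. \<Sum>p\<in>grid_box K. (fdiff e (fdiff d u) p)\<^sup>2)"
    by (rule member_le_sum) (auto intro: sum_nonneg)
  also have "\<dots> \<le> (\<Sum>d\<in>UNIV. \<Sum>e\<in>UNIV. \<Sum>p\<in>grid_box K. (fdiff e (fdiff d u) p)\<^sup>2)"
    by (rule member_le_sum[where f = "\<lambda>d. \<Sum>e\<in>UNIV. \<Sum>p\<in>grid_box K. (fdiff e (fdiff d u) p)\<^sup>2"])
      (auto intro!: sum_nonneg)
  finally show ?thesis by (simp add: sum_laplace_h_squared[OF u h])
qed

section \<open>One-dimensional estimates along grid lines\<close>

lemma axis_of_nat_Suc: "axis d (int (Suc i)) = axis d (int i) + axis d 1"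
  by (auto simp: vec_eq_iff axis_def)

lemma sum_line_shift:
  assumes u: "u \<in> C_per K"
  shows "(\<Sum>i<num_points K. u (p + axis d (int (Suc i)))) = (\<Sum>i<num_points K. u (p + axis d (int i)))"
  using sum.lessThan_Suc_shift[of "\<lambda>i. u (p + axis d (int i))" "num_points K"]
    sum.lessThan_Suc[of "\<lambda>i. u (p + axis d (int i))" "num_points K"] C_per_plus_axis[OF u, of p d]
  by (simp del: of_nat_Suc)

lemma fdiff_line: "fdiff d u (p + axis d (int i)) = u (p + axis d (int (Suc i))) - u (p + axis d (int i))"
  by (simp only: fdiff_def axis_of_nat_Suc ac_simps)

lemma line_sup_le:
  assumes j: "j < N"
  shows "u p - u (p + axis d (int j)) \<le> (\<Sum>i<N. \<bar>fdiff d u (p + axis d (int i))\<bar>)"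
proof -
  have "u p - u (p + axis d (int j)) = - (\<Sum>i<j. fdiff d u (p + axis d (int i)))"
    unfolding fdiff_line using sum_lessThan_telescope[of "\<lambda>i. u (p + axis d (int i))" j] by simp
  also have "\<dots> \<le> \<bar>\<Sum>i<j. fdiff d u (p + axis d (int i))\<bar>" by simp
  also have "\<dots> \<le> (\<Sum>i<j. \<bar>fdiff d u (p + axis d (int i))\<bar>)" by (rule sum_abs)
  also have "\<dots> \<le> (\<Sum>i<N. \<bar>fdiff d u (p + axis d (int i))\<bar>)"
    using j by (intro sum_mono2) auto
  finally show ?thesis .
qed

text \<open>The estimate by the variation, averaged over the line. Being one-sided, it applies to a
  square as it stands, and with both signs to a function of zero mean.\<close>

lemma line_sup_le_mean:
  assumes N: "N > 0"
  shows "u p \<le> (\<Sum>j<N. u (p + axis d (int j))) / N + (\<Sum>i<N. \<bar>fdiff d u (p + axis d (int i))\<bar>)"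
proof -
  let ?S = "\<Sum>i<N. \<bar>fdiff d u (p + axis d (int i))\<bar>"
  have "(\<Sum>j<N. u p) \<le> (\<Sum>j<N. u (p + axis d (int j)) + ?S)"
  proof (rule sum_mono)
    fix j assume "j \<in> {..<N}"
    then show "u p \<le> u (p + axis d (int j)) + ?S" using line_sup_le[of j N u p d] by simp
  qed
  then show ?thesis using N by (simp add: sum.distrib field_simps)
qed

text \<open>Discrete Agmon inequality: the variation of the square factors as a difference times a
  sum of neighbours, and the Cauchy-Schwarz inequality separates the two. Periodicity makes the
  shifted neighbours sum to the same value.\<close>

lemma line_agmon:
  assumes u: "u \<in> C_per K"
  shows "(u p)\<^sup>2 \<le> (\<Sum>i<num_points K. (u (p + axis d (int i)))\<^sup>2) / num_points K
     + 2 * sqrt (\<Sum>i<num_points K. (u (p + axis d (int i)))\<^sup>2)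
         * sqrt (\<Sum>i<num_points K. (fdiff d u (p + axis d (int i)))\<^sup>2)"
proof -
  let ?N = "num_points K"
  let ?u = "\<lambda>i. u (p + axis d (int i))"
  let ?f = "\<lambda>i. fdiff d u (p + axis d (int i))"
  have "(\<Sum>i<?N. \<bar>fdiff d (\<lambda>p. (u p)\<^sup>2) (p + axis d (int i))\<bar>) = (\<Sum>i<?N. \<bar>?f i * (?u (Suc i) + ?u i)\<bar>)"
    by (simp only: fdiff_line) (simp add: power2_eq_square algebra_simps)
  also have "\<dots> \<le> sqrt (\<Sum>i<?N. (?f i)\<^sup>2) * sqrt (\<Sum>i<?N. (?u (Suc i) + ?u i)\<^sup>2)"
    using L2_set_mult_ineq[of ?f "\<lambda>i. ?u (Suc i) + ?u i" "{..<?N}"]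
    by (simp add: L2_set_def abs_mult)
  finally have 1: "(\<Sum>i<?N. \<bar>fdiff d (\<lambda>p. (u p)\<^sup>2) (p + axis d (int i))\<bar>) \<le>
      sqrt (\<Sum>i<?N. (?f i)\<^sup>2) * sqrt (\<Sum>i<?N. (?u (Suc i) + ?u i)\<^sup>2)" .
  have "(\<Sum>i<?N. (?u (Suc i) + ?u i)\<^sup>2) \<le> (\<Sum>i<?N. 2 * (?u (Suc i))\<^sup>2 + 2 * (?u i)\<^sup>2)"
  proof (rule sum_mono)
    fix i show "(?u (Suc i) + ?u i)\<^sup>2 \<le> 2 * (?u (Suc i))\<^sup>2 + 2 * (?u i)\<^sup>2"
      using zero_le_power2[of "?u (Suc i) - ?u i"] unfolding power2_sum power2_diff by linarith
  qed
  also have "\<dots> = 2\<^sup>2 * (\<Sum>i<?N. (?u i)\<^sup>2)"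
    using sum_line_shift[OF C_per_compose1[OF u, of "\<lambda>x. x\<^sup>2"], of p d]
    by (simp add: sum.distrib flip: sum_distrib_left)
  finally have "sqrt (\<Sum>i<?N. (?u (Suc i) + ?u i)\<^sup>2) \<le> 2 * sqrt (\<Sum>i<?N. (?u i)\<^sup>2)"
    using real_sqrt_le_mono by (fastforce simp: real_sqrt_mult)
  then have "sqrt (\<Sum>i<?N. (?f i)\<^sup>2) * sqrt (\<Sum>i<?N. (?u (Suc i) + ?u i)\<^sup>2) \<le>
      sqrt (\<Sum>i<?N. (?f i)\<^sup>2) * (2 * sqrt (\<Sum>i<?N. (?u i)\<^sup>2))"
    by (rule mult_left_mono) (simp add: sum_nonneg)
  with 1 have "(\<Sum>i<?N. \<bar>fdiff d (\<lambda>p. (u p)\<^sup>2) (p + axis d (int i))\<bar>) \<le>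
      sqrt (\<Sum>i<?N. (?f i)\<^sup>2) * (2 * sqrt (\<Sum>i<?N. (?u i)\<^sup>2))" by linarith
  then show ?thesis
    using line_sup_le_mean[of ?N "\<lambda>p. (u p)\<^sup>2" p d] by (simp add: mult_ac)
qed

lemma sum_fdiff_line_0:
  assumes u: "u \<in> C_per K"
  shows "(\<Sum>i<num_points K. fdiff d u (p + axis d (int i))) = 0"
  unfolding fdiff_line using sum_line_shift[OF u] by (simp add: sum_subtractf)

text \<open>First differences of a periodic function have mean zero on every line, so only the
  variation survives in \<open>line_sup_le_mean\<close>. One factor \<open>N\<close> comes from
  Cauchy-Schwarz and one from summing over the line; with \<open>h * N = L\<close> the constant is
  independent of \<open>h\<close> after scaling.\<close>

lemma poincare_fdiff:
  assumes u: "u \<in> C_per K"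
  shows "(\<Sum>p\<in>grid_box K. (fdiff d u p)\<^sup>2) \<le>
    (real (num_points K))\<^sup>2 * (\<Sum>p\<in>grid_box K. (fdiff d (fdiff d u) p)\<^sup>2)"
proof -
  let ?N = "num_points K"
  let ?g = "fdiff d u"
  have g: "(?g p)\<^sup>2 \<le> ?N * (\<Sum>i<?N. (fdiff d ?g (p + axis d (int i)))\<^sup>2)" for p
  proof -
    let ?S = "\<Sum>i<?N. \<bar>fdiff d ?g (p + axis d (int i))\<bar>"
    have n: "fdiff d (\<lambda>p. - ?g p) q = - fdiff d ?g q" for q by (simp add: fdiff_def)
    have "\<bar>?g p\<bar> \<le> ?S"
      using line_sup_le_mean[of ?N ?g p d] line_sup_le_mean[of ?N "\<lambda>p. - ?g p" p d]
        sum_fdiff_line_0[OF u, of d p] by (simp add: n sum_negf)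
    then have "(?g p)\<^sup>2 \<le> ?S\<^sup>2" by (rule abs_le_square_iff[THEN iffD1, OF order_trans]) simp
    also have "\<dots> \<le> (\<Sum>i<?N. (fdiff d ?g (p + axis d (int i)))\<^sup>2) * ?N"
      using Cauchy_Schwarz_ineq_sum[of "\<lambda>i. \<bar>fdiff d ?g (p + axis d (int i))\<bar>" "\<lambda>_. 1" "{..<?N}"]
      by simp
    finally show ?thesis by (simp add: mult.commute)
  qed
  have "(\<Sum>p\<in>grid_box K. (?g p)\<^sup>2) \<le>
      (\<Sum>p\<in>grid_box K. ?N * (\<Sum>i<?N. (fdiff d ?g (p + axis d (int i)))\<^sup>2))"
    by (rule sum_mono[OF g])
  also have "\<dots> = ?N * (\<Sum>i<?N. \<Sum>p\<in>grid_box K. (fdiff d ?g (p + axis d (int i)))\<^sup>2)"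
    by (subst sum.swap) (simp add: sum_distrib_left)
  also have "\<dots> = ?N * (\<Sum>i<?N. \<Sum>p\<in>grid_box K. (fdiff d ?g p)\<^sup>2)"
    using sum_grid_box_shift_axis[OF C_per_compose1[where f = "\<lambda>x. x\<^sup>2", OF C_per_fdiff[OF C_per_fdiff[OF u]]]]
    by simp
  finally show ?thesis by (simp add: power2_eq_square)
qed

lemma sum_fdiff_squared_le:
  assumes u: "u \<in> C_per K" and h: "h \<noteq> 0"
  shows "(\<Sum>p\<in>grid_box K. (fdiff d u p)\<^sup>2) \<le>
    (real (num_points K))\<^sup>2 * (h ^ 4 * (\<Sum>p\<in>grid_box K. (laplace_h h u p)\<^sup>2))"
  by (rule order_trans[OF poincare_fdiff[OF u]], rule mult_left_mono,
      rule sum_fdiff_fdiff_squared_le[OF u h]) simp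

text \<open>Used first across lines in direction \<open>e\<close>, to control the sum over one line in direction \<open>d\<close>,
  and then along that line, the line estimate gains a factor \<open>sqrt h\<close> over the bound of a point value
  by the differences on a single line. Without this gain the gradient error would not tend to zero.\<close>

lemma fdiff_sup_le:
  fixes h L :: real
  assumes u: "u \<in> C_per K" and h: "h > 0" and L: "L = h * num_points K"
  defines "W \<equiv> \<Sum>p\<in>grid_box K. (laplace_h h u p)\<^sup>2"
  shows "(fdiff d u p)\<^sup>2 \<le> 7 * h ^ 3 * sqrt (L * h) * W"
proof -
  let ?N = "num_points K"
  let ?g = "fdiff d u"
  have g: "?g \<in> C_per K" using u by simp
  have N: "real ?N \<ge> 1" using num_points_pos[of K] by linarith
  have hL: "h \<le> L" using N h by (simp add: L)
  have Lp: "L > 0" using h hL by linarith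
  have W: "W \<ge> 0" by (simp add: W_def sum_nonneg)
  have "\<exists>e. d \<noteq> e"
  proof (cases "d = 1")
    case True
    then have "d \<noteq> 2" by simp
    then show ?thesis by blast
  qed blast
  then obtain e where e: "d \<noteq> e" by blast
  define A where "A = (\<Sum>i<?N. (?g (p + axis d (int i)))\<^sup>2)"
  let ?a = "\<lambda>i. \<Sum>j<?N. (?g (p + axis d (int i) + axis e (int j)))\<^sup>2"
  let ?b = "\<lambda>i. \<Sum>j<?N. (fdiff e ?g (p + axis d (int i) + axis e (int j)))\<^sup>2"
  have F: "(\<Sum>p\<in>grid_box K. (?g p)\<^sup>2) \<le> L\<^sup>2 * h\<^sup>2 * W"
    using sum_fdiff_squared_le[OF u, of h d] h by (simp add: L W_def power_mult_distrib power_numeral_reduce mult_ac)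
  have G: "(\<Sum>p\<in>grid_box K. (fdiff e ?g p)\<^sup>2) \<le> h ^ 4 * W" for e
    using sum_fdiff_fdiff_squared_le[OF u, of h e d] h by (simp add: W_def)
  have sa: "(\<Sum>i<?N. ?a i) \<le> L\<^sup>2 * h\<^sup>2 * W"
    using sum_plane_le_sum_grid_box[OF C_per_compose1[where f = "\<lambda>x. x\<^sup>2", OF g] _ e, of p] F by simp
  have sb: "(\<Sum>i<?N. ?b i) \<le> h ^ 4 * W"
    using sum_plane_le_sum_grid_box[OF C_per_compose1[where f = "\<lambda>x. x\<^sup>2", OF C_per_fdiff[OF g]] _ e, of e p] G[of e]
    by simp
  \<comment> \<open>Every point of the \<open>d\<close>-line is bounded along its own
    \<open>e\<close>-line. Cauchy-Schwarz over the points then produces sums over a plane, to which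
    \<open>F\<close> and \<open>G\<close> apply.\<close>
  have "A \<le> (\<Sum>i<?N. ?a i / ?N + 2 * (sqrt (?a i) * sqrt (?b i)))"
    unfolding A_def by (rule sum_mono) (use line_agmon[OF g, of _ e] in \<open>simp add: mult.assoc\<close>)
  also have "\<dots> = (\<Sum>i<?N. ?a i) / ?N + 2 * (\<Sum>i<?N. \<bar>sqrt (?a i)\<bar> * \<bar>sqrt (?b i)\<bar>)"
    by (simp add: sum.distrib sum_divide_distrib sum_distrib_left sum_nonneg)
  also have "\<dots> \<le> (\<Sum>i<?N. ?a i) / ?N + 2 * (sqrt (\<Sum>i<?N. ?a i) * sqrt (\<Sum>i<?N. ?b i))"
    using L2_set_mult_ineq[of "\<lambda>i. sqrt (?a i)" "\<lambda>i. sqrt (?b i)" "{..<?N}"]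
    by (simp add: L2_set_def sum_nonneg)
  also have "\<dots> \<le> (L\<^sup>2 * h\<^sup>2 * W) / ?N + 2 * (sqrt (L\<^sup>2 * h\<^sup>2 * W) * sqrt (h ^ 4 * W))"
    using sa sb by (intro add_mono divide_right_mono mult_left_mono mult_mono real_sqrt_le_mono) (auto intro!: sum_nonneg simp: W)
  also have "(L\<^sup>2 * h\<^sup>2 * W) / ?N = L * h ^ 3 * W"
    using N h by (simp add: L power2_eq_square power3_eq_cube)
  also have "sqrt (L\<^sup>2 * h\<^sup>2 * W) * sqrt (h ^ 4 * W) = L * h ^ 3 * W"
  proof -
    have "(L\<^sup>2 * h\<^sup>2 * W) * (h ^ 4 * W) = (L * h ^ 3 * W)\<^sup>2"
      by (simp add: power2_eq_square power3_eq_cube power4_eq_xxxx mult_ac)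
    then have "sqrt (L\<^sup>2 * h\<^sup>2 * W) * sqrt (h ^ 4 * W) = sqrt ((L * h ^ 3 * W)\<^sup>2)"
      by (simp only: real_sqrt_mult[symmetric])
    then show ?thesis using Lp h W by simp
  qed
  finally have A: "A \<le> 3 * (L * h ^ 3 * W)" by (simp add: mult_ac)
  have B: "(\<Sum>i<?N. (fdiff d ?g (p + axis d (int i)))\<^sup>2) \<le> h ^ 4 * W"
  proof -
    let ?v = "\<lambda>p. (fdiff d ?g p)\<^sup>2"
    have "(\<Sum>i<?N. ?v (p + axis d (int i))) \<le> (\<Sum>i<?N. \<Sum>j<?N. ?v (p + axis d (int i) + axis e (int j)))"
    proof (rule sum_mono)
      fix i
      have "?v (p + axis d (int i) + axis e (int 0)) \<le> (\<Sum>j<?N. ?v (p + axis d (int i) + axis e (int j)))"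
        by (rule member_le_sum[where f = "\<lambda>j. ?v (p + axis d (int i) + axis e (int j))"]) auto
      then show "?v (p + axis d (int i)) \<le> (\<Sum>j<?N. ?v (p + axis d (int i) + axis e (int j)))" by simp
    qed
    also have "\<dots> \<le> (\<Sum>p\<in>grid_box K. ?v p)"
      by (rule sum_plane_le_sum_grid_box[OF C_per_compose1[where f = "\<lambda>x. x\<^sup>2"] _ e]) (use g in auto)
    finally show ?thesis using G[of d] by linarith
  qed
  \<comment> \<open>Second use, along the \<open>d\<close>-line itself. The bound for
    \<open>A\<close> has one more factor \<open>h\<close> than the plane bound
    \<open>L\<^sup>2 * h\<^sup>2 * W\<close>; under the square root this becomes the gained
    \<open>sqrt h\<close>.\<close>
  have "(?g p)\<^sup>2 \<le> A / ?N + 2 * (sqrt A * sqrt (\<Sum>i<?N. (fdiff d ?g (p + axis d (int i)))\<^sup>2))"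
    using line_agmon[OF g, of p d] by (simp add: A_def mult.assoc)
  also have "\<dots> \<le> 3 * (L * h ^ 3 * W) / ?N + 2 * (sqrt (3 * (L * h ^ 3 * W)) * sqrt (h ^ 4 * W))"
    using A B by (intro add_mono divide_right_mono mult_left_mono mult_mono real_sqrt_le_mono)
      (auto intro!: sum_nonneg simp: A_def W Lp[THEN less_imp_le] h[THEN less_imp_le])
  also have "3 * (L * h ^ 3 * W) / ?N = 3 * (h ^ 3 * h * W)"
    using N by (simp add: L)
  also have "sqrt (3 * (L * h ^ 3 * W)) * sqrt (h ^ 4 * W) = sqrt 3 * (h ^ 3 * sqrt (L * h) * W)"
  proof -
    have "(3 * (L * h ^ 3 * W)) * (h ^ 4 * W) = 3 * (L * h) * (h ^ 3 * W)\<^sup>2"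
      by (simp add: power2_eq_square power3_eq_cube power4_eq_xxxx mult_ac)
    then have "sqrt (3 * (L * h ^ 3 * W)) * sqrt (h ^ 4 * W) = sqrt (3 * (L * h) * (h ^ 3 * W)\<^sup>2)"
      by (simp only: real_sqrt_mult[symmetric])
    also have "sqrt (3 * (L * h) * (h ^ 3 * W)\<^sup>2) = sqrt 3 * sqrt (L * h) * (h ^ 3 * W)"
      using h W by (subst real_sqrt_mult, subst real_sqrt_mult[of 3]) simp
    finally show ?thesis by (simp add: mult_ac)
  qed
  \<comment> \<open>The constant 7 is 3 + 2 * 2: here \<open>sqrt 3\<close> is rounded up to 2, and
    \<open>h\<close> is at most \<open>sqrt (L * h)\<close>.\<close>
  also have "3 * (h ^ 3 * h * W) + 2 * (sqrt 3 * (h ^ 3 * sqrt (L * h) * W)) \<le>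
      3 * (h ^ 3 * sqrt (L * h) * W) + 2 * (2 * (h ^ 3 * sqrt (L * h) * W))"
  proof -
    have "h \<le> sqrt (L * h)" using hL h by (intro real_le_rsqrt) (simp add: power2_eq_square)
    moreover have "sqrt 3 \<le> 2" by (rule real_le_lsqrt) auto
    ultimately show ?thesis using h W Lp
      by (intro add_mono mult_left_mono mult_right_mono) auto
  qed
  finally show ?thesis by (simp add: mult_ac)
qed

section \<open>The mobility averages\<close>

text \<open>All four averages turn the Slotboom flux into a flux whose two weights depend on the
  potential difference across the face only.\<close>

fun face_weight :: "mobility \<Rightarrow> real \<Rightarrow> real" where
  "face_weight Harmonic x = 2 / (1 + exp (- x))"
| "face_weight Geometric x = exp (x / 2)"
| "face_weight Arithmetic x = (exp x + 1) / 2"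
| "face_weight Entropic x = (if x = 0 then 1 else x / (1 - exp (- x)))"

text \<open>Adding a constant to both arguments of a mean divides it by the exponential of that
  constant, so the product with one end exponential depends on the difference alone. All means are
  symmetric, which gives the second identity from the first.\<close>

lemma mobility_mean_exp:
  "mobility_mean \<mu> r s * exp s = face_weight \<mu> (s - r)"
  "mobility_mean \<mu> r s * exp r = face_weight \<mu> (r - s)"
proof -
  have pos: "exp s + exp r > 0" "exp s + exp r \<noteq> 0" for r s :: real
    by (simp_all add: add_pos_pos) (metis add_pos_pos exp_gt_zero less_irrefl)
  have sym: "mobility_mean \<mu> s r = mobility_mean \<mu> r s" for r s
    by (cases \<mu>) (auto simp: divide_simps algebra_simps)
  have *: "mobility_mean \<mu> r s * exp s = face_weight \<mu> (s - r)" for r s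
  proof (cases \<mu>)
    case Harmonic
    then show ?thesis using pos[of s r] by (simp add: exp_diff divide_simps)
  next
    case Geometric
    then show ?thesis by (simp flip: exp_add add: field_simps)
  next
    case Arithmetic
    then show ?thesis by (simp add: exp_diff exp_minus field_simps)
  next
    case Entropic
    then show ?thesis by (simp add: exp_diff exp_minus field_simps)
  qed
  show "mobility_mean \<mu> r s * exp s = face_weight \<mu> (s - r)" by (rule *)
  show "mobility_mean \<mu> r s * exp r = face_weight \<mu> (r - s)" using *[of s r] sym by simp
qed

section \<open>Lipschitz and consistency bounds for the face weights\<close>

lemma exp_quadratic_bounds:
  fixes y :: real
  assumes "\<bar>y\<bar> \<le> 1"
  shows "\<bar>exp y - 1 - y\<bar> \<le> y\<^sup>2"
proof -
  have "exp y \<le> 1 + y + y\<^sup>2"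
  proof (cases "y \<ge> 0")
    case True
    then show ?thesis using exp_bound[of y] assms by simp
  next
    case False
    define z where "z = - y"
    have z: "0 < z" "y = - z" using False by (auto simp: z_def)
    \<comment> \<open>The factorization of \<open>1 + z ^ 3\<close>, combined with
      \<open>1 + z \<le> exp z\<close>, gives the upper bound 1 - z + z^2 for
      \<open>exp (- z)\<close>.\<close>
    have "1 \<le> 1 + z ^ 3" using z by simp
    also have "\<dots> = (1 - z + z\<^sup>2) * (1 + z)" by (simp add: power2_eq_square power3_eq_cube algebra_simps)
    also have "\<dots> \<le> (1 - z + z\<^sup>2) * exp z"
    proof (rule mult_left_mono)
      have "0 \<le> (1 - z)\<^sup>2 + z" using z by simp
      then show "0 \<le> 1 - z + z\<^sup>2" by (simp add: power2_eq_square algebra_simps)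
    qed (rule exp_ge_add_one_self)
    finally show ?thesis by (simp add: z(2) exp_minus field_simps)
  qed
  with exp_ge_add_one_self[of y] show ?thesis by linarith
qed

lemma exp_minus_mult_le_1: "exp (- x) * (1 + x) \<le> (1::real)"
proof -
  have "exp (- x) * (1 + x) \<le> exp (- x) * exp x" by (intro mult_left_mono) auto
  then show ?thesis by (simp flip: exp_add)
qed

text \<open>The quotient is the derivative of x / (1 - exp (-x)), the Bernoulli function of the
  Scharfetter-Gummel flux at -x. It lies between 0 and 1: the lower bound is
  \<open>exp (- x) * (1 + x) \<le> 1\<close>, the upper one
  \<open>1 - x \<le> exp (- x)\<close>.\<close>

lemma entropic_weight_deriv_bounds:
  fixes x :: real
  assumes x: "x \<noteq> 0"
  shows "\<bar>(1 - exp (- x) - x * exp (- x)) / (1 - exp (- x))\<^sup>2\<bar> \<le> 1"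
proof -
  have p: "(1 - exp (- x))\<^sup>2 > 0" using x by simp
  have 1: "0 \<le> 1 - exp (- x) - x * exp (- x)"
    using exp_minus_mult_le_1[of x] by (simp add: algebra_simps)
  have "exp (- x) * (1 - x) \<le> exp (- x) * exp (- x)"
    using exp_ge_add_one_self[of "- x"] by (intro mult_left_mono) auto
  then have 2: "1 - exp (- x) - x * exp (- x) \<le> (1 - exp (- x))\<^sup>2"
    by (simp add: power2_eq_square algebra_simps)
  from 1 2 p show ?thesis by simp
qed

lemma entropic_weight_lipschitz_same_sign:
  fixes x y :: real
  assumes "(0 < x \<and> 0 < y) \<or> (x < 0 \<and> y < 0)"
  shows "\<bar>x / (1 - exp (- x)) - y / (1 - exp (- y))\<bar> \<le> \<bar>x - y\<bar>"
proof -
  let ?S = "if 0 < x then {0<..} else {..<0} :: real set"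
  have "norm (x / (1 - exp (- x)) - y / (1 - exp (- y))) \<le> 1 * norm (x - y)"
  proof (rule field_differentiable_bound[where S = ?S
        and f = "\<lambda>x. x / (1 - exp (- x))" and f' = "\<lambda>x. (1 - exp (- x) - x * exp (- x)) / (1 - exp (- x))\<^sup>2"])
    fix z assume "z \<in> ?S"
    then have z: "z \<noteq> 0" by (auto split: if_splits)
    then show "((\<lambda>x. x / (1 - exp (- x))) has_real_derivative
        (1 - exp (- z) - z * exp (- z)) / (1 - exp (- z))\<^sup>2) (at z within ?S)"
      by (auto intro!: derivative_eq_intros simp: power2_eq_square)
    show "norm ((1 - exp (- z) - z * exp (- z)) / (1 - exp (- z))\<^sup>2) \<le> 1"
      using entropic_weight_deriv_bounds[OF z] by simp
  qed (use assms in auto)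
  then show ?thesis by simp
qed

lemma entropic_weight_at_0:
  fixes x :: real
  assumes x: "x \<noteq> 0"
  shows "\<bar>x / (1 - exp (- x)) - 1\<bar> \<le> \<bar>x\<bar>"
proof -
  have a: "1 - exp (- x) \<le> x" using exp_ge_add_one_self[of "- x"] by linarith
  have b: "x \<le> (1 + x) * (1 - exp (- x))"
    using exp_minus_mult_le_1[of x] by (simp add: algebra_simps)
  show ?thesis
  proof (cases "x > 0")
    case True
    then have "1 - exp (- x) > 0" by simp
    then have "1 \<le> x / (1 - exp (- x))" "x / (1 - exp (- x)) \<le> 1 + x"
      using a b by (simp_all only: le_divide_eq divide_le_eq) simp_all
    then show ?thesis using True by simp
  next
    case False
    then have neg: "x < 0" "1 - exp (- x) < 0" using x by auto
    then have "x / (1 - exp (- x)) \<le> 1" "1 + x \<le> x / (1 - exp (- x))"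
      using a b by (simp_all only: le_divide_eq divide_le_eq) simp_all
    then show ?thesis using neg by simp
  qed
qed

text \<open>The formula degenerates at 0, so the mean value inequality is used on each half-line
  only. For arguments of opposite sign the comparison with the value 1 at 0 loses nothing, because
  then \<bar>x - y\<bar> is \<bar>x\<bar> + \<bar>y\<bar>.\<close>

lemma entropic_weight_lipschitz:
  "\<bar>face_weight Entropic x - face_weight Entropic y\<bar> \<le> \<bar>x - y\<bar>"
proof -
  consider "(0 < x \<and> 0 < y) \<or> (x < 0 \<and> y < 0)" | "x = 0" | "y = 0"
    | "x < 0" "0 < y" | "0 < x" "y < 0" by linarith
  then show ?thesis
  proof cases
    case 1
    then show ?thesis using entropic_weight_lipschitz_same_sign[OF 1] by auto
  next
    case 2
    then show ?thesis using entropic_weight_at_0[of y] by (auto simp: abs_minus_commute)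
  next
    case 3
    then show ?thesis using entropic_weight_at_0[of x] by auto
  next
    case 4
    then show ?thesis using entropic_weight_at_0[of x] entropic_weight_at_0[of y] by auto
  next
    case 5
    then show ?thesis using entropic_weight_at_0[of x] entropic_weight_at_0[of y] by auto
  qed
qed

lemma face_weight_0 [simp]: "face_weight \<mu> 0 = 1"
  by (cases \<mu>) auto

text \<open>The geometric and the arithmetic weight grow exponentially, hence the restriction to
  [-1, 1]. The arguments in use are a valence times \<open>h\<close> times a discrete gradient,
  which is small. The constant 6 is twice the bound 3 for \<open>exp 1\<close>.\<close>

lemma face_weight_lipschitz:
  assumes "\<bar>x\<bar> \<le> 1" "\<bar>y\<bar> \<le> 1"
  shows "\<bar>face_weight \<mu> x - face_weight \<mu> y\<bar> \<le> 6 * \<bar>x - y\<bar>"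
proof (cases "\<mu> = Entropic")
  case True
  then show ?thesis using order_trans[OF entropic_weight_lipschitz[of x y], of "6 * \<bar>x - y\<bar>"] by simp
next
  case False
  define g where "g z = (case \<mu> of Harmonic \<Rightarrow> 2 * exp (- z) / (1 + exp (- z))\<^sup>2
    | Geometric \<Rightarrow> exp (z / 2) / 2 | _ \<Rightarrow> exp z / 2)" for z :: real
  have "norm (face_weight \<mu> x - face_weight \<mu> y) \<le> 6 * norm (x - y)"
  proof (rule field_differentiable_bound[where S = "{-1..1}" and f = "face_weight \<mu>" and f' = g])
    fix z :: real assume z: "z \<in> {-1..1}"
    have ne: "1 + exp (- z) \<noteq> 0" "1 + exp (- z) > 0"
      using exp_gt_zero[of "- z"] by linarith+
    show "(face_weight \<mu> has_real_derivative g z) (at z within {-1..1})"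
      using False ne by (cases \<mu>) (auto simp: g_def fun_eq_iff[symmetric] power2_eq_square
          face_weight.simps[abs_def] intro!: derivative_eq_intros)
    have e: "exp w \<le> 3" if "w \<le> 1" for w :: real
      using exp_le order_trans[of "exp w" "exp 1" 3] that by auto
    have "exp (- z) / (1 + exp (- z))\<^sup>2 \<le> exp (- z) / 1"
      using ne by (intro divide_left_mono) auto
    also have "\<dots> \<le> 3" using e[of "- z"] z by simp
    finally have "2 * exp (- z) / (1 + exp (- z))\<^sup>2 \<le> 6" by simp
    then show "norm (g z) \<le> 6"
      using False e[of z] e[of "z / 2"] z by (cases \<mu>) (auto simp: g_def)
  qed (use assms in auto)
  then show ?thesis by simp
qed

text \<open>This property makes the four schemes consistent: the difference of the two weights
  multiplies the face average of the concentration and has to reproduce the drift. The argument is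
  of order \<open>h\<close> and the flux divides by \<open>h\<close>, so a quadratic error leaves
  order \<open>h\<close>. For the entropic mean the difference is exactly \<open>x\<close>.\<close>

lemma face_weight_odd_part:
  assumes x: "\<bar>x\<bar> \<le> 1"
  shows "\<bar>face_weight \<mu> x - face_weight \<mu> (- x) - x\<bar> \<le> 6 * x\<^sup>2"
proof -
  have q: "\<bar>exp x - 1 - x\<bar> \<le> x\<^sup>2" "\<bar>exp (- x) - 1 - (- x)\<bar> \<le> x\<^sup>2"
    "\<bar>exp (x / 2) - 1 - x / 2\<bar> \<le> x\<^sup>2 / 4" "\<bar>exp (- (x / 2)) - 1 - (- (x / 2))\<bar> \<le> x\<^sup>2 / 4"
    using exp_quadratic_bounds[of x] exp_quadratic_bounds[of "- x"]
      exp_quadratic_bounds[of "x / 2"] exp_quadratic_bounds[of "- (x / 2)"] x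
    by (simp_all add: power_divide)
  have x2: "x\<^sup>2 \<ge> 0" by simp
  show ?thesis
  proof (cases \<mu>)
    case Harmonic
    have p: "1 + exp x > 1" "1 + exp x \<noteq> 0" using exp_gt_zero[of x] by linarith+
    have "\<bar>x\<bar> * \<bar>x\<bar> \<le> \<bar>x\<bar> * 1" using x by (intro mult_left_mono) auto
    then have sq: "x\<^sup>2 \<le> \<bar>x\<bar>" by (simp add: power2_eq_square)
    have "\<bar>exp x - 1\<bar> \<le> 2 * \<bar>x\<bar>" using q(1) sq by linarith
    then have "\<bar>x\<bar> * \<bar>exp x - 1\<bar> \<le> \<bar>x\<bar> * (2 * \<bar>x\<bar>)" by (rule mult_left_mono) simp
    then have 1: "\<bar>x * (exp x - 1)\<bar> \<le> 2 * x\<^sup>2" by (simp add: abs_mult power2_eq_square)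
    have "face_weight \<mu> x - face_weight \<mu> (- x) - x = (2 * (exp x - 1 - x) - x * (exp x - 1)) / (1 + exp x)"
    proof -
      have "1 + exp (- x) = (1 + exp x) / exp x" by (simp add: exp_minus field_simps)
      then have "face_weight \<mu> x = 2 * exp x / (1 + exp x)" by (simp add: Harmonic)
      moreover have "face_weight \<mu> (- x) = 2 / (1 + exp x)" by (simp add: Harmonic)
      ultimately show ?thesis using p by (simp add: field_simps)
    qed
    also have "\<bar>\<dots>\<bar> = \<bar>2 * (exp x - 1 - x) - x * (exp x - 1)\<bar> / (1 + exp x)"
      using p by (simp add: abs_divide)
    also have "\<dots> \<le> \<bar>2 * (exp x - 1 - x) - x * (exp x - 1)\<bar> / 1"
      using p by (intro divide_left_mono) (auto intro: add_pos_pos)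
    also have "\<dots> \<le> 6 * x\<^sup>2" using 1 q(1) x2 by (simp add: abs_le_iff)
    finally show ?thesis .
  next
    case Geometric
    then have "face_weight \<mu> x = exp (x / 2)" "face_weight \<mu> (- x) = exp (- (x / 2))" by simp_all
    then show ?thesis using q(3,4) x2 by linarith
  next
    case Arithmetic
    then have eq: "face_weight \<mu> x - face_weight \<mu> (- x) - x = ((exp x - 1 - x) - (exp (- x) - 1 - (- x))) / 2"
      by (simp add: field_simps)
    have "\<bar>(A - B) / 2\<bar> \<le> 6 * r" if "\<bar>A\<bar> \<le> r" "\<bar>B\<bar> \<le> r" "0 \<le> r" for A B r :: real
      using that abs_triangle_ineq4[of A B] by simp
    then show ?thesis unfolding eq using q(1,2) x2 .
  next
    case Entropic
    show ?thesis
    proof (cases "x = 0")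
      case False
      then have ne: "exp x - 1 \<noteq> 0" by simp
      have "1 - exp (- x) = (exp x - 1) / exp x" by (simp add: exp_minus diff_divide_distrib inverse_eq_divide)
      then have "face_weight \<mu> x = x * exp x / (exp x - 1)" using False by (simp add: Entropic)
      moreover have "face_weight \<mu> (- x) = x / (exp x - 1)"
        using False minus_divide_divide[of x "1 - exp x"] by (simp add: Entropic)
      ultimately have "face_weight \<mu> x - face_weight \<mu> (- x) = (x * (exp x - 1)) / (exp x - 1)"
        by (simp add: diff_divide_distrib right_diff_distrib)
      then have "face_weight \<mu> x - face_weight \<mu> (- x) = x" using ne by simp
      then show ?thesis using x2 by simp
    qed (simp add: Entropic)
  qed
qed

text \<open>With the exponentials eliminated, the estimates involve the discrete gradient of the
  potential but never the size of the potential itself.\<close>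

definition slotboom_flux :: "mobility \<Rightarrow> real \<Rightarrow> real \<Rightarrow> cell_fun \<Rightarrow> cell_fun \<Rightarrow> face_field" where
  "slotboom_flux \<mu> h z c \<psi> d p =
     (c (p + axis d 1) * face_weight \<mu> (z * (\<psi> (p + axis d 1) - \<psi> p))
      - c p * face_weight \<mu> (z * (\<psi> p - \<psi> (p + axis d 1)))) / h"

lemma slotboom_flux_eq:
  "mobility_face \<mu> (\<lambda>s. z * \<psi> s) d r * grad_h h (\<lambda>s. c s * exp (z * \<psi> s)) d r
    = slotboom_flux \<mu> h z c \<psi> d r"
proof -
  let ?m = "mobility_mean \<mu> (z * \<psi> r) (z * \<psi> (r + axis d 1))"
  have "mobility_face \<mu> (\<lambda>s. z * \<psi> s) d r * grad_h h (\<lambda>s. c s * exp (z * \<psi> s)) d r =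
      (c (r + axis d 1) * (?m * exp (z * \<psi> (r + axis d 1))) - c r * (?m * exp (z * \<psi> r))) / h"
    by (simp add: mobility_face_def grad_h_def right_diff_distrib mult_ac)
  then show ?thesis unfolding mobility_mean_exp by (simp add: slotboom_flux_def right_diff_distrib)
qed

section \<open>Stability of the discrete error equations\<close>

lemma power2_le_if_abs_le: "\<bar>x\<bar> \<le> y \<Longrightarrow> x\<^sup>2 \<le> (y::real)\<^sup>2"
  using power_mono[of "\<bar>x\<bar>" y 2] by simp

lemma power2_diff_le: "(x - y)\<^sup>2 \<le> 2 * (y\<^sup>2 + (x::real)\<^sup>2)"
  using zero_le_power2[of "x + y"] by (simp add: power2_eq_square algebra_simps)

lemma power2_sum4_le: "(x + y + z + w)\<^sup>2 \<le> 4 * (x\<^sup>2 + y\<^sup>2 + z\<^sup>2 + (w::real)\<^sup>2)"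
proof -
  have "0 \<le> (x - y)\<^sup>2 + (x - z)\<^sup>2 + (x - w)\<^sup>2 + (y - z)\<^sup>2 + (y - w)\<^sup>2 + (z - w)\<^sup>2"
    by (intro add_nonneg_nonneg) auto
  then show ?thesis by (simp add: power2_eq_square algebra_simps)
qed

lemma C_per_slotboom_flux:
  assumes "c \<in> C_per K" "\<psi> \<in> C_per K"
  shows "slotboom_flux \<mu> h z c \<psi> d \<in> C_per K"
  unfolding slotboom_flux_def[abs_def]
  by (rule C_per_compose4[OF C_per_shift[OF assms(1)] C_per_shift[OF assms(2)] assms,
        of "\<lambda>c1 p1 c0 p0. (c1 * face_weight \<mu> (z * (p1 - p0)) - c0 * face_weight \<mu> (z * (p0 - p1))) / h"
        "axis d 1" "axis d 1"])

text \<open>Backward Euler energy estimate: the equation is tested with the new error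
  \<open>e'\<close>. The flux is the gradient of \<open>e'\<close> up to a perturbation, so half of
  the dissipation absorbs the mixed term and the other half stays on the left. In the application
  \<open>\<phi>\<close> is the potential error at the old level and \<open>\<eta>\<close> the
  consistency error.\<close>

lemma energy_step:
  assumes e: "e \<in> C_per K" and e': "e' \<in> C_per K" and Fl: "\<And>d. Fl d \<in> C_per K"
    and h: "h > 0" and dt: "\<Delta>t > 0" and b: "b \<ge> 0"
    and eq: "\<And>p. (e' p - e p) / \<Delta>t = div_h h Fl p + s p"
    and flux: "\<And>d p. \<bar>Fl d p - grad_h h e' d p\<bar> \<le>
        b * (\<bar>e' (p + axis d 1)\<bar> + \<bar>e' p\<bar> + \<bar>grad_h h \<phi> d p\<bar>) + \<eta>"
    and s: "\<And>p. \<bar>s p\<bar> \<le> \<eta>"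
  shows "(\<Sum>p\<in>grid_box K. (e' p)\<^sup>2) - (\<Sum>p\<in>grid_box K. (e p)\<^sup>2)
      + \<Delta>t * (\<Sum>p\<in>grid_box K. \<Sum>d\<in>UNIV. (grad_h h e' d p)\<^sup>2)
    \<le> \<Delta>t * ((24 * b\<^sup>2 + 1) * (\<Sum>p\<in>grid_box K. (e' p)\<^sup>2)
        + 4 * b\<^sup>2 * (\<Sum>p\<in>grid_box K. \<Sum>d\<in>UNIV. (grad_h h \<phi> d p)\<^sup>2)
        + 13 * \<eta>\<^sup>2 * card (grid_box K))"
proof -
  let ?D = "grad_h h e'"
  let ?S = "\<lambda>f. \<Sum>p\<in>grid_box K. f p"
  have D: "?S (\<lambda>p. (e' p)\<^sup>2) - ?S (\<lambda>p. (e p)\<^sup>2) \<le> ?S (\<lambda>p. 2 * \<Delta>t * ((div_h h Fl p + s p) * e' p))"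
    unfolding sum_subtractf[symmetric]
  proof (rule sum_mono)
    fix p
    have "e' p - e p = \<Delta>t * (div_h h Fl p + s p)" using eq[of p] dt by (simp add: field_simps)
    then have "2 * ((e' p - e p) * e' p) = 2 * \<Delta>t * ((div_h h Fl p + s p) * e' p)"
      by (simp only: mult.assoc)
    moreover have "(e' p)\<^sup>2 - (e p)\<^sup>2 \<le> 2 * ((e' p - e p) * e' p)"
      using zero_le_power2[of "e' p - e p"] by (simp add: power2_eq_square algebra_simps)
    ultimately show "(e' p)\<^sup>2 - (e p)\<^sup>2 \<le> 2 * \<Delta>t * ((div_h h Fl p + s p) * e' p)" by linarith
  qed
  have "?S (\<lambda>p. 2 * \<Delta>t * ((div_h h Fl p + s p) * e' p)) =
      \<Delta>t * (2 * ?S (\<lambda>p. div_h h Fl p * e' p) + 2 * ?S (\<lambda>p. s p * e' p))"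
    by (simp add: sum_distrib_left sum.distrib algebra_simps)
  also have "2 * ?S (\<lambda>p. div_h h Fl p * e' p) = ?S (\<lambda>p. \<Sum>d\<in>UNIV. - 2 * (Fl d p * ?D d p))"
    using summation_by_parts_div_h[of Fl K e' h, OF Fl e'] by (simp add: sum_distrib_left sum_negf)
  also have "\<Delta>t * (?S (\<lambda>p. \<Sum>d\<in>UNIV. - 2 * (Fl d p * ?D d p)) + 2 * ?S (\<lambda>p. s p * e' p)) \<le>
     \<Delta>t * (?S (\<lambda>p. \<Sum>d\<in>UNIV. - (?D d p)\<^sup>2
        + 4 * (b\<^sup>2 * (e' (p + axis d 1))\<^sup>2 + b\<^sup>2 * (e' p)\<^sup>2 + b\<^sup>2 * (grad_h h \<phi> d p)\<^sup>2 + \<eta>\<^sup>2))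
      + ?S (\<lambda>p. \<eta>\<^sup>2 + (e' p)\<^sup>2))"
  proof (intro mult_left_mono add_mono sum_mono)
    fix p d
    let ?x = "b * \<bar>e' (p + axis d 1)\<bar>" and ?y = "b * \<bar>e' p\<bar>" and ?z = "b * \<bar>grad_h h \<phi> d p\<bar>"
    define P where "P = Fl d p - ?D d p"
    have "\<bar>P\<bar> \<le> ?x + ?y + ?z + \<eta>" using flux[of d p] by (simp add: P_def algebra_simps)
    then have "P\<^sup>2 \<le> (?x + ?y + ?z + \<eta>)\<^sup>2"
      by (rule power2_le_if_abs_le)
    also have "\<dots> \<le> 4 * (?x\<^sup>2 + ?y\<^sup>2 + ?z\<^sup>2 + \<eta>\<^sup>2)"
      by (rule power2_sum4_le)
    finally have "P\<^sup>2 \<le> 4 * (b\<^sup>2 * (e' (p + axis d 1))\<^sup>2 + b\<^sup>2 * (e' p)\<^sup>2 + b\<^sup>2 * (grad_h h \<phi> d p)\<^sup>2 + \<eta>\<^sup>2)"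
      by (simp add: power_mult_distrib)
    \<comment> \<open>The flux is \<open>?D + P\<close>; Young's inequality spends one of the two
      squares of \<open>?D\<close> on the product with \<open>P\<close>.\<close>
    moreover have "- 2 * (Fl d p * ?D d p) \<le> - (?D d p)\<^sup>2 + P\<^sup>2"
      using zero_le_power2[of "?D d p + P"] by (simp add: P_def power2_eq_square algebra_simps)
    ultimately show "- 2 * (Fl d p * ?D d p) \<le> - (?D d p)\<^sup>2
        + 4 * (b\<^sup>2 * (e' (p + axis d 1))\<^sup>2 + b\<^sup>2 * (e' p)\<^sup>2 + b\<^sup>2 * (grad_h h \<phi> d p)\<^sup>2 + \<eta>\<^sup>2)" by linarith
  next
    have "2 * (s p * e' p) \<le> \<eta>\<^sup>2 + (e' p)\<^sup>2" for p
    proof -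
      have "(s p)\<^sup>2 \<le> \<eta>\<^sup>2" using s[of p] by (rule power2_le_if_abs_le)
      then show ?thesis using zero_le_power2[of "s p - e' p"] unfolding power2_diff by linarith
    qed
    then show "2 * ?S (\<lambda>p. s p * e' p) \<le> ?S (\<lambda>p. \<eta>\<^sup>2 + (e' p)\<^sup>2)"
      by (simp add: sum_distrib_left sum_mono)
  qed (use dt in auto)
  \<comment> \<open>Origin of the constants: the unshifted and the shifted values contribute
    \<open>12 * b\<^sup>2\<close> each over three directions, which makes 24; the 13 is 4 per
    direction and 1 from the source \<open>s\<close>.\<close>
  also have "?S (\<lambda>p. \<Sum>d\<in>UNIV. - (?D d p)\<^sup>2
        + 4 * (b\<^sup>2 * (e' (p + axis d 1))\<^sup>2 + b\<^sup>2 * (e' p)\<^sup>2 + b\<^sup>2 * (grad_h h \<phi> d p)\<^sup>2 + \<eta>\<^sup>2)) =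
      - ?S (\<lambda>p. \<Sum>d\<in>UNIV. (?D d p)\<^sup>2) + 4 * b\<^sup>2 * ?S (\<lambda>p. \<Sum>d\<in>UNIV. (e' (p + axis d 1))\<^sup>2)
      + 12 * b\<^sup>2 * ?S (\<lambda>p. (e' p)\<^sup>2) + 4 * b\<^sup>2 * ?S (\<lambda>p. \<Sum>d\<in>UNIV. (grad_h h \<phi> d p)\<^sup>2)
      + 12 * \<eta>\<^sup>2 * card (grid_box K)"
    by (simp add: sum.distrib sum_subtractf sum_distrib_left sum_negf algebra_simps)
  also have "?S (\<lambda>p. \<Sum>d\<in>UNIV. (e' (p + axis d 1))\<^sup>2) = 3 * ?S (\<lambda>p. (e' p)\<^sup>2)"
    using sum_grid_box_shift[OF C_per_compose1[where f = "\<lambda>x. x\<^sup>2", OF e']]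
    by (subst sum.swap) simp
  finally show ?thesis using D by (simp add: sum.distrib algebra_simps)
qed

text \<open>Gronwall for an implicit step: the new value on the right is absorbed because
  \<open>C * \<Delta>t\<close> is at most 1/2. Adding the accumulated \<open>Z\<close> and the
  forcing \<open>H\<close> to \<open>Y\<close> makes the recursion homogeneous, and its factor (1 +
  x) / (1 - x) is at most 1 + 4 x for 0 \<le> x \<le> 1/2, whence the 4 in the exponent.\<close>

lemma gronwall_sum:
  fixes Y Z :: "nat \<Rightarrow> real"
  assumes nn: "\<And>n. Y n \<ge> 0" "\<And>n. Z n \<ge> 0" "H \<ge> 0" "C \<ge> 0" "\<Delta>t \<ge> 0" and small: "2 * (C * \<Delta>t) \<le> 1"
    and step: "\<And>n. n < m \<Longrightarrow> Y (Suc n) - Y n + \<Delta>t * Z (Suc n) \<le> \<Delta>t * (C * (Y (Suc n) + Y n + H))"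
  shows "Y m + \<Delta>t * (\<Sum>k=1..m. Z k) + H \<le> exp (4 * C * (real m * \<Delta>t)) * (Y 0 + H)"
  using step
proof (induction m)
  case (Suc m)
  define V where "V n = Y n + \<Delta>t * (\<Sum>k=1..n. Z k) + H" for n
  define x where "x = C * \<Delta>t"
  have x: "0 \<le> x" "2 * x \<le> 1" using nn small by (auto simp: x_def)
  have V: "Y n + H \<le> V n" "0 \<le> V n" for n
    using nn by (auto simp: V_def sum_nonneg intro!: add_nonneg_nonneg mult_nonneg_nonneg)
  have "V (Suc m) - V m \<le> x * (Y (Suc m) + Y m + H)"
    using Suc.prems[of m] by (simp add: V_def x_def algebra_simps)
  also have "\<dots> \<le> x * (V (Suc m) + V m)"
    using V(1)[of m] V(1)[of "Suc m"] nn(3) x by (intro mult_left_mono) auto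
  finally have 1: "V (Suc m) * (1 - x) \<le> V m * (1 + x)" by (simp add: algebra_simps)
  have "0 \<le> 2 * x * (1 - 2 * x)" using x by (intro mult_nonneg_nonneg) auto
  then have "1 + x \<le> (1 + 4 * x) * (1 - x)" by (simp add: algebra_simps)
  also have "\<dots> \<le> exp (4 * x) * (1 - x)" using exp_ge_add_one_self x by (intro mult_right_mono) auto
  finally have "V m * (1 + x) \<le> V m * (exp (4 * x) * (1 - x))" using V by (intro mult_left_mono)
  with 1 have "V (Suc m) * (1 - x) \<le> (exp (4 * x) * V m) * (1 - x)" by (simp add: mult_ac)
  then have "V (Suc m) \<le> exp (4 * x) * V m" using x by (intro mult_right_le_imp_le[of "V (Suc m)" "1 - x"]) auto
  also have "\<dots> \<le> exp (4 * x) * (exp (4 * C * (real m * \<Delta>t)) * (Y 0 + H))"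
    using Suc.IH Suc.prems by (intro mult_left_mono) (auto simp: V_def)
  also have "\<dots> = exp (4 * C * (real (Suc m) * \<Delta>t)) * (Y 0 + H)"
    by (simp add: x_def algebra_simps flip: exp_add)
  finally show ?case by (simp add: V_def)
qed simp

lemma sum_grad_h_squared_le:
  assumes u: "u \<in> C_per K" and h: "h > 0"
  shows "(\<Sum>p\<in>grid_box K. \<Sum>d\<in>UNIV. (grad_h h u d p)\<^sup>2) \<le>
    3 * (h * num_points K)\<^sup>2 * (\<Sum>p\<in>grid_box K. (laplace_h h u p)\<^sup>2)"
proof -
  let ?W = "\<Sum>p\<in>grid_box K. (laplace_h h u p)\<^sup>2"
  have "(\<Sum>p\<in>grid_box K. (grad_h h u d p)\<^sup>2) \<le> (h * num_points K)\<^sup>2 * ?W" for d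
  proof -
    have "(\<Sum>p\<in>grid_box K. (grad_h h u d p)\<^sup>2) = (\<Sum>p\<in>grid_box K. (fdiff d u p)\<^sup>2) / h\<^sup>2"
      by (simp add: grad_h_fdiff power_divide sum_divide_distrib)
    also have "\<dots> \<le> ((real (num_points K))\<^sup>2 * (h ^ 4 * ?W)) / h\<^sup>2"
      using sum_fdiff_squared_le[OF u, of h d] h by (intro divide_right_mono) auto
    also have "\<dots> = (h * num_points K)\<^sup>2 * ?W"
      using h by (simp add: field_simps power2_eq_square power4_eq_xxxx)
    finally show ?thesis .
  qed
  then have "(\<Sum>d\<in>UNIV. \<Sum>p\<in>grid_box K. (grad_h h u d p)\<^sup>2) \<le> (\<Sum>d::3\<in>UNIV. (h * num_points K)\<^sup>2 * ?W)"
    by (rule sum_mono)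
  then show ?thesis by (subst sum.swap) simp
qed

lemma grad_h_sup_le:
  fixes h L :: real
  assumes u: "u \<in> C_per K" and h: "h > 0" and L: "L = h * num_points K"
  shows "(grad_h h u d p)\<^sup>2 \<le> 7 * h * sqrt (L * h) * (\<Sum>p\<in>grid_box K. (laplace_h h u p)\<^sup>2)"
proof -
  have "(grad_h h u d p)\<^sup>2 = (fdiff d u p)\<^sup>2 / h\<^sup>2" by (simp add: grad_h_fdiff power_divide)
  also have "\<dots> \<le> (7 * h ^ 3 * sqrt (L * h) * (\<Sum>p\<in>grid_box K. (laplace_h h u p)\<^sup>2)) / h\<^sup>2"
    by (intro divide_right_mono fdiff_sup_le[OF u h L]) simp
  also have "\<dots> = 7 * h * sqrt (L * h) * (\<Sum>p\<in>grid_box K. (laplace_h h u p)\<^sup>2)"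
    using h by (simp add: power2_eq_square power3_eq_cube)
  finally show ?thesis .
qed

lemma sum_laplace_h_le:
  assumes \<kappa>: "\<kappa> > 0" and q: "\<And>l. l \<in> {1..M} \<Longrightarrow> \<bar>q l\<bar> \<le> Q"
    and eq: "\<And>p. \<bar>\<kappa> * laplace_h h \<phi> p + (\<Sum>l=1..M. q l * e l p)\<bar> \<le> \<eta>"
  shows "(\<Sum>p\<in>grid_box K. (laplace_h h \<phi> p)\<^sup>2) \<le>
    2 / \<kappa>\<^sup>2 * (real M * Q\<^sup>2 * (\<Sum>l=1..M. \<Sum>p\<in>grid_box K. (e l p)\<^sup>2) + \<eta>\<^sup>2 * card (grid_box K))"
proof -
  have "(laplace_h h \<phi> p)\<^sup>2 \<le> 2 / \<kappa>\<^sup>2 * (real M * Q\<^sup>2 * (\<Sum>l=1..M. (e l p)\<^sup>2) + \<eta>\<^sup>2)" for p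
  proof -
    let ?s = "\<Sum>l=1..M. q l * e l p"
    define w where "w = \<kappa> * laplace_h h \<phi> p + ?s"
    have "?s\<^sup>2 \<le> (\<Sum>l=1..M. (q l * e l p)\<^sup>2) * real M"
      using Cauchy_Schwarz_ineq_sum[of "\<lambda>l. q l * e l p" "\<lambda>_. 1" "{1..M}"] by simp
    also have "(\<Sum>l=1..M. (q l * e l p)\<^sup>2) \<le> (\<Sum>l=1..M. Q\<^sup>2 * (e l p)\<^sup>2)"
      unfolding power_mult_distrib
      by (intro sum_mono mult_right_mono abs_le_square_iff[THEN iffD1]) (use q in fastforce)+
    finally have s: "?s\<^sup>2 \<le> real M * Q\<^sup>2 * (\<Sum>l=1..M. (e l p)\<^sup>2)"
      by (simp add: sum_distrib_left sum_distrib_right mult_ac mult_right_mono)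
    have w: "w\<^sup>2 \<le> \<eta>\<^sup>2"
      using eq[of p] unfolding w_def by (rule power2_le_if_abs_le)
    have "(\<kappa> * laplace_h h \<phi> p)\<^sup>2 = (w - ?s)\<^sup>2" by (simp add: w_def)
    also have "\<dots> \<le> 2 * (?s\<^sup>2 + w\<^sup>2)"
      by (rule power2_diff_le)
    also have "\<dots> \<le> 2 * (real M * Q\<^sup>2 * (\<Sum>l=1..M. (e l p)\<^sup>2) + \<eta>\<^sup>2)" by (intro mult_left_mono add_mono s w) simp
    finally show ?thesis using \<kappa> by (simp add: power_mult_distrib field_simps)
  qed
  then have "(\<Sum>p\<in>grid_box K. (laplace_h h \<phi> p)\<^sup>2) \<le>
      (\<Sum>p\<in>grid_box K. 2 / \<kappa>\<^sup>2 * (real M * Q\<^sup>2 * (\<Sum>l=1..M. (e l p)\<^sup>2) + \<eta>\<^sup>2))"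
    by (rule sum_mono)
  also have "\<dots> = 2 / \<kappa>\<^sup>2 * (real M * Q\<^sup>2 * (\<Sum>p\<in>grid_box K. \<Sum>l=1..M. (e l p)\<^sup>2) + \<eta>\<^sup>2 * card (grid_box K))"
    by (simp only: sum.distrib sum_distrib_left[symmetric] sum_constant) (simp only: mult.commute)
  finally show ?thesis by (subst sum.swap)
qed

text \<open>All weights are 1 + O(h), so the difference of the fluxes is the gradient of the
  concentration error up to terms in which the factor \<open>h\<close> of a weight cancels
  \<open>1 / h\<close>. The change of the weights is charged to the exact concentration, bounded by
  \<open>B\<close>, and the concentration error to weights at the numerical potential; thus the
  numerical concentration is never estimated in the maximum norm.\<close>

lemma slotboom_flux_difference:
  assumes h: "h > 0" and z: "\<bar>z\<bar> \<le> Q"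
    and c: "\<And>p. \<bar>ce p\<bar> \<le> B"
    and e: "\<And>d p. \<bar>grad_h h \<psi>e d p\<bar> \<le> B + 1" and n: "\<And>d p. \<bar>grad_h h \<psi>n d p\<bar> \<le> B + 1"
    and small: "Q * (B + 1) * h \<le> 1"
  shows "\<bar>slotboom_flux \<mu> h z ce \<psi>e d p - slotboom_flux \<mu> h z cn \<psi>n d p
      - grad_h h (\<lambda>p. ce p - cn p) d p\<bar>
    \<le> 12 * Q * (B + 1) * (\<bar>ce (p + axis d 1) - cn (p + axis d 1)\<bar> + \<bar>ce p - cn p\<bar>
      + \<bar>grad_h h (\<lambda>p. \<psi>e p - \<psi>n p) d p\<bar>)"
proof -
  let ?w = "face_weight \<mu>"
  define e1 e0 c1 c0 where v: "e1 = ce (p + axis d 1) - cn (p + axis d 1)" "e0 = ce p - cn p"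
    "c1 = ce (p + axis d 1)" "c0 = ce p"
  define x y where xy: "x = z * (\<psi>e (p + axis d 1) - \<psi>e p)" "y = z * (\<psi>n (p + axis d 1) - \<psi>n p)"
  let ?g = "\<bar>grad_h h (\<lambda>p. \<psi>e p - \<psi>n p) d p\<bar>"
  have B: "B \<ge> 0" using c[of p] by linarith
  have Q: "Q \<ge> 0" using z by linarith
  have xe: "x = z * (h * grad_h h \<psi>e d p)" and yn: "y = z * (h * grad_h h \<psi>n d p)"
    using h by (simp_all add: xy grad_h_def)
  have bd: "\<bar>z * (h * t)\<bar> \<le> Q * (B + 1) * h" if "\<bar>t\<bar> \<le> B + 1" for t
  proof -
    have "\<bar>z\<bar> * (h * \<bar>t\<bar>) \<le> Q * (h * (B + 1))"
      using z that h Q by (intro mult_mono) auto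
    then show ?thesis using h by (simp add: abs_mult mult_ac)
  qed
  have x: "\<bar>x\<bar> \<le> Q * (B + 1) * h" and y: "\<bar>y\<bar> \<le> Q * (B + 1) * h"
    unfolding xe yn by (rule bd, rule e, rule bd, rule n)
  have x1: "\<bar>x\<bar> \<le> 1" "\<bar>y\<bar> \<le> 1" using x y small by linarith+
  have "\<bar>x - y\<bar> = \<bar>z\<bar> * (h * ?g)"
    using h by (simp add: xy grad_h_def abs_mult flip: right_diff_distrib) (simp add: algebra_simps)
  also have "\<dots> \<le> Q * (h * ?g)" using z h by (intro mult_right_mono) auto
  finally have xy': "\<bar>x - y\<bar> \<le> Q * h * ?g" "\<bar>y - x\<bar> \<le> Q * h * ?g"
    by (simp_all add: abs_minus_commute)
  have "\<bar>?w y - ?w 0\<bar> \<le> 6 * \<bar>y - 0\<bar>" "\<bar>?w (- y) - ?w 0\<bar> \<le> 6 * \<bar>- y - 0\<bar>"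
    by (rule face_weight_lipschitz; use x1 in simp)+
  then have w1: "\<bar>?w y - 1\<bar> \<le> 6 * (Q * (B + 1) * h)" "\<bar>?w (- y) - 1\<bar> \<le> 6 * (Q * (B + 1) * h)"
    using y by simp_all
  have "\<bar>?w x - ?w y\<bar> \<le> 6 * \<bar>x - y\<bar>" "\<bar>?w (- x) - ?w (- y)\<bar> \<le> 6 * \<bar>- x - - y\<bar>"
    by (rule face_weight_lipschitz; use x1 in simp)+
  then have w2: "\<bar>?w x - ?w y\<bar> \<le> 6 * (Q * h * ?g)" "\<bar>?w (- x) - ?w (- y)\<bar> \<le> 6 * (Q * h * ?g)"
    using xy' by simp_all
  note w = w1 w2
  have "slotboom_flux \<mu> h z ce \<psi>e d p - slotboom_flux \<mu> h z cn \<psi>n d p - grad_h h (\<lambda>p. ce p - cn p) d p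
     = (e1 * (?w y - 1) - e0 * (?w (- y) - 1) + (c1 * (?w x - ?w y) - c0 * (?w (- x) - ?w (- y)))) / h"
  proof -
    have m: "z * (\<psi>e p - \<psi>e (p + axis d 1)) = - x" "z * (\<psi>n p - \<psi>n (p + axis d 1)) = - y"
      by (simp_all add: xy algebra_simps)
    have s: "slotboom_flux \<mu> h z ce \<psi>e d p = (c1 * ?w x - c0 * ?w (- x)) / h"
      "slotboom_flux \<mu> h z cn \<psi>n d p = ((c1 - e1) * ?w y - (c0 - e0) * ?w (- y)) / h"
      "grad_h h (\<lambda>p. ce p - cn p) d p = (e1 - e0) / h"
      by (simp_all add: slotboom_flux_def m v grad_h_def flip: xy)
    show ?thesis unfolding s by (simp add: diff_divide_distrib[symmetric] algebra_simps)
  qed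
  also have "\<bar>\<dots>\<bar> \<le> (\<bar>e1\<bar> * (6 * (Q * (B + 1) * h)) + \<bar>e0\<bar> * (6 * (Q * (B + 1) * h))
      + (B * (6 * (Q * h * ?g)) + B * (6 * (Q * h * ?g)))) / h"
  proof -
    have "\<bar>e1 * (?w y - 1)\<bar> \<le> \<bar>e1\<bar> * (6 * (Q * (B + 1) * h))"
      "\<bar>e0 * (?w (- y) - 1)\<bar> \<le> \<bar>e0\<bar> * (6 * (Q * (B + 1) * h))"
      "\<bar>c1 * (?w x - ?w y)\<bar> \<le> B * (6 * (Q * h * ?g))"
      "\<bar>c0 * (?w (- x) - ?w (- y))\<bar> \<le> B * (6 * (Q * h * ?g))"
      unfolding abs_mult using w c B by (auto intro!: mult_mono simp: v)
    then have "\<bar>e1 * (?w y - 1) - e0 * (?w (- y) - 1) + (c1 * (?w x - ?w y) - c0 * (?w (- x) - ?w (- y)))\<bar> \<le>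
        \<bar>e1\<bar> * (6 * (Q * (B + 1) * h)) + \<bar>e0\<bar> * (6 * (Q * (B + 1) * h))
        + (B * (6 * (Q * h * ?g)) + B * (6 * (Q * h * ?g)))" by linarith
    from divide_right_mono[OF this, of h] show ?thesis using h by (simp add: abs_divide)
  qed
  also have "\<dots> = 6 * Q * (B + 1) * (\<bar>e1\<bar> + \<bar>e0\<bar>) + 12 * Q * B * ?g"
    using h by (simp add: field_simps)
  also have "\<dots> \<le> 12 * Q * (B + 1) * (\<bar>e1\<bar> + \<bar>e0\<bar>) + 12 * Q * (B + 1) * ?g"
    using Q B by (intro add_mono mult_right_mono mult_nonneg_nonneg mult_mono) auto
  finally show ?thesis by (simp add: v algebra_simps)
qed

text \<open>The consistency error has a part \<open>r\<close> under the divergence, which is only tested against the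
  gradient of the error and so may be of the same order \<open>h\<close> as the pointwise part \<open>s\<close>.\<close>

locale error_system =
  fixes \<mu> :: mobility and a b T \<kappa> Q B R \<Delta>t :: real and M K :: nat and q :: "nat \<Rightarrow> real"
    and ce cn :: "nat \<Rightarrow> nat \<Rightarrow> cell_fun" and \<psi>e \<psi>n :: "nat \<Rightarrow> cell_fun"
    and r :: "nat \<Rightarrow> nat \<Rightarrow> face_field" and s :: "nat \<Rightarrow> nat \<Rightarrow> cell_fun"
  assumes ab: "a < b" and \<kappa>: "\<kappa> > 0" and B: "B \<ge> 0" and R: "R \<ge> 0" and dt: "\<Delta>t > 0" and Q: "Q \<ge> 0"
    and q: "\<And>l. l \<in> {1..M} \<Longrightarrow> \<bar>q l\<bar> \<le> Q"
    and per: "\<And>n. real n * \<Delta>t \<le> T \<Longrightarrow> \<psi>e n \<in> C_per K" "\<And>n. real n * \<Delta>t \<le> T \<Longrightarrow> \<psi>n n \<in> C_per K"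
      "\<And>n l. real n * \<Delta>t \<le> T \<Longrightarrow> l \<in> {1..M} \<Longrightarrow> ce l n \<in> C_per K"
      "\<And>n l. real n * \<Delta>t \<le> T \<Longrightarrow> l \<in> {1..M} \<Longrightarrow> cn l n \<in> C_per K"
      "\<And>n l d. real (Suc n) * \<Delta>t \<le> T \<Longrightarrow> l \<in> {1..M} \<Longrightarrow> r l n d \<in> C_per K"
    and ce_bd: "\<And>n l p. real n * \<Delta>t \<le> T \<Longrightarrow> l \<in> {1..M} \<Longrightarrow> \<bar>ce l n p\<bar> \<le> B"
    and \<psi>e_bd: "\<And>n d p. real n * \<Delta>t \<le> T \<Longrightarrow> \<bar>grad_h (mesh a b K) (\<psi>e n) d p\<bar> \<le> B"
    and init: "\<And>l p. l \<in> {1..M} \<Longrightarrow> \<bar>ce l 0 p - cn l 0 p\<bar> \<le> R * (mesh a b K)\<^sup>2"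
      "\<And>p. \<bar>\<psi>e 0 p - \<psi>n 0 p\<bar> \<le> R * (mesh a b K)\<^sup>2"
    and exact: "\<And>n l p. real (Suc n) * \<Delta>t \<le> T \<Longrightarrow> l \<in> {1..M} \<Longrightarrow>
      (ce l (Suc n) p - ce l n p) / \<Delta>t =
        div_h (mesh a b K) (\<lambda>d p. slotboom_flux \<mu> (mesh a b K) (q l) (ce l (Suc n)) (\<psi>e n) d p + r l n d p) p + s l n p"
    and consistent: "\<And>n l d p. real (Suc n) * \<Delta>t \<le> T \<Longrightarrow> l \<in> {1..M} \<Longrightarrow> \<bar>r l n d p\<bar> \<le> R * mesh a b K"
      "\<And>n l p. real (Suc n) * \<Delta>t \<le> T \<Longrightarrow> l \<in> {1..M} \<Longrightarrow> \<bar>s l n p\<bar> \<le> R * mesh a b K"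
    and scheme: "\<And>n l p. real (Suc n) * \<Delta>t \<le> T \<Longrightarrow> l \<in> {1..M} \<Longrightarrow>
      (cn l (Suc n) p - cn l n p) / \<Delta>t =
        div_h (mesh a b K) (slotboom_flux \<mu> (mesh a b K) (q l) (cn l (Suc n)) (\<psi>n n)) p"
    and poisson: "\<And>n p. real (Suc n) * \<Delta>t \<le> T \<Longrightarrow>
      \<bar>\<kappa> * laplace_h (mesh a b K) (\<lambda>p. \<psi>e (Suc n) p - \<psi>n (Suc n) p) p
        + (\<Sum>l=1..M. q l * (ce l (Suc n) p - cn l (Suc n) p))\<bar> \<le> R * mesh a b K"
begin

abbreviation h where "h \<equiv> mesh a b K"
abbreviation L where "L \<equiv> b - a"

definition ec where "ec l n p = ce l n p - cn l n p"
definition ep where "ep n p = \<psi>e n p - \<psi>n n p"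
definition Y where "Y n = (\<Sum>l=1..M. \<Sum>p\<in>grid_box K. (ec l n p)\<^sup>2)"
definition Z where "Z n = (\<Sum>l=1..M. \<Sum>p\<in>grid_box K. \<Sum>d\<in>UNIV. (grad_h h (ec l n) d p)\<^sup>2)"
definition U where "U n = (\<Sum>p\<in>grid_box K. \<Sum>d\<in>UNIV. (grad_h h (ep n) d p)\<^sup>2)"
text \<open>The square of an error of order \<open>h\<close>, summed over all cells without the
  volume weight \<open>h ^ 3\<close>. The sums \<open>Y\<close>, \<open>Z\<close> and
  \<open>U\<close> have the same normalization.\<close>

definition H where "H = h\<^sup>2 * real (num_points K ^ 3)"

text \<open>The constants arise in this order: \<open>C\<^sub>U\<close> bounds the potential
  gradient by \<open>Y\<close> and \<open>H\<close>, its last summand serving the initial level;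
  \<open>C\<^sub>E\<close> collects the right-hand side of \<open>energy_step\<close>;
  \<open>C\<^sub>V\<close> is the Gronwall factor; \<open>C\<^sub>W\<close> bounds the Laplacian of
  the potential error. None of them contains \<open>K\<close>, \<open>\<Delta>t\<close> or the
  numerical solution.\<close>

definition C\<^sub>U where "C\<^sub>U = 6 * L\<^sup>2 / \<kappa>\<^sup>2 * (real M * Q\<^sup>2 + R\<^sup>2) + 12 * R\<^sup>2"
definition C\<^sub>E where "C\<^sub>E = 24 * (12 * Q * (B + 1))\<^sup>2 + 1 + 4 * real M * (12 * Q * (B + 1))\<^sup>2 * C\<^sub>U + 13 * real M * R\<^sup>2"
definition C\<^sub>V where "C\<^sub>V = exp (4 * C\<^sub>E * T) * (real M * R\<^sup>2 + 1)"
definition C\<^sub>W where "C\<^sub>W = 2 / \<kappa>\<^sup>2 * (real M * Q\<^sup>2 * C\<^sub>V + R\<^sup>2)"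

lemma h_pos: "h > 0" using ab by (simp add: mesh_def)

lemma h_num_points: "h * num_points K = L" by (simp add: mesh_def)

lemma Y_nonneg: "Y n \<ge> 0" and Z_nonneg: "Z n \<ge> 0" and U_nonneg: "U n \<ge> 0" and H_nonneg: "H \<ge> 0"
  by (auto simp: Y_def Z_def U_def H_def intro!: sum_nonneg)

lemma card_le: "real (card (grid_box K)) \<le> real (num_points K ^ 3)"
  using card_grid_box_le of_nat_le_iff by blast

lemma C_nonneg: "C\<^sub>U \<ge> 0" "C\<^sub>E \<ge> 0" "C\<^sub>V \<ge> 0" "C\<^sub>W \<ge> 0"
proof -
  show U: "C\<^sub>U \<ge> 0" unfolding C\<^sub>U_def by (intro add_nonneg_nonneg mult_nonneg_nonneg divide_nonneg_nonneg) auto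
  show "C\<^sub>E \<ge> 0" unfolding C\<^sub>E_def using U by (intro add_nonneg_nonneg mult_nonneg_nonneg) auto
  show V: "C\<^sub>V \<ge> 0" unfolding C\<^sub>V_def by (intro mult_nonneg_nonneg add_nonneg_nonneg) auto
  show "C\<^sub>W \<ge> 0" unfolding C\<^sub>W_def using V by (intro add_nonneg_nonneg mult_nonneg_nonneg divide_nonneg_nonneg) auto
qed

lemma ep_per: "real n * \<Delta>t \<le> T \<Longrightarrow> ep n \<in> C_per K"
  unfolding ep_def[abs_def] using per(1,2) by (rule C_per_compose2[where f = "(-)"])

lemma ec_per: "real n * \<Delta>t \<le> T \<Longrightarrow> l \<in> {1..M} \<Longrightarrow> ec l n \<in> C_per K"
  unfolding ec_def[abs_def] using per(3,4) by (intro C_per_compose2[where f = "(-)"])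

lemma W_le:
  assumes n: "real (Suc n) * \<Delta>t \<le> T"
  shows "(\<Sum>p\<in>grid_box K. (laplace_h h (ep (Suc n)) p)\<^sup>2) \<le> 2 / \<kappa>\<^sup>2 * (real M * Q\<^sup>2 * Y (Suc n) + R\<^sup>2 * H)"
proof -
  have "(\<Sum>p\<in>grid_box K. (laplace_h h (ep (Suc n)) p)\<^sup>2) \<le>
      2 / \<kappa>\<^sup>2 * (real M * Q\<^sup>2 * Y (Suc n) + (R * h)\<^sup>2 * card (grid_box K))"
    unfolding Y_def using poisson[OF n] q
    by (intro sum_laplace_h_le \<kappa>) (auto simp: ec_def ep_def[abs_def])
  also have "\<dots> \<le> 2 / \<kappa>\<^sup>2 * (real M * Q\<^sup>2 * Y (Suc n) + R\<^sup>2 * H)"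
  proof -
    have "(R * h)\<^sup>2 * card (grid_box K) \<le> (R * h)\<^sup>2 * real (num_points K ^ 3)"
      using card_le by (intro mult_left_mono) auto
    then show ?thesis by (intro mult_left_mono) (auto simp: H_def power_mult_distrib mult_ac)
  qed
  finally show ?thesis .
qed

lemma ep_0_bd: "\<bar>grad_h h (ep 0) d p\<bar> \<le> 2 * R * h"
proof -
  have "\<bar>ep 0 (p + axis d 1) - ep 0 p\<bar> \<le> 2 * R * h\<^sup>2"
    using init(2)[of p] init(2)[of "p + axis d 1"] unfolding ep_def by linarith
  then have "\<bar>ep 0 (p + axis d 1) - ep 0 p\<bar> / h \<le> 2 * R * h\<^sup>2 / h"
    using h_pos by (intro divide_right_mono) auto
  then show ?thesis using h_pos by (simp add: grad_h_def power2_eq_square abs_divide)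
qed

text \<open>Level 0 is separate, because the initial potential is projected data and not a solution
  of the discrete Poisson equation. There the accuracy \<open>h\<^sup>2\<close> of the data pays for
  the division by \<open>h\<close>.\<close>

lemma U_le:
  assumes n: "real n * \<Delta>t \<le> T"
  shows "U n \<le> C\<^sub>U * (Y n + H)"
proof (cases n)
  case 0
  have "U n \<le> (\<Sum>p\<in>grid_box K. \<Sum>d::3\<in>UNIV. (2 * R * h)\<^sup>2)"
    unfolding U_def 0
  proof (intro sum_mono)
    fix p d show "(grad_h h (ep 0) d p)\<^sup>2 \<le> (2 * R * h)\<^sup>2"
      using ep_0_bd[of d p] by (rule power2_le_if_abs_le)
  qed
  also have "\<dots> = 12 * R\<^sup>2 * (h\<^sup>2 * real (card (grid_box K)))" by (simp add: power_mult_distrib)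
  also have "\<dots> \<le> 12 * R\<^sup>2 * H"
    unfolding H_def using card_le by (intro mult_left_mono) auto
  also have "\<dots> \<le> C\<^sub>U * (Y n + H)"
    unfolding C\<^sub>U_def using Y_nonneg[of n] H_nonneg by (intro mult_mono) auto
  finally show ?thesis .
next
  case (Suc m)
  have "U n \<le> 3 * L\<^sup>2 * (\<Sum>p\<in>grid_box K. (laplace_h h (ep n) p)\<^sup>2)"
    unfolding U_def using sum_grad_h_squared_le[OF ep_per[OF n] h_pos] by (simp add: h_num_points)
  also have "\<dots> \<le> 3 * L\<^sup>2 * (2 / \<kappa>\<^sup>2 * (real M * Q\<^sup>2 * Y n + R\<^sup>2 * H))"
    using W_le[of m] n Suc by (intro mult_left_mono) auto
  also have "\<dots> = 6 * L\<^sup>2 / \<kappa>\<^sup>2 * (real M * Q\<^sup>2 * Y n + R\<^sup>2 * H)" by simp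
  also have "\<dots> \<le> 6 * L\<^sup>2 / \<kappa>\<^sup>2 * ((real M * Q\<^sup>2 + R\<^sup>2) * (Y n + H))"
    using Y_nonneg[of n] H_nonneg
    by (intro mult_left_mono) (auto simp: algebra_simps)
  also have "\<dots> \<le> C\<^sub>U * (Y n + H)"
  proof -
    have "C\<^sub>U * (Y n + H) = 6 * L\<^sup>2 / \<kappa>\<^sup>2 * ((real M * Q\<^sup>2 + R\<^sup>2) * (Y n + H)) + 12 * R\<^sup>2 * (Y n + H)"
      unfolding C\<^sub>U_def by (simp only: distrib_right[of _ _ "Y n + H"] mult.assoc)
    moreover have "0 \<le> 12 * R\<^sup>2 * (Y n + H)" using Y_nonneg[of n] H_nonneg by simp
    ultimately show ?thesis by linarith
  qed
  finally show ?thesis .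
qed

text \<open>The five smallness conditions serve, in order, to weaken the initial accuracy from h^2
  to h, to keep the arguments of the weights in [-1, 1], to start the induction on the potential
  gradient, to absorb the implicit term in Gronwall's inequality, and to close the
  induction.\<close>

context
  assumes small: "h \<le> 1" "Q * (B + 1) * h \<le> 1" "2 * R * h \<le> 1" "2 * (C\<^sub>E * \<Delta>t) \<le> 1"
    "7 * (C\<^sub>W * L ^ 3) * sqrt (L * h) \<le> 1"
begin

text \<open>A gradient bound at the old level suffices because the mobility is lagged. It keeps the
  numerical gradient below \<open>B + 1\<close>, as \<open>slotboom_flux_difference\<close>
  demands.\<close>

lemma Y_step:
  assumes n: "real (Suc n) * \<Delta>t \<le> T" and ep: "\<And>d p. \<bar>grad_h h (ep n) d p\<bar> \<le> 1"
  shows "Y (Suc n) - Y n + \<Delta>t * Z (Suc n) \<le> \<Delta>t * (C\<^sub>E * (Y (Suc n) + Y n + H))"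
proof -
  let ?b = "12 * Q * (B + 1)"
  let ?S = "\<lambda>f. \<Sum>p\<in>grid_box K. f p"
  have n': "real n * \<Delta>t \<le> T" using n dt by (simp add: algebra_simps)
  have step: "?S (\<lambda>p. (ec l (Suc n) p)\<^sup>2) - ?S (\<lambda>p. (ec l n p)\<^sup>2)
      + \<Delta>t * ?S (\<lambda>p. \<Sum>d\<in>UNIV. (grad_h h (ec l (Suc n)) d p)\<^sup>2)
    \<le> \<Delta>t * ((24 * ?b\<^sup>2 + 1) * ?S (\<lambda>p. (ec l (Suc n) p)\<^sup>2) + 4 * ?b\<^sup>2 * U n + 13 * (R * h)\<^sup>2 * card (grid_box K))"
    if l: "l \<in> {1..M}" for l
  proof -
    let ?F = "\<lambda>d p. slotboom_flux \<mu> h (q l) (ce l (Suc n)) (\<psi>e n) d p + r l n d p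
        - slotboom_flux \<mu> h (q l) (cn l (Suc n)) (\<psi>n n) d p"
    show ?thesis unfolding U_def
    proof (rule energy_step[where Fl = ?F and s = "s l n"])
      show "?F d \<in> C_per K" for d
        using C_per_slotboom_flux[OF per(3)[OF n l] per(1)[OF n'], of \<mu> h "q l" d]
          C_per_slotboom_flux[OF per(4)[OF n l] per(2)[OF n'], of \<mu> h "q l" d]
          per(5)[OF n l, of d] by (auto simp: C_per_def)
      show "(ec l (Suc n) p - ec l n p) / \<Delta>t = div_h h ?F p + s l n p" for p
      proof -
        have "(ec l (Suc n) p - ec l n p) / \<Delta>t =
            (ce l (Suc n) p - ce l n p) / \<Delta>t - (cn l (Suc n) p - cn l n p) / \<Delta>t"
          by (simp add: ec_def diff_divide_distrib)
        then show ?thesis unfolding exact[OF n l] scheme[OF n l]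
          by (simp add: div_h_def diff_divide_distrib add_divide_distrib sum_subtractf sum.distrib)
      qed
      fix d p
      have pe: "\<bar>grad_h h (\<psi>e n) d p\<bar> \<le> B + 1" for d p using \<psi>e_bd[OF n', of d p] by linarith
      have pn: "\<bar>grad_h h (\<psi>n n) d p\<bar> \<le> B + 1" for d p
      proof -
        have "grad_h h (\<psi>n n) d p = grad_h h (\<psi>e n) d p - grad_h h (ep n) d p"
          by (simp add: grad_h_def ep_def diff_divide_distrib)
        then show ?thesis using \<psi>e_bd[OF n', of d p] ep[of d p] by linarith
      qed
      have "\<bar>slotboom_flux \<mu> h (q l) (ce l (Suc n)) (\<psi>e n) d p
          - slotboom_flux \<mu> h (q l) (cn l (Suc n)) (\<psi>n n) d p - grad_h h (ec l (Suc n)) d p\<bar>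
        \<le> ?b * (\<bar>ec l (Suc n) (p + axis d 1)\<bar> + \<bar>ec l (Suc n) p\<bar> + \<bar>grad_h h (ep n) d p\<bar>)"
        using slotboom_flux_difference[OF h_pos q[OF l] ce_bd[OF n l] pe pn small(2)]
        by (simp add: ec_def[abs_def] ep_def[abs_def])
      then show "\<bar>?F d p - grad_h h (ec l (Suc n)) d p\<bar>
        \<le> ?b * (\<bar>ec l (Suc n) (p + axis d 1)\<bar> + \<bar>ec l (Suc n) p\<bar> + \<bar>grad_h h (ep n) d p\<bar>) + R * h"
        using consistent(1)[OF n l, of d p] by linarith
      show "\<bar>s l n p\<bar> \<le> R * h" by (rule consistent(2)[OF n l])
    qed (use ec_per[OF n l] ec_per[OF n' l] h_pos dt Q B in auto)
  qed
  have "Y (Suc n) - Y n + \<Delta>t * Z (Suc n) = (\<Sum>l=1..M. ?S (\<lambda>p. (ec l (Suc n) p)\<^sup>2) - ?S (\<lambda>p. (ec l n p)\<^sup>2)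
      + \<Delta>t * ?S (\<lambda>p. \<Sum>d\<in>UNIV. (grad_h h (ec l (Suc n)) d p)\<^sup>2))"
    by (simp add: Y_def Z_def sum.distrib sum_subtractf sum_distrib_left)
  also have "\<dots> \<le> (\<Sum>l=1..M. \<Delta>t * ((24 * ?b\<^sup>2 + 1) * ?S (\<lambda>p. (ec l (Suc n) p)\<^sup>2) + 4 * ?b\<^sup>2 * U n
      + 13 * (R * h)\<^sup>2 * card (grid_box K)))"
    by (rule sum_mono[OF step])
  also have "\<dots> = \<Delta>t * ((24 * ?b\<^sup>2 + 1) * Y (Suc n) + 4 * real M * ?b\<^sup>2 * U n
      + 13 * real M * R\<^sup>2 * (h\<^sup>2 * card (grid_box K)))"
  proof -
    have "(\<Sum>l=1..M. \<Delta>t * (c1 * a l + c2 + c3)) = \<Delta>t * (c1 * (\<Sum>l=1..M. a l) + real M * c2 + real M * c3)"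
      for c1 c2 c3 and a :: "nat \<Rightarrow> real"
      by (simp add: sum.distrib algebra_simps flip: sum_distrib_left)
    from this[of "24 * ?b\<^sup>2 + 1" "\<lambda>l. ?S (\<lambda>p. (ec l (Suc n) p)\<^sup>2)" "4 * ?b\<^sup>2 * U n"
        "13 * (R * h)\<^sup>2 * card (grid_box K)"]
    show ?thesis unfolding Y_def by (simp only: power_mult_distrib mult_ac)
  qed
  also have "\<dots> \<le> \<Delta>t * ((24 * ?b\<^sup>2 + 1) * Y (Suc n) + 4 * real M * ?b\<^sup>2 * (C\<^sub>U * (Y n + H))
      + 13 * real M * R\<^sup>2 * H)"
    using U_le[OF n'] card_le dt unfolding H_def
    by (intro mult_left_mono add_mono order_refl) auto
  also have "\<dots> \<le> \<Delta>t * (C\<^sub>E * (Y (Suc n) + Y n + H))"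
  proof -
    define A1 A2 A3 where A: "A1 = 24 * ?b\<^sup>2 + 1" "A2 = 4 * real M * ?b\<^sup>2 * C\<^sub>U" "A3 = 13 * real M * R\<^sup>2"
    have A0: "A1 \<ge> 0" "A2 \<ge> 0" "A3 \<ge> 0" using C_nonneg(1) by (auto simp: A)
    have "A1 * Y (Suc n) + A2 * (Y n + H) + A3 * H \<le> (A1 + A2 + A3) * (Y (Suc n) + Y n + H)"
      using A0 Y_nonneg[of n] Y_nonneg[of "Suc n"] H_nonneg
      by (simp add: algebra_simps add_nonneg_nonneg)
    then show ?thesis using dt unfolding C\<^sub>E_def A by (intro mult_left_mono) (auto simp: mult_ac)
  qed
  finally show ?thesis .
qed

lemma Y_0: "Y 0 \<le> real M * R\<^sup>2 * H"
proof -
  have "Y 0 \<le> (\<Sum>l=1..M. \<Sum>p\<in>grid_box K. R\<^sup>2 * h\<^sup>2)"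
    unfolding Y_def
  proof (intro sum_mono)
    fix l p assume l: "l \<in> {1..M}"
    have "\<bar>ec l 0 p\<bar> \<le> R * h\<^sup>2" using init(1)[OF l] by (simp add: ec_def)
    also have "\<dots> \<le> R * h" using small(1) h_pos R
      by (intro mult_left_mono) (auto simp: power2_eq_square mult_left_le)
    finally show "(ec l 0 p)\<^sup>2 \<le> R\<^sup>2 * h\<^sup>2"
      unfolding power_mult_distrib[symmetric] by (rule power2_le_if_abs_le)
  qed
  also have "\<dots> = real M * R\<^sup>2 * (h\<^sup>2 * card (grid_box K))" by simp
  also have "\<dots> \<le> real M * R\<^sup>2 * H"
    unfolding H_def using card_le by (intro mult_left_mono) auto
  finally show ?thesis .
qed

lemma H_h: "H * h = L ^ 3"
proof -
  have "H * h = (h * num_points K) ^ 3"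
    by (simp add: H_def power_mult_distrib power2_eq_square power3_eq_cube)
  then show ?thesis by (simp add: h_num_points)
qed

lemma V_le:
  assumes n: "real n * \<Delta>t \<le> T" and ep: "\<And>k d p. k < n \<Longrightarrow> \<bar>grad_h h (ep k) d p\<bar> \<le> 1"
  shows "Y n + \<Delta>t * (\<Sum>k=1..n. Z k) + H \<le> C\<^sub>V * H"
proof -
  have "Y n + \<Delta>t * (\<Sum>k=1..n. Z k) + H \<le> exp (4 * C\<^sub>E * (real n * \<Delta>t)) * (Y 0 + H)"
  proof (rule gronwall_sum)
    fix k assume k: "k < n"
    have "real (Suc k) * \<Delta>t \<le> real n * \<Delta>t" using k dt by (intro mult_right_mono) auto
    then show "Y (Suc k) - Y k + \<Delta>t * Z (Suc k) \<le> \<Delta>t * (C\<^sub>E * (Y (Suc k) + Y k + H))"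
      using n ep[OF k] by (intro Y_step) auto
  qed (use Y_nonneg Z_nonneg H_nonneg C_nonneg dt small in auto)
  also have "\<dots> \<le> exp (4 * C\<^sub>E * T) * (real M * R\<^sup>2 * H + H)"
    using n Y_0 C_nonneg Y_nonneg[of 0] H_nonneg by (intro mult_mono) (auto intro!: mult_left_mono)
  also have "\<dots> = C\<^sub>V * H" by (simp add: C\<^sub>V_def algebra_simps)
  finally show ?thesis .
qed

text \<open>The bootstrap: the bound at all earlier levels gives
  \<open>Y n \<le> C\<^sub>V * H\<close>, the Poisson equation turns this into a bound for the
  Laplacian of the potential error, and the maximum estimate recovers the gradient bound with room
  to spare.\<close>

lemma ep_bd: "real n * \<Delta>t \<le> T \<Longrightarrow> \<bar>grad_h h (ep n) d p\<bar> \<le> 1"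
proof (induction n arbitrary: d p rule: less_induct)
  case (less n)
  have n: "real n * \<Delta>t \<le> T" by fact
  show ?case
  proof (cases n)
    case 0
    then show ?thesis using ep_0_bd[of d p] small(3) by auto
  next
    case (Suc m)
    have IH: "\<bar>grad_h h (ep k) d p\<bar> \<le> 1" if "k < n" for k d p
    proof (rule less.IH[OF that])
      have "real k * \<Delta>t \<le> real n * \<Delta>t" using that dt by (intro mult_right_mono) auto
      with n show "real k * \<Delta>t \<le> T" by simp
    qed
    have "0 \<le> \<Delta>t * (\<Sum>k=1..n. Z k)"
      using Z_nonneg dt by (intro mult_nonneg_nonneg sum_nonneg) auto
    then have Y: "Y n \<le> C\<^sub>V * H" using V_le[OF n IH] H_nonneg by linarith
    have "(grad_h h (ep n) d p)\<^sup>2 \<le> 7 * h * sqrt (L * h) * (\<Sum>p\<in>grid_box K. (laplace_h h (ep n) p)\<^sup>2)"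
      by (rule grad_h_sup_le[OF ep_per[OF n] h_pos]) (simp add: h_num_points)
    also have "\<dots> \<le> 7 * h * sqrt (L * h) * (2 / \<kappa>\<^sup>2 * (real M * Q\<^sup>2 * (C\<^sub>V * H) + R\<^sup>2 * H))"
    proof (rule mult_left_mono)
      have "(\<Sum>p\<in>grid_box K. (laplace_h h (ep n) p)\<^sup>2) \<le> 2 / \<kappa>\<^sup>2 * (real M * Q\<^sup>2 * Y n + R\<^sup>2 * H)"
        using W_le[of m] n Suc by simp
      also have "\<dots> \<le> 2 / \<kappa>\<^sup>2 * (real M * Q\<^sup>2 * (C\<^sub>V * H) + R\<^sup>2 * H)"
        using Y by (intro mult_left_mono add_mono) auto
      finally show "(\<Sum>p\<in>grid_box K. (laplace_h h (ep n) p)\<^sup>2) \<le> 2 / \<kappa>\<^sup>2 * (real M * Q\<^sup>2 * (C\<^sub>V * H) + R\<^sup>2 * H)" .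
    qed (use h_pos ab in auto)
    \<comment> \<open>By \<open>H_h\<close> the product \<open>H * h\<close> does not depend on the
      mesh, so \<open>sqrt (L * h)\<close> is the small factor that remains.\<close>
    also have "\<dots> = 7 * (C\<^sub>W * (H * h)) * sqrt (L * h)"
      by (simp add: C\<^sub>W_def algebra_simps)
    also have "\<dots> \<le> 1" using small(5) by (simp add: H_h)
    finally show ?thesis by (simp add: abs_square_le_1)
  qed
qed

lemma stability:
  assumes n: "real n * \<Delta>t \<le> T"
  shows "Y n + \<Delta>t * (\<Sum>k=1..n. Z k) + H \<le> C\<^sub>V * H"
proof (rule V_le[OF n ep_bd])
  fix k assume "k < n"
  then have "real k * \<Delta>t \<le> real n * \<Delta>t" using dt by (intro mult_right_mono) auto
  with n show "real k * \<Delta>t \<le> T" by simp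
qed

text \<open>The term \<open>4 * C\<^sub>V\<close> is the part of the concentration gradients, which
  only the time sum controls. The rest is bounded level by level and summed over a total time of at
  most \<open>T\<close>. The factor \<open>L ^ 3\<close> is \<open>H * h\<close>.\<close>

definition C\<^sub>F where
  "C\<^sub>F = L ^ 3 * (4 * C\<^sub>V + T * (4 * (real M * Q\<^sup>2 * B\<^sup>2 * (C\<^sub>U * (C\<^sub>V + 1)) + 3 * Q\<^sup>2 * (B + 1)\<^sup>2 * C\<^sub>V + 3 * real M * R\<^sup>2)))"

text \<open>The drift is split so that each error meets a bounded factor: the potential error the
  exact concentration, the concentration error the numerical gradient, which \<open>ep_bd\<close>
  bounds.\<close>

lemma discrete_flux_difference:
  assumes n: "real n * \<Delta>t \<le> T" and l: "l \<in> {1..M}"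
  shows "\<bar>discrete_flux h (q l) (ce l n) (\<psi>e n) d p - discrete_flux h (q l) (cn l n) (\<psi>n n) d p\<bar> \<le>
    \<bar>grad_h h (ec l n) d p\<bar> + Q * B * \<bar>grad_h h (ep n) d p\<bar> + Q * (B + 1) * \<bar>face_avg (ec l n) d p\<bar>"
proof -
  let ?De = "grad_h h (ep n) d p" and ?A = "face_avg (ec l n) d p" and ?Dn = "grad_h h (\<psi>n n) d p"
  let ?ce = "face_avg (ce l n) d p"
  have D: "grad_h h (\<psi>e n) d p = ?De + ?Dn" "grad_h h (ec l n) d p = grad_h h (ce l n) d p - grad_h h (cn l n) d p"
    "face_avg (cn l n) d p = ?ce - ?A"
    by (simp_all add: grad_h_def ep_def ec_def face_avg_def field_simps flip: diff_divide_distrib add_divide_distrib)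
  have "\<bar>?Dn\<bar> \<le> B + 1"
    using \<psi>e_bd[OF n, of d p] ep_bd[OF n, of d p] unfolding D(1) by linarith
  then have 1: "\<bar>q l * (?A * ?Dn)\<bar> \<le> Q * (\<bar>?A\<bar> * (B + 1))"
    unfolding abs_mult using q[OF l] Q by (intro mult_mono) auto
  have "\<bar>?ce\<bar> \<le> B"
    using ce_bd[OF n l, of p] ce_bd[OF n l, of "p + axis d 1"] by (simp add: face_avg_def abs_le_iff)
  then have 2: "\<bar>q l * (?ce * ?De)\<bar> \<le> Q * (B * \<bar>?De\<bar>)"
    unfolding abs_mult using q[OF l] Q B by (intro mult_mono) auto
  have "discrete_flux h (q l) (ce l n) (\<psi>e n) d p - discrete_flux h (q l) (cn l n) (\<psi>n n) d p =
      grad_h h (ec l n) d p + q l * (?ce * ?De) + q l * (?A * ?Dn)"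
    unfolding discrete_flux_def D by (simp add: algebra_simps)
  with 1 2 show ?thesis by (simp add: mult_ac)
qed

text \<open>The slack \<open>R * h\<close> in \<open>F\<close> makes room for the change from the
  exact solution, with which stability compares, to the projected one, with which the theorem
  compares.\<close>

lemma sum_flux_squared_le:
  assumes n: "real n * \<Delta>t \<le> T" and l: "l \<in> {1..M}"
    and F: "\<And>d p. \<bar>F d p - (discrete_flux h (q l) (ce l n) (\<psi>e n) d p - discrete_flux h (q l) (cn l n) (\<psi>n n) d p)\<bar> \<le> R * h"
  shows "(\<Sum>p\<in>grid_box K. \<Sum>d\<in>UNIV. \<bar>F d p\<bar>\<^sup>2) \<le>
    4 * ((\<Sum>p\<in>grid_box K. \<Sum>d\<in>UNIV. (grad_h h (ec l n) d p)\<^sup>2) + Q\<^sup>2 * B\<^sup>2 * U n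
      + 3 * Q\<^sup>2 * (B + 1)\<^sup>2 * (\<Sum>p\<in>grid_box K. (ec l n p)\<^sup>2) + 3 * R\<^sup>2 * H)"
proof -
  let ?S = "\<lambda>f. \<Sum>p\<in>grid_box K. f p"
  let ?c = "Q\<^sup>2 * (B + 1)\<^sup>2"
  have "?S (\<lambda>p. \<Sum>d\<in>UNIV. \<bar>F d p\<bar>\<^sup>2) \<le> ?S (\<lambda>p. \<Sum>d\<in>UNIV. 4 * ((grad_h h (ec l n) d p)\<^sup>2
      + Q\<^sup>2 * B\<^sup>2 * (grad_h h (ep n) d p)\<^sup>2 + ?c * ((ec l n (p + axis d 1))\<^sup>2 / 2 + (ec l n p)\<^sup>2 / 2) + R\<^sup>2 * h\<^sup>2))"
  proof (intro sum_mono)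
    fix p d
    let ?x = "\<bar>grad_h h (ec l n) d p\<bar>" and ?y = "Q * B * \<bar>grad_h h (ep n) d p\<bar>"
      and ?z = "Q * (B + 1) * \<bar>face_avg (ec l n) d p\<bar>" and ?w = "R * h"
    have "\<bar>F d p\<bar> \<le> ?x + ?y + ?z + ?w"
      using F[of d p] discrete_flux_difference[OF n l, of d p] by linarith
    then have "\<bar>F d p\<bar>\<^sup>2 \<le> (?x + ?y + ?z + ?w)\<^sup>2" by (intro power_mono) auto
    also have "\<dots> \<le> 4 * (?x\<^sup>2 + ?y\<^sup>2 + ?z\<^sup>2 + ?w\<^sup>2)"
      by (rule power2_sum4_le)
    also have "\<dots> \<le> 4 * ((grad_h h (ec l n) d p)\<^sup>2
      + Q\<^sup>2 * B\<^sup>2 * (grad_h h (ep n) d p)\<^sup>2 + ?c * ((ec l n (p + axis d 1))\<^sup>2 / 2 + (ec l n p)\<^sup>2 / 2) + R\<^sup>2 * h\<^sup>2)"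
    proof -
      have "(face_avg (ec l n) d p)\<^sup>2 \<le> (ec l n (p + axis d 1))\<^sup>2 / 2 + (ec l n p)\<^sup>2 / 2"
        using zero_le_power2[of "ec l n (p + axis d 1) - ec l n p"]
        by (simp add: face_avg_def power2_eq_square field_simps)
      then have "?c * (face_avg (ec l n) d p)\<^sup>2 \<le> ?c * ((ec l n (p + axis d 1))\<^sup>2 / 2 + (ec l n p)\<^sup>2 / 2)"
        by (rule mult_left_mono) simp
      then show ?thesis by (simp add: power_mult_distrib)
    qed
    finally show "\<bar>F d p\<bar>\<^sup>2 \<le> 4 * ((grad_h h (ec l n) d p)\<^sup>2
      + Q\<^sup>2 * B\<^sup>2 * (grad_h h (ep n) d p)\<^sup>2 + ?c * ((ec l n (p + axis d 1))\<^sup>2 / 2 + (ec l n p)\<^sup>2 / 2) + R\<^sup>2 * h\<^sup>2)" .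
  qed
  also have "\<dots> = 4 * (?S (\<lambda>p. \<Sum>d\<in>UNIV. (grad_h h (ec l n) d p)\<^sup>2) + Q\<^sup>2 * B\<^sup>2 * U n
      + ?c * (?S (\<lambda>p. \<Sum>d\<in>UNIV. (ec l n (p + axis d 1))\<^sup>2) / 2 + 3 * ?S (\<lambda>p. (ec l n p)\<^sup>2) / 2)
      + 3 * R\<^sup>2 * (h\<^sup>2 * card (grid_box K)))"
    by (simp add: U_def sum.distrib sum_distrib_left sum_divide_distrib algebra_simps)
  also have "?S (\<lambda>p. \<Sum>d\<in>UNIV. (ec l n (p + axis d 1))\<^sup>2) = 3 * ?S (\<lambda>p. (ec l n p)\<^sup>2)"
    using sum_grid_box_shift[OF C_per_compose1[where f = "\<lambda>x. x\<^sup>2", OF ec_per[OF n l]]]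
    by (subst sum.swap) simp
  also have "4 * (?S (\<lambda>p. \<Sum>d\<in>UNIV. (grad_h h (ec l n) d p)\<^sup>2) + Q\<^sup>2 * B\<^sup>2 * U n
      + ?c * (3 * ?S (\<lambda>p. (ec l n p)\<^sup>2) / 2 + 3 * ?S (\<lambda>p. (ec l n p)\<^sup>2) / 2)
      + 3 * R\<^sup>2 * (h\<^sup>2 * card (grid_box K)))
    \<le> 4 * (?S (\<lambda>p. \<Sum>d\<in>UNIV. (grad_h h (ec l n) d p)\<^sup>2) + Q\<^sup>2 * B\<^sup>2 * U n
      + ?c * (3 * ?S (\<lambda>p. (ec l n p)\<^sup>2) / 2 + 3 * ?S (\<lambda>p. (ec l n p)\<^sup>2) / 2)
      + 3 * R\<^sup>2 * H)"
    unfolding H_def using card_le by (intro mult_left_mono add_mono order_refl) auto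
  finally show ?thesis by (simp add: mult_ac)
qed

lemma flux_error_le:
  assumes n: "real n * \<Delta>t \<le> T"
    and F: "\<And>l k d p. real k * \<Delta>t \<le> T \<Longrightarrow> l \<in> {1..M} \<Longrightarrow>
      \<bar>F l k d p - (discrete_flux h (q l) (ce l k) (\<psi>e k) d p - discrete_flux h (q l) (cn l k) (\<psi>n k) d p)\<bar> \<le> R * h"
  shows "\<Delta>t * (\<Sum>l=1..M. \<Sum>k=1..n. (face_norm a b K (F l k))\<^sup>2) \<le> C\<^sub>F * h\<^sup>2"
proof -
  let ?A = "4 * (real M * Q\<^sup>2 * B\<^sup>2 * (C\<^sub>U * (C\<^sub>V + 1)) + 3 * Q\<^sup>2 * (B + 1)\<^sup>2 * C\<^sub>V + 3 * real M * R\<^sup>2)"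
  let ?G = "\<lambda>l k. \<Sum>p\<in>grid_box K. \<Sum>d\<in>UNIV. \<bar>F l k d p\<bar>\<^sup>2"
  have A0: "?A \<ge> 0" using C_nonneg by simp
  have k: "(\<Sum>l=1..M. ?G l k) \<le> 4 * Z k + ?A * H" if kn: "k \<in> {1..n}" for k
  proof -
    have kT: "real k * \<Delta>t \<le> T"
      using n kn dt order_trans[OF mult_right_mono[of "real k" "real n" \<Delta>t]] by auto
    have Zs: "0 \<le> \<Delta>t * (\<Sum>k=1..k. Z k)"
      using Z_nonneg dt by (intro mult_nonneg_nonneg sum_nonneg) auto
    have Yk: "Y k \<le> C\<^sub>V * H" using stability[OF kT] H_nonneg Zs by linarith
    have Uk: "U k \<le> C\<^sub>U * (C\<^sub>V + 1) * H"
    proof -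
      have "C\<^sub>U * (Y k + H) \<le> C\<^sub>U * (C\<^sub>V * H + H)" using Yk C_nonneg by (intro mult_left_mono) auto
      then show ?thesis using U_le[OF kT] by (simp add: algebra_simps)
    qed
    have "(\<Sum>l=1..M. ?G l k) \<le> (\<Sum>l=1..M. 4 * ((\<Sum>p\<in>grid_box K. \<Sum>d\<in>UNIV. (grad_h h (ec l k) d p)\<^sup>2)
        + Q\<^sup>2 * B\<^sup>2 * U k + 3 * Q\<^sup>2 * (B + 1)\<^sup>2 * (\<Sum>p\<in>grid_box K. (ec l k p)\<^sup>2) + 3 * R\<^sup>2 * H))"
      by (intro sum_mono sum_flux_squared_le[OF kT] F[OF kT])
    also have "\<dots> = 4 * (Z k + real M * Q\<^sup>2 * B\<^sup>2 * U k + 3 * Q\<^sup>2 * (B + 1)\<^sup>2 * Y k + 3 * real M * R\<^sup>2 * H)"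
      by (simp only: sum_distrib_left[symmetric] sum.distrib Z_def Y_def sum_constant) (simp add: algebra_simps)
    also have "\<dots> \<le> 4 * (Z k + real M * Q\<^sup>2 * B\<^sup>2 * (C\<^sub>U * (C\<^sub>V + 1) * H) + 3 * Q\<^sup>2 * (B + 1)\<^sup>2 * (C\<^sub>V * H) + 3 * real M * R\<^sup>2 * H)"
      using Uk Yk by (intro mult_left_mono add_mono order_refl) auto
    also have "\<dots> = 4 * Z k + ?A * H" by (simp only: distrib_left distrib_right mult_ac)
    finally show ?thesis .
  qed
  have "(\<Sum>l=1..M. \<Sum>k=1..n. (face_norm a b K (F l k))\<^sup>2) = h ^ 3 * (\<Sum>k=1..n. \<Sum>l=1..M. ?G l k)"
    using h_pos by (subst sum.swap) (simp add: face_norm_def sum_distrib_left sum_nonneg)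
  also have "\<dots> \<le> h ^ 3 * (\<Sum>k=1..n. 4 * Z k + ?A * H)"
    using h_pos k by (intro mult_left_mono sum_mono) auto
  also have "\<dots> = h ^ 3 * (4 * (\<Sum>k=1..n. Z k) + real n * (?A * H))"
    by (simp add: sum.distrib flip: sum_distrib_left)
  finally have "\<Delta>t * (\<Sum>l=1..M. \<Sum>k=1..n. (face_norm a b K (F l k))\<^sup>2) \<le>
      \<Delta>t * (h ^ 3 * (4 * (\<Sum>k=1..n. Z k) + real n * (?A * H)))"
    using dt by (intro mult_left_mono) auto
  also have "\<dots> = h ^ 3 * (4 * (\<Delta>t * (\<Sum>k=1..n. Z k)) + real n * \<Delta>t * (?A * H))"
    by (simp only: distrib_left mult_ac)
  also have "\<dots> \<le> h ^ 3 * (4 * (C\<^sub>V * H) + T * (?A * H))"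
    using h_pos stability[OF n] Y_nonneg[of n] H_nonneg n A0
    by (intro mult_left_mono add_mono mult_right_mono) auto
  also have "\<dots> = C\<^sub>F * h\<^sup>2"
  proof -
    have "h ^ 3 * (4 * (C\<^sub>V * H) + T * (?A * H)) = (H * h) * (4 * C\<^sub>V + T * ?A) * h\<^sup>2"
      by (simp only: distrib_left distrib_right mult_ac power2_eq_square power3_eq_cube)
    then show ?thesis by (simp only: H_h C\<^sub>F_def)
  qed
  finally show ?thesis .
qed

end

end

section \<open>Periodic functions and integrals over the period cell\<close>

lemma periodic_axis_int:
  fixes w :: "real ^ 'n \<Rightarrow> 'b"
  assumes "\<And>x d. w (x + axis d L) = w x"
  shows "w (x + axis d (L * real_of_int k)) = w x"
proof (induction k arbitrary: x rule: int_induct[where k = 0])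
  case base
  show ?case by simp
next
  case (step1 i)
  have "x + axis d (L * real_of_int (i + 1)) = (x + axis d L) + axis d (L * real_of_int i)"
    by (simp add: vec_eq_iff axis_def algebra_simps)
  then have "w (x + axis d (L * real_of_int (i + 1))) = w ((x + axis d L) + axis d (L * real_of_int i))"
    by (rule arg_cong)
  also have "\<dots> = w x" using step1.IH assms by simp
  finally show ?case .
next
  case (step2 i)
  have "x + axis d (L * real_of_int (i - 1)) + axis d L = x + axis d (L * real_of_int i)"
    by (simp add: vec_eq_iff axis_def algebra_simps)
  then have "w (x + axis d (L * real_of_int (i - 1)) + axis d L) = w (x + axis d (L * real_of_int i))"
    by (rule arg_cong)
  then show ?case unfolding assms step2.IH .
qed

lemma periodic_lattice:
  fixes w :: "real ^ 3 \<Rightarrow> 'b"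
  assumes w: "\<And>x d. w (x + axis d L) = w x"
    and y: "\<And>d. \<exists>n::int. y $ d = x $ d + L * real_of_int n"
  shows "w y = w x"
proof -
  obtain n :: "3 \<Rightarrow> int" where n: "y $ d = x $ d + L * real_of_int (n d)" for d
    using y by metis
  have "y = x + axis 1 (L * real_of_int (n 1)) + axis 2 (L * real_of_int (n 2)) + axis 3 (L * real_of_int (n 3))"
    by (simp add: vec_eq_iff forall_3 axis_def n)
  then show ?thesis by (simp add: periodic_axis_int[of w, OF w])
qed

text \<open>A representative in the closed period cell. Through it, bounds and zeros found on a
  compact set spread to the whole space.\<close>

definition reduce_cube :: "real \<Rightarrow> real \<Rightarrow> real ^ 3 \<Rightarrow> real ^ 3" where
  "reduce_cube a b x = (\<chi> d. x $ d + (b - a) * real_of_int (- \<lfloor>(x $ d - a) / (b - a)\<rfloor>))"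

lemma reduce_cube_mem:
  assumes "a < b"
  shows "reduce_cube a b x \<in> cbox (vec a) (vec b)"
proof -
  have "a \<le> x $ d + (b - a) * real_of_int (- \<lfloor>(x $ d - a) / (b - a)\<rfloor>)"
    "x $ d + (b - a) * real_of_int (- \<lfloor>(x $ d - a) / (b - a)\<rfloor>) \<le> b" for d
  proof -
    let ?t = "(x $ d - a) / (b - a)"
    have xd: "x $ d = a + (b - a) * ?t" using assms by simp
    have "0 \<le> (b - a) * (?t - \<lfloor>?t\<rfloor>)" "(b - a) * (?t - \<lfloor>?t\<rfloor>) \<le> (b - a) * 1"
      using assms by (intro mult_nonneg_nonneg mult_left_mono; linarith)+
    then show "a \<le> x $ d + (b - a) * real_of_int (- \<lfloor>?t\<rfloor>)" "x $ d + (b - a) * real_of_int (- \<lfloor>?t\<rfloor>) \<le> b"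
      using xd by (simp_all add: algebra_simps)
  qed
  then show ?thesis by (simp add: mem_box_cart reduce_cube_def)
qed

lemma periodic_reduce_cube:
  fixes w :: "real ^ 3 \<Rightarrow> 'b"
  assumes "\<And>x d. w (x + axis d (b - a)) = w x"
  shows "w (reduce_cube a b x) = w x"
  by (rule periodic_lattice[of w "b - a"]) (use assms in \<open>auto simp: reduce_cube_def simp del: of_int_minus\<close>)

text \<open>The translated cell is cut at the face \<open>b\<close>, and the slab that sticks out is
  moved back by one period; the two pieces then fill the original cell.\<close>

lemma integral_cube_translate:
  fixes w :: "real ^ 3 \<Rightarrow> complex"
  assumes cont: "continuous_on UNIV w" and per: "\<And>x d. w (x + axis d (b - a)) = w x"
    and s: "0 \<le> s" "s \<le> b - a"
  shows "integral (cbox (vec a) (vec b)) (\<lambda>x. w (x + axis d s)) = integral (cbox (vec a) (vec b)) w"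
proof -
  let ?c = "axis d s :: real ^ 3"
  let ?m = "(\<chi> i. if i = d then a + s else b) :: real ^ 3"
  let ?r = "(\<chi> i. if i = d then b else a) :: real ^ 3"
  have int: "w integrable_on cbox u v" for u v
    by (rule integrable_continuous[OF continuous_on_subset[OF cont]]) simp
  have dB: "axis d 1 \<in> (Basis :: (real ^ 3) set)" by (simp add: axis_in_Basis_iff)
  have ip: "x \<bullet> axis d 1 = x $ d" for x :: "real ^ 3" by (simp add: inner_axis)
  have all: "(\<forall>i. P i) \<longleftrightarrow> P d \<and> (\<forall>i. i \<noteq> d \<longrightarrow> P i)" for P :: "3 \<Rightarrow> bool" by metis
  have "integral (cbox (vec a) (vec b)) (\<lambda>x. w (x + ?c)) = integral (cbox (vec a + ?c) (vec b + ?c)) w"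
    using integral_shift_cbox[of "vec a + ?c" ?c "vec b + ?c" w] by simp
  also have "\<dots> = integral (cbox (vec a + ?c) (vec b + ?c) \<inter> {x. x \<bullet> axis d 1 \<le> b}) w
      + integral (cbox (vec a + ?c) (vec b + ?c) \<inter> {x. b \<le> x \<bullet> axis d 1}) w"
    by (rule integral_split[OF int dB])
  also have "cbox (vec a + ?c) (vec b + ?c) \<inter> {x. x \<bullet> axis d 1 \<le> b} = cbox (vec a + ?c) (vec b)"
    using s unfolding ip set_eq_iff mem_box_cart Int_iff mem_Collect_eq
    by (subst (1 2) all) (auto simp: axis_def)
  also have "cbox (vec a + ?c) (vec b + ?c) \<inter> {x. b \<le> x \<bullet> axis d 1} = cbox ?r (vec b + ?c)"
    using s unfolding ip set_eq_iff mem_box_cart Int_iff mem_Collect_eq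
    by (subst (1 2) all) (auto simp: axis_def)
  also have "integral (cbox ?r (vec b + ?c)) w = integral (cbox (vec a) ?m) w"
  proof -
    have "?r - axis d (b - a) = vec a" "(vec b + ?c) - axis d (b - a) = ?m"
      by (auto simp: vec_eq_iff axis_def)
    then show ?thesis using integral_shift_cbox[of ?r "axis d (b - a)" "vec b + ?c" w] per by simp
  qed
  also have "integral (cbox (vec a + ?c) (vec b)) w + integral (cbox (vec a) ?m) w =
      integral (cbox (vec a) (vec b)) w"
  proof -
    have "integral (cbox (vec a) (vec b)) w =
        integral (cbox (vec a) (vec b) \<inter> {x. x \<bullet> axis d 1 \<le> a + s}) w
        + integral (cbox (vec a) (vec b) \<inter> {x. a + s \<le> x \<bullet> axis d 1}) w"
      by (rule integral_split[OF int dB])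
    also have "cbox (vec a) (vec b) \<inter> {x. x \<bullet> axis d 1 \<le> a + s} = cbox (vec a) ?m"
      using s unfolding ip set_eq_iff mem_box_cart Int_iff mem_Collect_eq
      by (subst (1 2) all) auto
    also have "cbox (vec a) (vec b) \<inter> {x. a + s \<le> x \<bullet> axis d 1} = cbox (vec a + ?c) (vec b)"
      using s unfolding ip set_eq_iff mem_box_cart Int_iff mem_Collect_eq
      by (subst (1 2) all) (auto simp: axis_def)
    finally show ?thesis by simp
  qed
  finally show ?thesis .
qed

text \<open>The integrals of the translates are constant in the translation parameter.
  Differentiation under the integral sign at 0 gives the claim without iterated integrals.\<close>

lemma integral_cube_derivative:
  fixes w w' :: "real ^ 3 \<Rightarrow> complex"
  assumes ab: "a < b" and cont: "continuous_on UNIV w" and per: "\<And>x d. w (x + axis d (b - a)) = w x"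
    and cont': "continuous_on UNIV w'"
    and deriv: "\<And>x. ((\<lambda>s. w (x + axis d s)) has_vector_derivative w' x) (at 0)"
  shows "integral (cbox (vec a) (vec b)) w' = 0"
proof -
  let ?U = "{0..b - a}"
  let ?I = "\<lambda>s. integral (cbox (vec a) (vec b)) (\<lambda>x. w (x + axis d s))"
  have cax: "continuous_on A (\<lambda>z. axis d (f z) :: real ^ 3)" if "continuous_on A f"
    for A :: "'a::topological_space set" and f
    unfolding axis_def
  proof (rule continuous_on_vec_lambda)
    show "continuous_on A (\<lambda>z. if i = d then f z else 0)" for i
      using that by (cases "i = d") auto
  qed
  have 1: "(?I has_vector_derivative integral (cbox (vec a) (vec b)) (\<lambda>x. w' (x + axis d 0))) (at 0 within ?U)"
  proof (rule leibniz_rule_vector_derivative)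
    fix s x assume "s \<in> ?U"
    have "((\<lambda>r. w ((x + axis d s) + axis d (r - s))) has_vector_derivative (1 *\<^sub>R w' (x + axis d s))) (at s)"
    proof -
      have "((\<lambda>r. r - s) has_vector_derivative 1) (at s)"
        by (auto intro!: derivative_eq_intros simp flip: has_real_derivative_iff_has_vector_derivative)
      from vector_diff_chain_at[OF this, of "\<lambda>r. w ((x + axis d s) + axis d r)" "w' (x + axis d s)"]
        deriv[of "x + axis d s"] show ?thesis by (simp add: o_def)
    qed
    moreover have "(x + axis d s) + axis d (r - s) = x + axis d r" for r
      by (simp add: vec_eq_iff axis_def)
    ultimately show "((\<lambda>s. w (x + axis d s)) has_vector_derivative w' (x + axis d s)) (at s within ?U)"
      by (auto intro: has_vector_derivative_at_within)
  next
    show "(\<lambda>x. w (x + axis d s)) integrable_on cbox (vec a) (vec b)" for s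
      by (intro integrable_continuous continuous_on_compose2[OF cont] continuous_intros) auto
    show "continuous_on (?U \<times> cbox (vec a) (vec b)) (\<lambda>(s, x). w' (x + axis d s))"
      unfolding split_def by (intro continuous_on_compose2[OF cont'] continuous_intros cax) auto
  qed (use ab in auto)
  \<comment> \<open>The translates are compared for \<open>0 \<le> s \<le> b - a\<close> only, so
    both derivatives are one-sided at the end point 0, where they are still unique.\<close>
  have 2: "(?I has_vector_derivative 0) (at 0 within ?U)"
    by (rule has_vector_derivative_transform[OF _ integral_cube_translate[OF cont per]]) (use ab in auto)
  have "integral (cbox (vec a) (vec b)) (\<lambda>x. w' (x + axis d 0)) = 0"
    by (rule vector_derivative_unique_within_closed_interval[of 0 "b - a" 0 ?I]) (use 1 2 ab in auto)
  then show ?thesis by simp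
qed


section \<open>Fourier modes\<close>

lemma fourier_mode_continuous: "continuous_on A (fourier_mode a b k)"
  unfolding fourier_mode_def[abs_def] divide_inverse by (intro continuous_intros)

lemma fourier_mode_add: "fourier_mode a b (k + j) x = fourier_mode a b k x * fourier_mode a b j x"
  by (simp add: fourier_mode_def cis_mult sum.distrib algebra_simps add_divide_distrib)

lemma fourier_mode_0 [simp]: "fourier_mode a b 0 x = 1"
  by (simp add: fourier_mode_def)

lemma fourier_mode_minus: "fourier_mode a b (- k) x = cnj (fourier_mode a b k x)"
  by (simp add: fourier_mode_def cis_cnj sum_negf)

lemma norm_fourier_mode [simp]: "norm (fourier_mode a b k x) = 1"
  by (simp add: fourier_mode_def)

lemma fourier_mode_translate:
  "fourier_mode a b k (x + axis d s) = fourier_mode a b k x * cis (2 * pi * real_of_int (k $ d) * s / (b - a))"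
proof -
  have "(\<Sum>e\<in>UNIV. real_of_int (k $ e) * (x + axis d s) $ e) =
      (\<Sum>e\<in>UNIV. real_of_int (k $ e) * x $ e) + real_of_int (k $ d) * s"
    by (simp add: algebra_simps sum.distrib axis_def if_distrib[of "\<lambda>x. _ * x"] cong: if_cong)
  then show ?thesis
    by (simp add: fourier_mode_def cis_mult algebra_simps add_divide_distrib)
qed

lemma fourier_mode_periodic:
  assumes "a < b"
  shows "fourier_mode a b k (x + axis d (b - a)) = fourier_mode a b k x"
proof -
  have "cis (2 * pi * real_of_int (k $ d) * (b - a) / (b - a)) = 1"
    using assms cis_multiple_2pi[of "real_of_int (k $ d)"] by (simp add: mult_ac)
  then show ?thesis by (simp only: fourier_mode_translate mult_1_right)
qed

lemma fourier_mode_has_derivative: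
  "((\<lambda>s. fourier_mode a b k (x + axis d s)) has_vector_derivative
     \<i> * of_real (2 * pi * real_of_int (k $ d) / (b - a)) * fourier_mode a b k x) (at 0)"
proof -
  let ?c = "2 * pi * real_of_int (k $ d) / (b - a)"
  have "((\<lambda>z. exp (\<i> * of_real c * z)) has_field_derivative \<i> * of_real c) (at (complex_of_real 0))" for c
    by (auto intro!: derivative_eq_intros)
  from has_vector_derivative_mult_right[OF has_vector_derivative_real_field[OF this[of ?c]], of "fourier_mode a b k x"]
  have "((\<lambda>s. fourier_mode a b k x * exp (\<i> * of_real ?c * of_real s)) has_vector_derivative
      fourier_mode a b k x * (\<i> * of_real ?c)) (at 0)" .
  moreover have "cis (2 * pi * real_of_int (k $ d) * s / (b - a)) = exp (\<i> * of_real ?c * of_real s)" for s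
    by (simp add: cis_conv_exp mult_ac)
  ultimately show ?thesis by (simp only: fourier_mode_translate mult.commute[of "fourier_mode a b k x"])
qed

lemma content_cube: "a < b \<Longrightarrow> Henstock_Kurzweil_Integration.content (cbox (vec a :: real ^ 3) (vec b)) = (b - a) ^ 3"
  by (subst content_cbox_cart) (auto simp: interval_ne_empty_cart)

text \<open>If \<open>k $ d\<close> is nonzero, the derivative of the mode in direction
  \<open>d\<close> is a nonzero multiple of the mode, and the integral of that derivative
  vanishes.\<close>

lemma integral_fourier_mode:
  assumes ab: "a < b"
  shows "integral (cbox (vec a) (vec b)) (fourier_mode a b k) = (if k = 0 then of_real ((b - a) ^ 3) else 0)"
proof (cases "k = 0")
  case True
  then have "fourier_mode a b k = (\<lambda>x. 1)" by (simp add: fun_eq_iff)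
  then show ?thesis using True content_cube[OF ab] by (simp add: scaleR_conv_of_real)
next
  case False
  then obtain d where d: "k $ d \<noteq> 0" by (auto simp: vec_eq_iff)
  let ?c = "\<i> * of_real (2 * pi * real_of_int (k $ d) / (b - a)) :: complex"
  have "integral (cbox (vec a) (vec b)) (\<lambda>x. ?c * fourier_mode a b k x) = 0"
    by (rule integral_cube_derivative[where w = "fourier_mode a b k" and d = d, OF ab fourier_mode_continuous
          fourier_mode_periodic[OF ab] _ fourier_mode_has_derivative])
      (intro continuous_intros fourier_mode_continuous)
  moreover have "?c \<noteq> 0" using d ab by simp
  ultimately show ?thesis using False by simp
qed

lemma integral_cube_norm_le:
  fixes w :: "real ^ 3 \<Rightarrow> complex"
  assumes "a < b" "continuous_on UNIV w" "B \<ge> 0" "\<And>x. x \<in> cbox (vec a) (vec b) \<Longrightarrow> norm (w x) \<le> B"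
  shows "norm (integral (cbox (vec a) (vec b)) w) \<le> B * (b - a) ^ 3"
proof -
  have "(w has_integral integral (cbox (vec a) (vec b)) w) (cbox (vec a) (vec b))"
    by (intro integrable_integral integrable_continuous continuous_on_subset[OF assms(2)]) auto
  from has_integral_bound[OF assms(3) this] assms(4) show ?thesis
    by (simp add: content_cube[OF assms(1)])
qed


section \<open>Uniqueness of Fourier coefficients\<close>

text \<open>The multipliers that preserve the continuous periodic functions without Fourier coefficients
  form an algebra. Viewed on the torus, it contains the coordinates, so it is uniformly dense.\<close>

definition fourier_null :: "real \<Rightarrow> real \<Rightarrow> (real ^ 3 \<Rightarrow> complex) set" where
  "fourier_null a b = {w. continuous_on UNIV w \<and> (\<forall>x d. w (x + axis d (b - a)) = w x) \<and>
     (\<forall>k. integral (cbox (vec a) (vec b)) (\<lambda>x. w x * fourier_mode a b k x) = 0)}"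

lemma fourier_null_add:
  assumes "v \<in> fourier_null a b" "w \<in> fourier_null a b"
  shows "(\<lambda>x. v x + w x) \<in> fourier_null a b"
proof -
  have "integral (cbox (vec a) (vec b)) (\<lambda>x. v x * fourier_mode a b k x + w x * fourier_mode a b k x) = 0" for k
    using assms
    by (subst integral_add) (auto simp: fourier_null_def intro!: integrable_continuous continuous_intros
        fourier_mode_continuous intro: continuous_on_subset)
  with assms show ?thesis by (auto simp: fourier_null_def distrib_right intro!: continuous_intros)
qed

lemma fourier_null_cmult:
  assumes "w \<in> fourier_null a b"
  shows "(\<lambda>x. c * w x) \<in> fourier_null a b"
  using assms by (auto simp: fourier_null_def mult.assoc intro!: continuous_intros)

lemma fourier_null_mode:
  assumes "a < b" "w \<in> fourier_null a b"
  shows "(\<lambda>x. fourier_mode a b j x * w x) \<in> fourier_null a b"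
proof -
  have eq: "(\<lambda>x. fourier_mode a b j x * w x * fourier_mode a b k x) =
      (\<lambda>x. w x * fourier_mode a b (j + k) x)" for k
    by (simp add: fourier_mode_add mult_ac)
  from assms show ?thesis unfolding fourier_null_def mem_Collect_eq eq
    by (auto simp: fourier_mode_periodic intro!: continuous_intros fourier_mode_continuous)
qed

text \<open>Embeds the torus in complex 3-space. Opposite faces of the cell become identified, so
  that approximation on the compact image yields periodic functions of \<open>x\<close>, with the
  coordinates separating points.\<close>

definition torus_map :: "real \<Rightarrow> real \<Rightarrow> real ^ 3 \<Rightarrow> complex ^ 3" where
  "torus_map a b x = (\<chi> d. cis (2 * pi * x $ d / (b - a)))"

lemma torus_map_nth: "torus_map a b x $ d = fourier_mode a b (axis d 1) x"
  by (simp add: torus_map_def fourier_mode_def axis_def if_distrib[of "\<lambda>k. real_of_int k * _"] cong: if_cong)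

lemma continuous_on_torus_map: "continuous_on A (torus_map a b)"
  unfolding torus_map_def[abs_def] divide_inverse by (intro continuous_intros)

lemma torus_map_eqD:
  assumes "a < b" "torus_map a b x = torus_map a b y"
  shows "\<exists>n::int. y $ d = x $ d + (b - a) * real_of_int n"
proof -
  have "cis (2 * pi * y $ d / (b - a)) = cis (2 * pi * x $ d / (b - a))"
    using assms(2) by (simp add: torus_map_def vec_eq_iff)
  then have "sin (2 * pi * y $ d / (b - a)) = sin (2 * pi * x $ d / (b - a)) \<and>
      cos (2 * pi * y $ d / (b - a)) = cos (2 * pi * x $ d / (b - a))"
    by (simp add: complex_eq_iff)
  then obtain n :: int where "2 * pi * y $ d / (b - a) = 2 * pi * x $ d / (b - a) + 2 * pi * real_of_int n"
    unfolding sin_cos_eq_iff by blast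
  then have "2 * pi * y $ d = 2 * pi * (x $ d + (b - a) * real_of_int n)"
    using assms(1) by (simp add: field_simps)
  then show ?thesis by auto
qed

definition torus_multipliers :: "real \<Rightarrow> real \<Rightarrow> (complex ^ 3 \<Rightarrow> real) set" where
  "torus_multipliers a b = {g. continuous_on UNIV g \<and>
     (\<forall>w\<in>fourier_null a b. (\<lambda>x. complex_of_real (g (torus_map a b x)) * w x) \<in> fourier_null a b)}"

lemma torus_multipliers_Re_Im:
  assumes ab: "a < b"
  shows "(\<lambda>z. Re (z $ d)) \<in> torus_multipliers a b" "(\<lambda>z. Im (z $ d)) \<in> torus_multipliers a b"
proof -
  let ?e = "fourier_mode a b (axis d 1)" and ?e' = "fourier_mode a b (- axis d 1)"
  have "complex_of_real (Re (torus_map a b x $ d)) = 1/2 * ?e x + 1/2 * ?e' x"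
    "complex_of_real (Im (torus_map a b x $ d)) = (- \<i>/2) * ?e x + (\<i>/2) * ?e' x" for x
    by (simp_all add: complex_eq_iff torus_map_nth fourier_mode_minus)
  then have re: "complex_of_real (Re (torus_map a b x $ d)) * w x = 1/2 * (?e x * w x) + 1/2 * (?e' x * w x)"
    and im: "complex_of_real (Im (torus_map a b x $ d)) * w x = (- \<i>/2) * (?e x * w x) + (\<i>/2) * (?e' x * w x)"
    for w x by (simp_all only: distrib_right mult.assoc)
  show "(\<lambda>z. Re (z $ d)) \<in> torus_multipliers a b"
    unfolding torus_multipliers_def mem_Collect_eq re
    by (intro conjI ballI fourier_null_add fourier_null_cmult fourier_null_mode ab continuous_intros)
  show "(\<lambda>z. Im (z $ d)) \<in> torus_multipliers a b"
    unfolding torus_multipliers_def mem_Collect_eq im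
    by (intro conjI ballI fourier_null_add fourier_null_cmult fourier_null_mode ab continuous_intros)
qed

lemma function_ring_on_torus_multipliers:
  assumes ab: "a < b"
  shows "function_ring_on (torus_multipliers a b) (torus_map a b ` cbox (vec a) (vec b))"
proof
  show "compact (torus_map a b ` cbox (vec a) (vec b))"
    by (intro compact_continuous_image continuous_on_torus_map compact_cbox)
next
  fix f assume "f \<in> torus_multipliers a b"
  then show "continuous_on (torus_map a b ` cbox (vec a) (vec b)) f"
    by (auto simp: torus_multipliers_def intro: continuous_on_subset)
next
  fix f g assume fg: "f \<in> torus_multipliers a b" "g \<in> torus_multipliers a b"
  then show "(\<lambda>x. f x + g x) \<in> torus_multipliers a b"
    by (auto simp: torus_multipliers_def distrib_right intro!: continuous_intros fourier_null_add)
  show "(\<lambda>x. f x * g x) \<in> torus_multipliers a b"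
    using fg by (auto simp: torus_multipliers_def mult.assoc intro!: continuous_intros)
next
  fix c show "(\<lambda>_. c) \<in> torus_multipliers a b"
    by (auto simp: torus_multipliers_def intro!: fourier_null_cmult)
next
  fix x y :: "complex ^ 3" assume "x \<noteq> y"
  then obtain d where "Re (x $ d) \<noteq> Re (y $ d) \<or> Im (x $ d) \<noteq> Im (y $ d)"
    by (metis vec_eq_iff complex_eq_iff)
  then show "\<exists>f\<in>torus_multipliers a b. f x \<noteq> f y"
  proof
    assume "Re (x $ d) \<noteq> Re (y $ d)"
    then show ?thesis by (intro bexI[OF _ torus_multipliers_Re_Im(1)[OF ab]])
  next
    assume "Im (x $ d) \<noteq> Im (y $ d)"
    then show ?thesis by (intro bexI[OF _ torus_multipliers_Re_Im(2)[OF ab]])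
  qed
qed

text \<open>The real part of \<open>w\<close> descends to the image of the torus map: it is well
  defined, as points with the same image differ by periods, and continuous, as preimages of closed
  sets are images of compact sets. The Stone-Weierstrass theorem applies there.\<close>

lemma Re_fourier_null_approx:
  assumes ab: "a < b" and w: "w \<in> fourier_null a b" and \<epsilon>: "\<epsilon> > 0"
  shows "\<exists>g\<in>torus_multipliers a b. \<forall>x\<in>cbox (vec a) (vec b). \<bar>Re (w x) - g (torus_map a b x)\<bar> < \<epsilon>"
proof -
  let ?Q = "cbox (vec a) (vec b) :: (real ^ 3) set" and ?E = "torus_map a b"
  have cont: "continuous_on UNIV w" and per: "\<And>x d. w (x + axis d (b - a)) = w x"
    using w by (auto simp: fourier_null_def)
  define F where "F z = Re (w (inv_into ?Q ?E z))" for z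
  have F: "F (?E x) = Re (w x)" if "x \<in> ?Q" for x
  proof -
    have "?E (inv_into ?Q ?E (?E x)) = ?E x" using that by (intro f_inv_into_f) auto
    from periodic_lattice[of w, OF per torus_map_eqD[OF ab this]] show ?thesis by (simp add: F_def)
  qed
  have "continuous_on (?E ` ?Q) F"
  proof (subst continuous_on_closed_gen[where T = UNIV]; (intro allI impI)?)
    fix C :: "real set" assume "closedin (top_of_set UNIV) C"
    then have "closed C" by simp
    have "?E ` ?Q \<inter> F -` C = ?E ` (?Q \<inter> (\<lambda>x. Re (w x)) -` C)" using F by auto
    moreover have "compact (?Q \<inter> (\<lambda>x. Re (w x)) -` C)"
    proof -
      have "closed ((\<lambda>x. Re (w x)) -` C)"
        using \<open>closed C\<close> cont by (intro closed_vimage) (auto intro!: continuous_intros)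
      then show ?thesis by (intro compact_Int_closed) auto
    qed
    then have "compact (?E ` (?Q \<inter> (\<lambda>x. Re (w x)) -` C))"
      by (intro compact_continuous_image continuous_on_torus_map)
    ultimately show "closedin (top_of_set (?E ` ?Q)) (?E ` ?Q \<inter> F -` C)"
      by (metis closed_subset compact_imp_closed inf_le1)
  qed auto
  from function_ring_on.Stone_Weierstrass_basic[OF function_ring_on_torus_multipliers[OF ab] this \<epsilon>]
  show ?thesis using F by auto
qed

text \<open>For a multiplier \<open>g\<close> the product with \<open>w\<close> again has no Fourier
  coefficients, and mode 0 shows that the integral of \<open>g\<close> times the real part of
  \<open>w\<close> is 0. As \<open>g\<close> approximates that real part uniformly, the integral of
  its square is arbitrarily small.\<close>

lemma fourier_null_Re:
  assumes ab: "a < b" and w: "w \<in> fourier_null a b"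
  shows "Re (w x) = 0"
proof -
  let ?Q = "cbox (vec a) (vec b) :: (real ^ 3) set"
  have cont: "continuous_on A w" and per: "\<And>x d. w (x + axis d (b - a)) = w x" for A
    using w by (auto simp: fourier_null_def intro: continuous_on_subset)
  let ?r = "\<lambda>x. Re (w x)"
  have rc: "continuous_on A ?r" for A by (intro continuous_intros cont)
  obtain B where B: "\<And>x. x \<in> ?Q \<Longrightarrow> \<bar>?r x\<bar> \<le> B"
    using compact_imp_bounded[OF compact_continuous_image[OF rc compact_cbox, of "vec a" "vec b"]]
    by (auto simp: bounded_iff)
  have B0: "B \<ge> 0" using B[of "vec a"] ab by (force simp: mem_box_cart)
  let ?I = "integral ?Q (\<lambda>x. ?r x * ?r x)"
  have "\<bar>?I\<bar> \<le> \<epsilon> * (B * (b - a) ^ 3)" if \<epsilon>: "\<epsilon> > 0" for \<epsilon>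
  proof -
    obtain g where g: "g \<in> torus_multipliers a b" "\<And>x. x \<in> ?Q \<Longrightarrow> \<bar>?r x - g (torus_map a b x)\<bar> < \<epsilon>"
      using Re_fourier_null_approx[OF ab w \<epsilon>] by blast
    let ?g = "\<lambda>x. g (torus_map a b x)"
    have gc: "continuous_on A ?g" for A
      using g(1) by (intro continuous_on_compose2[OF _ continuous_on_torus_map]) (auto simp: torus_multipliers_def)
    have "(\<lambda>x. complex_of_real (?g x) * w x) \<in> fourier_null a b"
      using g(1) w by (auto simp: torus_multipliers_def)
    then have "integral ?Q (\<lambda>x. complex_of_real (?g x) * w x * fourier_mode a b 0 x) = 0"
      unfolding fourier_null_def by blast
    then have "integral ?Q (Re \<circ> (\<lambda>x. complex_of_real (?g x) * w x)) = 0"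
      by (subst integral_linear) (auto intro!: integrable_continuous continuous_intros cont gc bounded_linear_Re)
    then have 0: "integral ?Q (\<lambda>x. ?g x * ?r x) = 0" by (simp add: o_def)
    have "?I = integral ?Q (\<lambda>x. ?r x * ?r x) - integral ?Q (\<lambda>x. ?g x * ?r x)" by (simp add: 0)
    also have "\<dots> = integral ?Q (\<lambda>x. ?r x * ?r x - ?g x * ?r x)"
      by (rule integral_diff[symmetric]) (intro integrable_continuous continuous_intros rc gc)+
    finally have "?I = integral ?Q (\<lambda>x. ?r x * ?r x - ?g x * ?r x)" .
    moreover have "norm (integral ?Q (\<lambda>x. ?r x * ?r x - ?g x * ?r x)) \<le> (\<epsilon> * B) * Henstock_Kurzweil_Integration.content ?Q"
    proof (rule has_integral_bound)
      show "((\<lambda>x. ?r x * ?r x - ?g x * ?r x) has_integral integral ?Q (\<lambda>x. ?r x * ?r x - ?g x * ?r x)) ?Q"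
        by (intro integrable_integral integrable_continuous continuous_intros rc gc)
      fix x assume x: "x \<in> ?Q"
      have "\<bar>(?r x - ?g x) * ?r x\<bar> \<le> \<epsilon> * B"
        unfolding abs_mult using g(2)[OF x] B[OF x] \<epsilon> by (intro mult_mono) auto
      then show "norm (?r x * ?r x - ?g x * ?r x) \<le> \<epsilon> * B" by (simp add: left_diff_distrib)
    qed (use \<epsilon> B0 in auto)
    ultimately show ?thesis by (simp add: content_cube[OF ab] mult.assoc)
  qed
  note bound = this
  have "\<bar>?I\<bar> \<le> 0"
  proof (rule field_le_epsilon)
    fix e :: real assume e: "e > 0"
    let ?C = "B * (b - a) ^ 3 + 1"
    have C: "?C > 0" using B0 ab by (intro add_nonneg_pos) auto
    have "\<bar>?I\<bar> \<le> (e / ?C) * (B * (b - a) ^ 3)" using e C by (intro bound) auto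
    also have "\<dots> \<le> (e / ?C) * ?C" using e C by (intro mult_left_mono) auto
    finally show "\<bar>?I\<bar> \<le> 0 + e" using C by simp
  qed
  then have "?I = 0" by simp
  then have "\<forall>x\<in>?Q. ?r x * ?r x = 0"
    by (subst (asm) integral_cbox_eq_0_iff)
      (use ab in \<open>auto intro!: continuous_intros cont simp: interval_ne_empty_cart\<close>)
  then have "?r (reduce_cube a b x) = 0" using reduce_cube_mem[OF ab, of x] by auto
  then show ?thesis using periodic_reduce_cube[of w b a x, OF per] by simp
qed


section \<open>The error of the Fourier projection\<close>

text \<open>Only pure derivatives along each axis are recorded, with a bound at the top order: the
  decay of a Fourier coefficient is read off from a single direction in which the mode is
  high.\<close>

definition periodic_smooth :: "real \<Rightarrow> nat \<Rightarrow> real \<Rightarrow> (real ^ 3 \<Rightarrow> real) \<Rightarrow> bool" where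
  "periodic_smooth L m B u \<longleftrightarrow> (\<forall>d. \<exists>v::nat \<Rightarrow> real ^ 3 \<Rightarrow> real. v 0 = u \<and>
     (\<forall>j\<le>m. continuous_on UNIV (v j) \<and> space_periodic L (v j)) \<and>
     (\<forall>j<m. \<forall>x. ((\<lambda>s. v j (x + s *\<^sub>R axis d 1)) has_real_derivative v (Suc j) x) (at 0)) \<and>
     (\<forall>x. \<bar>v m x\<bar> \<le> B))"

lemma scaleR_axis_1 [simp]: "s *\<^sub>R axis d 1 = (axis d s :: real ^ 'n)"
  by (simp add: vec_eq_iff axis_def)

abbreviation fourier_integral :: "real \<Rightarrow> real \<Rightarrow> int ^ 3 \<Rightarrow> (real ^ 3 \<Rightarrow> real) \<Rightarrow> complex" where
  "fourier_integral a b k u \<equiv>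
     integral (cbox (vec a) (vec b)) (\<lambda>x. complex_of_real (u x) * fourier_mode a b k x)"

lemma fourier_coeff_eq: "fourier_coeff a b u k = fourier_integral a b (- k) u / of_real ((b - a) ^ 3)"
  by (simp add: fourier_coeff_def cube_def integral_open_interval fourier_mode_minus)

text \<open>Integration by parts, obtained from \<open>integral_cube_derivative\<close> for the
  product of \<open>u\<close> and the mode.\<close>

lemma fourier_integral_derivative:
  assumes ab: "a < b" and u: "continuous_on UNIV u" "continuous_on UNIV u'" "space_periodic (b - a) u"
    and d: "\<And>x. ((\<lambda>s. u (x + s *\<^sub>R axis d 1)) has_real_derivative u' x) (at 0)"
  shows "fourier_integral a b k u' =
    - (\<i> * of_real (2 * pi * real_of_int (k $ d) / (b - a))) * fourier_integral a b k u"
proof -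
  let ?Q = "cbox (vec a) (vec b) :: (real ^ 3) set" and ?e = "fourier_mode a b k"
  define c where "c = \<i> * of_real (2 * pi * real_of_int (k $ d) / (b - a))"
  have "integral ?Q (\<lambda>x. of_real (u x) * (c * ?e x) + of_real (u' x) * ?e x) = 0"
  proof (rule integral_cube_derivative[where w = "\<lambda>x. of_real (u x) * ?e x" and d = d, OF ab])
    fix x :: "real ^ 3"
    have "((\<lambda>s. complex_of_real (u (x + axis d s))) has_vector_derivative of_real (u' x)) (at 0)"
      using has_vector_derivative_of_real[of "\<lambda>s. u (x + axis d s)"] d[of x]
      by (simp add: has_real_derivative_iff_has_vector_derivative)
    from has_vector_derivative_mult[OF this fourier_mode_has_derivative[of a b k x d]]
    show "((\<lambda>s. complex_of_real (u (x + axis d s)) * ?e (x + axis d s)) has_vector_derivative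
        of_real (u x) * (c * ?e x) + of_real (u' x) * ?e x) (at 0)"
      by (simp add: c_def)
  qed (use u fourier_mode_periodic[OF ab] in
      \<open>auto simp: space_periodic_def intro!: continuous_intros fourier_mode_continuous\<close>)
  also have "integral ?Q (\<lambda>x. of_real (u x) * (c * ?e x) + of_real (u' x) * ?e x) =
      integral ?Q (\<lambda>x. c * (of_real (u x) * ?e x)) + fourier_integral a b k u'"
    by (subst integral_add[symmetric])
      (auto intro!: integrable_continuous continuous_intros fourier_mode_continuous
        continuous_on_subset[OF u(1)] continuous_on_subset[OF u(2)] simp: mult_ac)
  finally show ?thesis by (simp add: c_def add_eq_0_iff)
qed

lemma fourier_integral_decay:
  assumes ab: "a < b" and u: "periodic_smooth (b - a) m B u"
  shows "\<bar>2 * pi * real_of_int (k $ d) / (b - a)\<bar> ^ m * norm (fourier_integral a b k u) \<le> B * (b - a) ^ 3"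
proof -
  let ?c = "\<bar>2 * pi * real_of_int (k $ d) / (b - a)\<bar>"
  obtain v where v: "v 0 = u" "\<And>j. j \<le> m \<Longrightarrow> continuous_on UNIV (v j)"
      "\<And>j. j \<le> m \<Longrightarrow> space_periodic (b - a) (v j)"
      "\<And>j x. j < m \<Longrightarrow> ((\<lambda>s. v j (x + s *\<^sub>R axis d 1)) has_real_derivative v (Suc j) x) (at 0)"
      "\<And>x. \<bar>v m x\<bar> \<le> B"
    using u unfolding periodic_smooth_def by metis
  have "norm (fourier_integral a b k (v j)) = ?c ^ j * norm (fourier_integral a b k u)" if "j \<le> m" for j
    using that
  proof (induction j)
    case (Suc j)
    have "fourier_integral a b k (v (Suc j)) =
        - (\<i> * of_real (2 * pi * real_of_int (k $ d) / (b - a))) * fourier_integral a b k (v j)"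
      using Suc.prems by (intro fourier_integral_derivative ab v) auto
    then have "norm (fourier_integral a b k (v (Suc j))) = ?c * norm (fourier_integral a b k (v j))"
      by (simp only: norm_mult norm_minus_cancel norm_ii norm_of_real mult_1_left)
    then show ?case using Suc by (simp add: mult.assoc)
  qed (simp add: v(1))
  then have "?c ^ m * norm (fourier_integral a b k u) = norm (fourier_integral a b k (v m))" by simp
  also have "\<dots> \<le> B * (b - a) ^ 3"
    using v(2)[of m] v(5) order_trans[OF abs_ge_zero v(5)]
    by (intro integral_cube_norm_le ab) (auto simp: norm_mult intro!: continuous_intros fourier_mode_continuous)
  finally show ?thesis .
qed

lemma norm_fourier_coeff_le:
  assumes ab: "a < b" and u: "periodic_smooth (b - a) m B u" and r: "0 < r" "r \<le> \<bar>real_of_int (k $ d)\<bar>"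
  shows "norm (fourier_coeff a b u k) \<le> B * ((b - a) / r) ^ m"
proof -
  let ?c = "\<bar>2 * pi * real_of_int ((- k) $ d) / (b - a)\<bar>"
  let ?J = "norm (fourier_integral a b (- k) u)"
  have "1 * \<bar>real_of_int (k $ d)\<bar> \<le> (2 * pi) * \<bar>real_of_int (k $ d)\<bar>"
    using pi_gt3 by (intro mult_right_mono) auto
  with r have "r / (b - a) \<le> ?c"
    using ab by (auto simp: abs_mult abs_divide intro!: divide_right_mono)
  then have "(r / (b - a)) ^ m * ?J \<le> ?c ^ m * ?J"
    using r ab by (intro mult_right_mono power_mono) auto
  also have "\<dots> \<le> B * (b - a) ^ 3" by (rule fourier_integral_decay[OF ab u])
  finally have "(r / (b - a)) ^ m * (?J / (b - a) ^ 3) \<le> B"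
    using ab by (simp add: divide_le_eq)
  moreover have "norm (fourier_coeff a b u k) = ?J / (b - a) ^ 3"
    using ab unfolding fourier_coeff_eq norm_divide norm_of_real by simp
  ultimately have "norm (fourier_coeff a b u k) \<le> B / (r / (b - a)) ^ m"
    using r ab by (subst pos_le_divide_eq) (auto simp: mult.commute)
  then show ?thesis by (simp add: power_divide)
qed

section \<open>Convergence of the partial sums over cubes of modes\<close>

definition mode_box :: "nat \<Rightarrow> (int ^ 3) set" where
  "mode_box K = {k. \<forall>d. \<bar>k $ d\<bar> \<le> int K}"

lemma mode_box_eq: "mode_box K = {k. \<forall>d. - int K \<le> k $ d \<and> k $ d \<le> int K}"
proof -
  have "\<bar>z\<bar> \<le> int K \<longleftrightarrow> - int K \<le> z \<and> z \<le> int K" for z by linarith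
  then show ?thesis by (simp add: mode_box_def)
qed

lemma finite_mode_box [simp]: "finite (mode_box K)"
  unfolding mode_box_eq by (rule card_int_box_le)

lemma card_mode_box_le: "card (mode_box K) \<le> (2 * K + 1) ^ 3"
  using card_int_box_le(1)[of "- int K" "int K"] unfolding mode_box_eq by (simp add: nat_add_distrib nat_mult_distrib)

lemma mode_box_mono:
  assumes "K \<le> K'"
  shows "mode_box K \<subseteq> mode_box K'"
proof
  fix k assume k: "k \<in> mode_box K"
  have "\<bar>k $ d\<bar> \<le> int K'" for d
  proof -
    have "\<bar>k $ d\<bar> \<le> int K" using k by (simp add: mode_box_def)
    with assms show ?thesis by linarith
  qed
  then show "k \<in> mode_box K'" by (simp add: mode_box_def)
qed

definition fourier_sum :: "real \<Rightarrow> real \<Rightarrow> (real ^ 3 \<Rightarrow> real) \<Rightarrow> nat \<Rightarrow> real ^ 3 \<Rightarrow> complex" where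
  "fourier_sum a b u K x = (\<Sum>k\<in>mode_box K. fourier_coeff a b u k * fourier_mode a b k x)"

lemma fourier_proj_eq: "fourier_proj a b K u x = Re (fourier_sum a b u K x)"
  by (simp add: fourier_proj_def fourier_sum_def mode_box_def)

lemma continuous_fourier_sum: "continuous_on A (fourier_sum a b u K)"
  unfolding fourier_sum_def[abs_def] by (intro continuous_intros fourier_mode_continuous)

text \<open>A mode that is new in the larger cube has a component of size at least K + 1, so six
  derivatives give the decay (K + 1)^-6. Counting the whole cube, with at most (3 (K + 1))^3 modes,
  leaves 27 (K + 1)^-3, which a telescoping difference of inverse squares dominates.\<close>

lemma fourier_sum_step:
  assumes ab: "a < b" and u: "periodic_smooth (b - a) 6 B u" and K: "K \<ge> 1" and B: "B \<ge> 0"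
  defines "D \<equiv> 27 * B * (b - a) ^ 6"
  shows "norm (fourier_sum a b u (Suc K) x - fourier_sum a b u K x) \<le> D / (real K)\<^sup>2 - D / (real (Suc K))\<^sup>2"
proof -
  let ?n = "real (Suc K)"
  have "fourier_sum a b u (Suc K) x - fourier_sum a b u K x =
      (\<Sum>k\<in>mode_box (Suc K) - mode_box K. fourier_coeff a b u k * fourier_mode a b k x)"
    unfolding fourier_sum_def by (simp add: sum_diff mode_box_mono)
  also have "norm \<dots> \<le> (\<Sum>k\<in>mode_box (Suc K) - mode_box K. B * ((b - a) / ?n) ^ 6)"
  proof (rule sum_norm_le)
    fix k assume "k \<in> mode_box (Suc K) - mode_box K"
    then obtain d where "\<bar>k $ d\<bar> > int K" by (auto simp: mode_box_def not_le)
    then have "?n \<le> \<bar>real_of_int (k $ d)\<bar>" by linarith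
    then show "norm (fourier_coeff a b u k * fourier_mode a b k x) \<le> B * ((b - a) / ?n) ^ 6"
      by (simp add: norm_mult norm_fourier_coeff_le[OF ab u])
  qed
  also have "\<dots> = real (card (mode_box (Suc K) - mode_box K)) * (B * ((b - a) / ?n) ^ 6)" by simp
  also have "\<dots> \<le> (3 * ?n) ^ 3 * (B * ((b - a) / ?n) ^ 6)"
  proof (rule mult_right_mono)
    have "card (mode_box (Suc K) - mode_box K) \<le> card (mode_box (Suc K))"
      by (intro card_mono) auto
    also have "\<dots> \<le> (2 * Suc K + 1) ^ 3" by (rule card_mode_box_le)
    also have "\<dots> \<le> (3 * Suc K) ^ 3" by (rule power_mono) auto
    finally have "real (card (mode_box (Suc K) - mode_box K)) \<le> real ((3 * Suc K) ^ 3)"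
      by (rule of_nat_mono)
    then show "real (card (mode_box (Suc K) - mode_box K)) \<le> (3 * ?n) ^ 3" by simp
  qed (use B ab in auto)
  also have "\<dots> = D * (1 / ?n ^ 3)"
    by (simp add: D_def power_divide power_mult_distrib field_simps eval_nat_numeral del: of_nat_Suc)
  also have "\<dots> \<le> D * (1 / (real K)\<^sup>2 - 1 / ?n\<^sup>2)"
  proof (rule mult_left_mono)
    define t where "t = real K"
    have t: "t \<ge> 1" using K by (simp add: t_def)
    have "1 / (t + 1) ^ 3 \<le> 1 / t\<^sup>2 - 1 / (t + 1)\<^sup>2"
    proof -
      have "t\<^sup>2 \<le> (2 * t + 1) * (t + 1)" using t by (simp add: power2_eq_square algebra_simps)
      then have "t\<^sup>2 / (t\<^sup>2 * (t + 1) ^ 3) \<le> ((2 * t + 1) * (t + 1)) / (t\<^sup>2 * (t + 1) ^ 3)"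
        using t by (intro divide_right_mono) auto
      also have "t\<^sup>2 / (t\<^sup>2 * (t + 1) ^ 3) = 1 / (t + 1) ^ 3" using t by simp
      also have "((2 * t + 1) * (t + 1)) / (t\<^sup>2 * (t + 1) ^ 3) = 1 / t\<^sup>2 - 1 / (t + 1)\<^sup>2"
      proof -
        have "1 / t\<^sup>2 - 1 / (t + 1)\<^sup>2 = ((t + 1)\<^sup>2 - t\<^sup>2) / (t\<^sup>2 * (t + 1)\<^sup>2)"
          using t by (simp add: divide_simps)
        also have "(t + 1)\<^sup>2 - t\<^sup>2 = 2 * t + 1" by (simp add: power2_eq_square algebra_simps)
        also have "(2 * t + 1) / (t\<^sup>2 * (t + 1)\<^sup>2) = ((2 * t + 1) * (t + 1)) / (t\<^sup>2 * (t + 1) ^ 3)"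
          using t by (simp add: power2_eq_square power3_eq_cube)
        finally show ?thesis by simp
      qed
      finally show ?thesis .
    qed
    then show "1 / ?n ^ 3 \<le> 1 / (real K)\<^sup>2 - 1 / ?n\<^sup>2" by (simp add: t_def add.commute)
  qed (use B ab in \<open>auto simp: D_def\<close>)
  finally show ?thesis by (simp add: right_diff_distrib)
qed

lemma tendsto_divide_square: "(\<lambda>K. c / (real K)\<^sup>2) \<longlonglongrightarrow> 0"
  by (intro tendsto_divide_0[OF tendsto_const] filterlim_at_top_imp_at_infinity filterlim_pow_at_top
      filterlim_real_sequentially) simp

text \<open>Telescoping makes the partial sums uniformly Cauchy with rate K^-2. At this stage the
  limit \<open>V\<close> need not be \<open>u\<close>; uniqueness of Fourier coefficients identifies
  it later.\<close>

lemma fourier_sum_converges: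
  assumes ab: "a < b" and u: "periodic_smooth (b - a) 6 B u" and B: "B \<ge> 0"
  defines "D \<equiv> 27 * B * (b - a) ^ 6"
  obtains V where "\<And>K x. K \<ge> 1 \<Longrightarrow> norm (fourier_sum a b u K x - V x) \<le> D / (real K)\<^sup>2"
    "\<And>x. (\<lambda>K. fourier_sum a b u K x) \<longlonglongrightarrow> V x"
proof -
  have D: "D \<ge> 0" using B ab by (simp add: D_def)
  have bd: "norm (fourier_sum a b u (K + j) x - fourier_sum a b u K x) \<le> D / (real K)\<^sup>2 - D / (real (K + j))\<^sup>2"
    if K: "K \<ge> 1" for K j x
  proof (induction j)
    case (Suc j)
    show ?case
      using fourier_sum_step[OF ab u _ B, of "K + j" x] K Suc
        norm_triangle_ineq[of "fourier_sum a b u (Suc (K + j)) x - fourier_sum a b u (K + j) x"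
          "fourier_sum a b u (K + j) x - fourier_sum a b u K x"]
      unfolding D_def by simp
  qed simp
  have bd': "norm (fourier_sum a b u n x - fourier_sum a b u K x) \<le> D / (real K)\<^sup>2"
    if K: "K \<ge> 1" "n \<ge> K" for K n x
  proof -
    have "0 \<le> D / (real (K + (n - K)))\<^sup>2" using D by simp
    then show ?thesis using bd[OF K(1), of "n - K" x] K by simp
  qed
  have "convergent (\<lambda>K. fourier_sum a b u K x)" for x
  proof (rule Cauchy_convergent, rule CauchyI')
    fix e :: real assume e: "e > 0"
    have "\<forall>\<^sub>F K in sequentially. D / (real K)\<^sup>2 < e / 2 \<and> K \<ge> 1"
      using order_tendstoD(2)[OF tendsto_divide_square, of "e / 2"] e eventually_ge_at_top[of 1] by (simp add: eventually_conj_iff)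
    then obtain K where K: "D / (real K)\<^sup>2 < e / 2" "K \<ge> 1" by (auto simp: eventually_sequentially)
    have "dist (fourier_sum a b u m x) (fourier_sum a b u n x) < e" if "m \<ge> K" "n > m" for m n
    proof -
      have "norm (fourier_sum a b u m x - fourier_sum a b u n x) \<le>
          norm (fourier_sum a b u m x - fourier_sum a b u K x) + norm (fourier_sum a b u n x - fourier_sum a b u K x)"
        using norm_triangle_ineq4[of "fourier_sum a b u m x - fourier_sum a b u K x" "fourier_sum a b u n x - fourier_sum a b u K x"]
        by simp
      moreover have "n \<ge> K" using that by simp
      ultimately show ?thesis
        unfolding dist_norm using bd'[OF K(2) that(1), of x] bd'[OF K(2), of n x] K(1) by linarith
    qed
    then show "\<exists>M. \<forall>m\<ge>M. \<forall>n>m. dist (fourier_sum a b u m x) (fourier_sum a b u n x) < e" by blast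
  qed
  then obtain V where V: "(\<lambda>K. fourier_sum a b u K x) \<longlonglongrightarrow> V x" for x
    unfolding convergent_def by metis
  show ?thesis
  proof
    show "(\<lambda>K. fourier_sum a b u K x) \<longlonglongrightarrow> V x" for x by (rule V)
    fix K x assume K: "K \<ge> (1::nat)"
    have "norm (V x - fourier_sum a b u K x) \<le> D / (real K)\<^sup>2"
      by (rule Lim_norm_ubound[OF _ tendsto_diff[OF V tendsto_const]])
        (use bd'[OF K] in \<open>auto simp: eventually_sequentially\<close>)
    then show "norm (fourier_sum a b u K x - V x) \<le> D / (real K)\<^sup>2" by (simp add: norm_minus_commute)
  qed
qed

lemma integral_fourier_sum_mode:
  assumes ab: "a < b" and j: "- j \<in> mode_box K"
  shows "integral (cbox (vec a) (vec b)) (\<lambda>x. fourier_sum a b u K x * fourier_mode a b j x) = fourier_integral a b j u"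
proof -
  let ?Q = "cbox (vec a) (vec b) :: (real ^ 3) set"
  have "integral ?Q (\<lambda>x. fourier_sum a b u K x * fourier_mode a b j x) =
      integral ?Q (\<lambda>x. \<Sum>k\<in>mode_box K. fourier_coeff a b u k * fourier_mode a b (k + j) x)"
    by (simp only: fourier_sum_def sum_distrib_right fourier_mode_add mult.assoc)
  also have "\<dots> = (\<Sum>k\<in>mode_box K. fourier_coeff a b u k * integral ?Q (fourier_mode a b (k + j)))"
    by (subst integral_sum) (auto intro!: integrable_continuous continuous_intros fourier_mode_continuous)
  also have "\<dots> = (\<Sum>k\<in>mode_box K. if k = - j then fourier_coeff a b u k * of_real ((b - a) ^ 3) else 0)"
    by (intro sum.cong refl) (auto simp: integral_fourier_mode[OF ab] add_eq_0_iff2)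
  also have "\<dots> = fourier_coeff a b u (- j) * of_real ((b - a) ^ 3)" using j by simp
  also have "\<dots> = fourier_integral a b j u" using ab by (simp add: fourier_coeff_eq)
  finally show ?thesis .
qed

text \<open>For large \<open>K\<close> the partial sum and \<open>u\<close> have the same
  coefficient at a given mode, and the partial sums converge uniformly to \<open>V\<close>; hence
  \<open>u - V\<close> has no Fourier coefficients and its real part vanishes. The rate towards
  \<open>V\<close> is then the rate towards \<open>u\<close>.\<close>

lemma fourier_proj_error:
  assumes ab: "a < b" and u: "periodic_smooth (b - a) 6 B u" and K: "K \<ge> 1"
  shows "\<bar>fourier_proj a b K u x - u x\<bar> \<le> 27 * B * (b - a) ^ 6 / (real K)\<^sup>2"
proof -
  let ?Q = "cbox (vec a) (vec b) :: (real ^ 3) set"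
  let ?D = "27 * B * (b - a) ^ 6"
  have B: "B \<ge> 0" using u unfolding periodic_smooth_def by (meson abs_ge_zero order_trans)
  have uc: "continuous_on UNIV u" and up: "\<And>x d. u (x + axis d (b - a)) = u x"
    using u unfolding periodic_smooth_def space_periodic_def by (metis zero_le)+
  obtain V where V: "\<And>K x. K \<ge> 1 \<Longrightarrow> norm (fourier_sum a b u K x - V x) \<le> ?D / (real K)\<^sup>2"
    "\<And>x. (\<lambda>K. fourier_sum a b u K x) \<longlonglongrightarrow> V x"
    using fourier_sum_converges[OF ab u B] by metis
  have "uniform_limit UNIV (fourier_sum a b u) V sequentially"
  proof (rule uniform_limitI)
    fix e :: real assume e: "e > 0"
    show "\<forall>\<^sub>F n in sequentially. \<forall>x\<in>UNIV. dist (fourier_sum a b u n x) (V x) < e"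
      using order_tendstoD(2)[OF tendsto_divide_square[of ?D] e] eventually_ge_at_top[of 1]
      by eventually_elim (use V(1) in \<open>auto simp: dist_norm intro: le_less_trans\<close>)
  qed
  then have Vc: "continuous_on UNIV V"
    by (rule uniform_limit_theorem[rotated]) (auto simp: continuous_fourier_sum)
  have Vp: "V (x + axis d (b - a)) = V x" for x d
  proof -
    have "fourier_sum a b u K (x + axis d (b - a)) = fourier_sum a b u K x" for K
      by (simp add: fourier_sum_def fourier_mode_periodic[OF ab])
    then show ?thesis using V(2)[of x] V(2)[of "x + axis d (b - a)"] LIMSEQ_unique by simp
  qed
  have "(\<lambda>x. of_real (u x) - V x) \<in> fourier_null a b"
    unfolding fourier_null_def mem_Collect_eq
  proof (intro conjI allI)
    fix j :: "int ^ 3"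
    let ?I = "integral ?Q (\<lambda>x. (of_real (u x) - V x) * fourier_mode a b j x)"
    obtain K0 where K0: "- j \<in> mode_box K0"
    proof
      have "\<bar>j $ d\<bar> \<le> int (nat (\<Sum>d\<in>UNIV. \<bar>j $ d\<bar>))" for d
        using member_le_sum[of d UNIV "\<lambda>d. \<bar>j $ d\<bar>"] by simp
      then show "- j \<in> mode_box (nat (\<Sum>d\<in>UNIV. \<bar>j $ d\<bar>))" by (simp add: mode_box_def)
    qed
    have le: "norm ?I \<le> (?D * (b - a) ^ 3) / (real K)\<^sup>2" if K: "K \<ge> max 1 K0" for K
    proof -
      have jK: "- j \<in> mode_box K" using K0 K mode_box_mono[of K0 K] by auto
      let ?f = "\<lambda>x. complex_of_real (u x) * fourier_mode a b j x"
      let ?g = "\<lambda>x. fourier_sum a b u K x * fourier_mode a b j x"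
      let ?h = "\<lambda>x. (fourier_sum a b u K x - V x) * fourier_mode a b j x"
      have c: "continuous_on UNIV ?f" "continuous_on UNIV ?g" "continuous_on UNIV ?h"
        by (intro continuous_intros uc Vc continuous_fourier_sum fourier_mode_continuous)+
      then have i: "?f integrable_on ?Q" "?g integrable_on ?Q" "?h integrable_on ?Q"
        by (auto intro!: integrable_continuous intro: continuous_on_subset)
      have "?I = integral ?Q (\<lambda>x. (?f x - ?g x) + ?h x)"
        by (simp add: algebra_simps)
      also have "\<dots> = (integral ?Q ?f - integral ?Q ?g) + integral ?Q ?h"
        using i by (simp add: integral_add integral_diff integrable_diff)
      also have "\<dots> = integral ?Q ?h" by (simp add: integral_fourier_sum_mode[OF ab jK])
      also have "norm \<dots> \<le> (?D / (real K)\<^sup>2) * (b - a) ^ 3"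
        using V(1)[of K] K B ab c(3) by (intro integral_cube_norm_le) (auto simp: norm_mult)
      finally show ?thesis by simp
    qed
    have "norm ?I \<le> 0"
      by (rule tendsto_lowerbound[OF tendsto_divide_square]) (use le in \<open>auto simp: eventually_sequentially simp del: max.bounded_iff\<close>)
    then show "?I = 0" by simp
  qed (use up Vp uc Vc in \<open>auto intro!: continuous_intros\<close>)
  from fourier_null_Re[OF ab this, of x] have "Re (V x) = u x" by simp
  then show ?thesis
    using V(1)[OF K, of x] abs_Re_le_cmod[of "fourier_sum a b u K x - V x"]
    by (simp add: fourier_proj_eq)
qed

section \<open>Smooth periodic space-time functions\<close>

lemma Ck_on_cong:
  assumes "Ck_on m S f" and "\<And>z. z \<in> S \<Longrightarrow> f z = g z"
  shows "Ck_on m S g"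
proof (cases m)
  case 0
  then show ?thesis using assms by (auto cong: continuous_on_cong)
next
  case (Suc n)
  then obtain D where D: "\<And>z. z \<in> S \<Longrightarrow> (f has_derivative D z) (at z within S)"
    "\<And>e. e \<in> Basis \<Longrightarrow> Ck_on n S (\<lambda>z. D z e)"
    using assms(1) by auto
  have "(g has_derivative D z) (at z within S)" if "z \<in> S" for z
    by (rule has_derivative_transform[OF that _ D(1)[OF that]]) (simp add: assms(2))
  with D(2) show ?thesis unfolding Suc by auto
qed

lemma Ck_on_Suc: "Ck_on (Suc m) S f \<Longrightarrow> Ck_on m S f"
proof (induction m arbitrary: f)
  case 0
  then obtain D where "\<And>z. z \<in> S \<Longrightarrow> (f has_derivative D z) (at z within S)" by auto
  then have "continuous_on S f" by (rule has_derivative_continuous_on)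
  then show ?case by simp
next
  case (Suc m)
  from Suc.prems obtain D where D: "\<And>z. z \<in> S \<Longrightarrow> (f has_derivative D z) (at z within S)"
    "\<And>e. e \<in> Basis \<Longrightarrow> Ck_on (Suc m) S (\<lambda>z. D z e)"
    by (subst (asm) Ck_on.simps(2)) blast
  from D(1) Suc.IH[OF D(2)] show ?case by auto
qed

lemma Ck_on_mono: "Ck_on m S f \<Longrightarrow> k \<le> m \<Longrightarrow> Ck_on k S f"
  by (induction m) (auto simp: le_Suc_eq dest: Ck_on_Suc simp del: Ck_on.simps)

lemma Ck_on_const: "Ck_on m S (\<lambda>_. c)"
  by (induction m arbitrary: c) (auto intro!: exI[of _ "\<lambda>_ _. 0"])

text \<open>Lets the fixed charge, a function of space alone, be treated as a space-time function
  that is constant in time. A basis vector of the product has one zero component, so every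
  derivative either stays of this form or vanishes.\<close>

lemma Ck_on_snd:
  fixes f :: "'b::euclidean_space \<Rightarrow> real"
  assumes "Ck_on m UNIV f"
  shows "Ck_on m (S :: ('a::euclidean_space \<times> 'b) set) (\<lambda>z. f (snd z))"
  using assms
proof (induction m arbitrary: f)
  case 0
  then show ?case by (auto intro!: continuous_on_compose2[of UNIV f] continuous_intros)
next
  case (Suc m)
  then obtain D where D: "\<And>z. (f has_derivative D z) (at z)" "\<And>e. e \<in> Basis \<Longrightarrow> Ck_on m UNIV (\<lambda>z. D z e)"
    by auto
  have "((\<lambda>z. f (snd z)) has_derivative (\<lambda>w. D (snd z) (snd w))) (at z within S)" for z :: "'a \<times> 'b"
    using has_derivative_compose[OF has_derivative_snd[OF has_derivative_ident] D(1)] .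
  moreover have "Ck_on m S (\<lambda>z. D (snd z) (snd w))" if "w \<in> Basis" for w :: "'a \<times> 'b"
  proof (cases "snd w \<in> Basis")
    case True
    then show ?thesis using Suc.IH[OF D(2)] by auto
  next
    case False
    then have "snd w = 0" using that by (auto simp: Basis_prod_def)
    then show ?thesis using linear_0[OF has_derivative_linear[OF D(1)]] by (simp add: Ck_on_const)
  qed
  ultimately show ?case
    unfolding Ck_on.simps by (intro exI[of _ "\<lambda>z w. D (snd z) (snd w)"]) blast
qed

section \<open>Periodic space-time functions and bounds uniform in time\<close>

definition per_Ck :: "real \<Rightarrow> real \<Rightarrow> nat \<Rightarrow> (real \<Rightarrow> real ^ 3 \<Rightarrow> real) \<Rightarrow> bool" where
  "per_Ck L T m u \<longleftrightarrow> (\<forall>t\<in>{0..T}. space_periodic L (u t)) \<and> Ck_on m ({0..T} \<times> UNIV) (\<lambda>(t, x). u t x)"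

lemma per_Ck_mono: "per_Ck L T m u \<Longrightarrow> k \<le> m \<Longrightarrow> per_Ck L T k u"
  unfolding per_Ck_def using Ck_on_mono by blast

lemma per_Ck_continuous: "per_Ck L T m u \<Longrightarrow> continuous_on ({0..T} \<times> UNIV) (\<lambda>(t, x). u t x)"
  using per_Ck_mono[of L T m u 0] by (simp add: per_Ck_def)

lemma per_Ck_continuous_space:
  assumes "per_Ck L T m u" "t \<in> {0..T}"
  shows "continuous_on A (u t)"
proof -
  have "continuous_on A (\<lambda>x. (t, x))" by (intro continuous_on_Pair continuous_on_const continuous_on_id)
  moreover have "(\<lambda>x. (t, x)) ` A \<subseteq> {0..T} \<times> UNIV" using assms(2) by auto
  ultimately have "continuous_on A (\<lambda>x. (\<lambda>(t, x). u t x) (t, x))"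
    by (rule continuous_on_compose2[OF per_Ck_continuous[OF assms(1)]])
  then show ?thesis by simp
qed

lemma compact_continuous_bounded:
  fixes f :: "'a::topological_space \<Rightarrow> real"
  assumes "compact S" "continuous_on S f"
  shows "\<exists>B. \<forall>z\<in>S. \<bar>f z\<bar> \<le> B"
  using compact_imp_bounded[OF compact_continuous_image[OF assms(2,1)]] by (auto simp: bounded_iff)

lemma per_Ck_bounded:
  assumes ab: "a < b" and u: "per_Ck (b - a) T m u"
  shows "\<exists>B\<ge>0. \<forall>t\<in>{0..T}. \<forall>x. \<bar>u t x\<bar> \<le> B"
proof -
  have "\<exists>B. \<forall>z\<in>{0..T} \<times> cbox (vec a) (vec b). \<bar>(\<lambda>(t, x). u t x) z\<bar> \<le> B"
    by (intro compact_continuous_bounded continuous_on_subset[OF per_Ck_continuous[OF u]] compact_Times) auto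
  then obtain B where "\<forall>z\<in>{0..T} \<times> cbox (vec a) (vec b). \<bar>(\<lambda>(t, x). u t x) z\<bar> \<le> B" by blast
  then have B: "\<bar>u t x\<bar> \<le> B" if "t \<in> {0..T}" "x \<in> cbox (vec a) (vec b)" for t x
    using that by auto
  have "\<bar>u t x\<bar> \<le> max B 0" if t: "t \<in> {0..T}" for t x
  proof -
    have "u t (reduce_cube a b x) = u t x"
      using u t by (intro periodic_reduce_cube) (auto simp: per_Ck_def space_periodic_def)
    then show ?thesis using B[OF t reduce_cube_mem[OF ab, of x]] by simp
  qed
  then show ?thesis by (intro exI[of _ "max B 0"]) auto
qed

text \<open>The derivative within the slab is restricted to lines. A line in a space direction stays
  in the slab, which gives a two-sided derivative; in time the derivative is only within
  \<open>{0..T}\<close>.\<close>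

lemma Ck_on_spacetime_derivatives:
  assumes "Ck_on (Suc m) ({0..T} \<times> UNIV) (\<lambda>(t, x). u t x)"
  shows "\<exists>D :: real \<times> (real ^ 3) \<Rightarrow> real \<times> (real ^ 3) \<Rightarrow> real.
    (\<forall>t\<in>{0..T}. \<forall>x s d. ((\<lambda>s. u t (x + axis d s)) has_real_derivative D (t, x + axis d s) (0, axis d 1)) (at s)) \<and>
    (\<forall>t\<in>{0..T}. \<forall>x. ((\<lambda>s. u s x) has_real_derivative D (t, x) (1, 0)) (at t within {0..T})) \<and>
    (\<forall>e\<in>Basis. Ck_on m ({0..T} \<times> UNIV) (\<lambda>z. D z e))"
proof -
  let ?S = "{0..T} \<times> (UNIV :: (real ^ 3) set)"
  from assms obtain D where D: "\<And>z. z \<in> ?S \<Longrightarrow> ((\<lambda>(t, x). u t x) has_derivative D z) (at z within ?S)"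
    "\<And>e. e \<in> Basis \<Longrightarrow> Ck_on m ?S (\<lambda>z. D z e)"
    by auto
  show ?thesis
  proof (intro exI[of _ D] conjI ballI allI)
    fix t s d and x :: "real ^ 3" assume t: "t \<in> {0..T}"
    let ?z = "(t, x + axis d s)"
    have lin: "linear (D ?z)" using has_derivative_linear[OF D(1)[of ?z]] t by simp
    have "((\<lambda>s. (t, x + s *\<^sub>R axis d 1)) has_derivative (\<lambda>h. (0, h *\<^sub>R axis d 1))) (at s)"
      by (auto intro!: derivative_eq_intros simp del: scaleR_axis_1)
    then have der: "((\<lambda>s. (t, x + axis d s)) has_derivative (\<lambda>h. h *\<^sub>R (0, axis d 1))) (at s)" by simp
    have sub: "range (\<lambda>s. (t, x + axis d s)) \<subseteq> ?S" using t by auto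
    have "((\<lambda>s. u t (x + axis d s)) has_derivative (\<lambda>h. D ?z (h *\<^sub>R (0, axis d 1)))) (at s)"
      using has_derivative_in_compose2[OF D(1) sub UNIV_I der]
      by (simp del: scaleR_Pair)
    moreover have "(\<lambda>h. D ?z (h *\<^sub>R (0, axis d 1))) = (*) (D ?z (0, axis d 1))"
      by (simp add: linear_cmul[OF lin] fun_eq_iff mult.commute del: scaleR_Pair)
    ultimately show "((\<lambda>s. u t (x + axis d s)) has_real_derivative D ?z (0, axis d 1)) (at s)"
      by (simp only: has_field_derivative_def)
  next
    fix t and x :: "real ^ 3" assume t: "t \<in> {0..T}"
    have lin: "linear (D (t, x))" using has_derivative_linear[OF D(1)[of "(t, x)"]] t by simp
    have der: "((\<lambda>s. (s, x)) has_derivative (\<lambda>h. h *\<^sub>R (1, 0))) (at t within {0..T})"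
      by (auto intro!: derivative_eq_intros)
    have sub: "(\<lambda>s. (s, x)) ` {0..T} \<subseteq> ?S" by auto
    have "((\<lambda>s. u s x) has_derivative (\<lambda>h. D (t, x) (h *\<^sub>R (1, 0)))) (at t within {0..T})"
      using has_derivative_in_compose2[OF D(1) sub t der]
      by (simp del: scaleR_Pair)
    moreover have "(\<lambda>h. D (t, x) (h *\<^sub>R (1, 0))) = (*) (D (t, x) (1, 0))"
      by (simp add: linear_cmul[OF lin] fun_eq_iff mult.commute del: scaleR_Pair)
    ultimately show "((\<lambda>s. u s x) has_real_derivative D (t, x) (1, 0)) (at t within {0..T})"
      by (simp only: has_field_derivative_def)
  qed (use D(2) in auto)
qed

lemma per_Ck_partial_has_derivative:
  assumes u: "per_Ck L T (Suc m) u" and t: "t \<in> {0..T}"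
  shows "((\<lambda>s. u t (x + axis d s)) has_real_derivative partial d (u t) (x + axis d s)) (at s)"
proof -
  have "Ck_on (Suc m) ({0..T} \<times> UNIV) (\<lambda>(t, x). u t x)" using u unfolding per_Ck_def by blast
  from Ck_on_spacetime_derivatives[OF this] obtain D :: "real \<times> (real ^ 3) \<Rightarrow> real \<times> (real ^ 3) \<Rightarrow> real"
    where D: "\<And>t x s d. t \<in> {0..T} \<Longrightarrow>
      ((\<lambda>s. u t (x + axis d s)) has_real_derivative D (t, x + axis d s) (0, axis d 1)) (at s)"
    "\<And>t x. t \<in> {0..T} \<Longrightarrow> ((\<lambda>s. u s x) has_real_derivative D (t, x) (1, 0)) (at t within {0..T})"
    "\<And>e. e \<in> Basis \<Longrightarrow> Ck_on m ({0..T} \<times> UNIV) (\<lambda>z. D z e)"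
    by blast
  have "partial d (u t) y = D (t, y) (0, axis d 1)" for y
    using DERIV_imp_deriv[OF D(1)[OF t, of y d 0]] by (simp add: partial_def)
  then show ?thesis using D(1)[OF t, of x d s] by simp
qed

lemma partial_periodic:
  assumes u: "space_periodic L u"
  shows "space_periodic L (partial d u)"
proof -
  have "u (x + axis e L + s *\<^sub>R axis d 1) = u (x + s *\<^sub>R axis d 1)" for x e s
  proof -
    have "u ((x + s *\<^sub>R axis d 1) + axis e L) = u (x + s *\<^sub>R axis d 1)"
      using u unfolding space_periodic_def by blast
    then show ?thesis by (simp only: ac_simps)
  qed
  then show ?thesis by (simp add: space_periodic_def partial_def)
qed

lemma per_Ck_partial:
  assumes u: "per_Ck L T (Suc m) u"
  shows "per_Ck L T m (\<lambda>t. partial d (u t))"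
  unfolding per_Ck_def
proof (intro conjI ballI)
  fix t assume "t \<in> {0..T}"
  then show "space_periodic L (partial d (u t))" using u by (intro partial_periodic) (simp add: per_Ck_def)
next
  have "Ck_on (Suc m) ({0..T} \<times> UNIV) (\<lambda>(t, x). u t x)" using u unfolding per_Ck_def by blast
  from Ck_on_spacetime_derivatives[OF this] obtain D :: "real \<times> (real ^ 3) \<Rightarrow> real \<times> (real ^ 3) \<Rightarrow> real"
    where D: "\<And>t x s d. t \<in> {0..T} \<Longrightarrow>
      ((\<lambda>s. u t (x + axis d s)) has_real_derivative D (t, x + axis d s) (0, axis d 1)) (at s)"
    "\<And>t x. t \<in> {0..T} \<Longrightarrow> ((\<lambda>s. u s x) has_real_derivative D (t, x) (1, 0)) (at t within {0..T})"
    "\<And>e. e \<in> Basis \<Longrightarrow> Ck_on m ({0..T} \<times> UNIV) (\<lambda>z. D z e)"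
    by blast
  have "(0, axis d 1) \<in> (Basis :: (real \<times> (real ^ 3)) set)"
    by (auto simp: Basis_prod_def axis_in_Basis_iff)
  from Ck_on_cong[OF D(3)[OF this]]
  show "Ck_on m ({0..T} \<times> UNIV) (\<lambda>(t, x). partial d (u t) x)"
    using DERIV_imp_deriv[OF D(1)[where s = 0]] by (auto simp: partial_def)
qed

text \<open>The time derivative is bounded on the compact cell only. The point is first moved there
  by the periodicity of \<open>u\<close>, which spares a proof that the derivative is
  periodic.\<close>

lemma per_Ck_time_lipschitz:
  assumes ab: "a < b" and u: "per_Ck (b - a) T (Suc m) u"
  shows "\<exists>B\<ge>0. \<forall>s\<in>{0..T}. \<forall>t\<in>{0..T}. \<forall>x. \<bar>u s x - u t x\<bar> \<le> B * \<bar>s - t\<bar>"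
proof -
  have "Ck_on (Suc m) ({0..T} \<times> UNIV) (\<lambda>(t, x). u t x)" using u unfolding per_Ck_def by blast
  from Ck_on_spacetime_derivatives[OF this] obtain D :: "real \<times> (real ^ 3) \<Rightarrow> real \<times> (real ^ 3) \<Rightarrow> real"
    where D: "\<And>t x s d. t \<in> {0..T} \<Longrightarrow>
      ((\<lambda>s. u t (x + axis d s)) has_real_derivative D (t, x + axis d s) (0, axis d 1)) (at s)"
    "\<And>t x. t \<in> {0..T} \<Longrightarrow> ((\<lambda>s. u s x) has_real_derivative D (t, x) (1, 0)) (at t within {0..T})"
    "\<And>e. e \<in> Basis \<Longrightarrow> Ck_on m ({0..T} \<times> UNIV) (\<lambda>z. D z e)"
    by blast
  have "Ck_on m ({0..T} \<times> UNIV) (\<lambda>z. D z (1, 0))" by (rule D(3)) (auto simp: Basis_prod_def)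
  then have "continuous_on ({0..T} \<times> UNIV) (\<lambda>z. D z (1, 0))" using Ck_on_mono[of m _ _ 0] by simp
  then have "\<exists>B. \<forall>z\<in>{0..T} \<times> cbox (vec a) (vec b). \<bar>D z (1, 0)\<bar> \<le> B"
    by (intro compact_continuous_bounded compact_Times) (auto intro: continuous_on_subset)
  then obtain B where B: "\<And>t x. t \<in> {0..T} \<Longrightarrow> x \<in> cbox (vec a) (vec b) \<Longrightarrow> \<bar>D (t, x) (1, 0)\<bar> \<le> B"
    by blast
  have "\<bar>u s x - u t x\<bar> \<le> max B 0 * \<bar>s - t\<bar>" if st: "s \<in> {0..T}" "t \<in> {0..T}" for s t x
  proof -
    let ?y = "reduce_cube a b x"
    have y: "u r ?y = u r x" if "r \<in> {0..T}" for r
      using u that by (intro periodic_reduce_cube) (auto simp: per_Ck_def space_periodic_def)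
    have "norm (u s ?y - u t ?y) \<le> max B 0 * norm (s - t)"
    proof (rule field_differentiable_bound[where f = "\<lambda>r. u r ?y" and S = "{0..T}"])
      show "norm (D (z, ?y) (1, 0)) \<le> max B 0" if "z \<in> {0..T}" for z
        using B[OF that reduce_cube_mem[OF ab]] by (simp add: le_max_iff_disj)
    qed (use st D(2) in auto)
    then show ?thesis using y st by simp
  qed
  then show ?thesis by (intro exI[of _ "max B 0"]) auto
qed

lemma per_Ck_iterate: "per_Ck L T (m + j) u \<Longrightarrow> per_Ck L T m (((\<lambda>w t. partial d (w t)) ^^ j) u)"
proof (induction j arbitrary: m)
  case (Suc j)
  then have "per_Ck L T (Suc m) (((\<lambda>w t. partial d (w t)) ^^ j) u)" by simp
  from per_Ck_partial[OF this, of d] show ?case by simp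
qed simp

lemma per_Ck_periodic_smooth:
  assumes ab: "a < b" and u: "per_Ck (b - a) T m u"
  shows "\<exists>B\<ge>0. \<forall>t\<in>{0..T}. periodic_smooth (b - a) m B (u t)"
proof -
  define v where "v d j = ((\<lambda>w t. partial d (w t)) ^^ j) u" for d j
  have v: "per_Ck (b - a) T (m - j) (v d j)" if "j \<le> m" for d j
    unfolding v_def using per_Ck_iterate[of "b - a" T "m - j" j u d] u that by simp
  have "\<forall>d. \<exists>B\<ge>0. \<forall>t\<in>{0..T}. \<forall>x. \<bar>v d m t x\<bar> \<le> B"
    using per_Ck_bounded[OF ab v[of m]] by simp
  then obtain B where B: "\<And>d. B d \<ge> 0" "\<And>d t x. t \<in> {0..T} \<Longrightarrow> \<bar>v d m t x\<bar> \<le> B d" by metis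
  have "periodic_smooth (b - a) m (\<Sum>d\<in>UNIV. B d) (u t)" if t: "t \<in> {0..T}" for t
    unfolding periodic_smooth_def
  proof (intro allI exI[of _ "\<lambda>j. v _ j t"] conjI impI)
    fix d
    show "v d 0 t = u t" by (simp add: v_def)
    show "continuous_on UNIV (v d j t)" "space_periodic (b - a) (v d j t)" if "j \<le> m" for j
      using per_Ck_continuous_space[OF v[OF that] t] v[OF that] t by (auto simp: per_Ck_def)
    show "((\<lambda>s. v d j t (x + s *\<^sub>R axis d 1)) has_real_derivative v d (Suc j) t x) (at 0)" if "j < m" for j x
    proof -
      have "per_Ck (b - a) T (Suc (m - Suc j)) (v d j)" using v[of j d] that by (simp add: Suc_diff_Suc)
      from per_Ck_partial_has_derivative[OF this t, of x d 0] show ?thesis by (simp add: v_def)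
    qed
    show "\<bar>v d m t x\<bar> \<le> (\<Sum>d\<in>UNIV. B d)" for x
      using B(2)[OF t, of d x] member_le_sum[of d UNIV B] B(1) by fastforce
  qed
  then show ?thesis using B(1) by (intro exI[of _ "\<Sum>d\<in>UNIV. B d"]) (auto intro: sum_nonneg)
qed

lemma partial_of_DERIV: "((\<lambda>s. f (x + axis d s)) has_real_derivative D) (at 0) \<Longrightarrow> partial d f x = D"
  using DERIV_imp_deriv by (simp add: partial_def)

section \<open>Consistency\<close>

text \<open>Collects what the consistency estimates use, with one common constant. Mixed space
  derivatives do not occur, because each flux component is differentiated along its own axis
  only.\<close>

definition smooth_bounds :: "real \<Rightarrow> real \<Rightarrow> (real \<Rightarrow> real ^ 3 \<Rightarrow> real) \<Rightarrow> bool" where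
  "smooth_bounds T B u \<longleftrightarrow> (\<forall>t\<in>{0..T}. \<forall>x d.
     \<bar>u t x\<bar> \<le> B \<and> \<bar>partial d (u t) x\<bar> \<le> B \<and> \<bar>partial d (partial d (u t)) x\<bar> \<le> B \<and>
     \<bar>partial d (partial d (partial d (u t))) x\<bar> \<le> B \<and>
     (\<forall>r. ((\<lambda>s. u t (x + axis d s)) has_real_derivative partial d (u t) (x + axis d r)) (at r) \<and>
       ((\<lambda>s. partial d (u t) (x + axis d s)) has_real_derivative partial d (partial d (u t)) (x + axis d r)) (at r) \<and>
       ((\<lambda>s. partial d (partial d (u t)) (x + axis d s)) has_real_derivative
          partial d (partial d (partial d (u t))) (x + axis d r)) (at r)) \<and>
     (\<forall>s\<in>{0..T}. \<bar>u s x - u t x\<bar> \<le> B * \<bar>s - t\<bar> \<and> \<bar>partial d (u s) x - partial d (u t) x\<bar> \<le> B * \<bar>s - t\<bar> \<and>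
       \<bar>partial d (partial d (u s)) x - partial d (partial d (u t)) x\<bar> \<le> B * \<bar>s - t\<bar>))"

lemma smooth_boundsD:
  assumes "smooth_bounds T B u" "t \<in> {0..T}"
  shows "\<bar>u t x\<bar> \<le> B" "\<bar>partial d (u t) x\<bar> \<le> B" "\<bar>partial d (partial d (u t)) x\<bar> \<le> B"
    "\<bar>partial d (partial d (partial d (u t))) x\<bar> \<le> B"
    "((\<lambda>s. u t (x + axis d s)) has_real_derivative partial d (u t) (x + axis d r)) (at r)"
    "((\<lambda>s. partial d (u t) (x + axis d s)) has_real_derivative partial d (partial d (u t)) (x + axis d r)) (at r)"
    "((\<lambda>s. partial d (partial d (u t)) (x + axis d s)) has_real_derivative
          partial d (partial d (partial d (u t))) (x + axis d r)) (at r)"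
    "s \<in> {0..T} \<Longrightarrow> \<bar>u s x - u t x\<bar> \<le> B * \<bar>s - t\<bar>"
    "s \<in> {0..T} \<Longrightarrow> \<bar>partial d (u s) x - partial d (u t) x\<bar> \<le> B * \<bar>s - t\<bar>"
    "s \<in> {0..T} \<Longrightarrow> \<bar>partial d (partial d (u s)) x - partial d (partial d (u t)) x\<bar> \<le> B * \<bar>s - t\<bar>"
  using assms unfolding smooth_bounds_def by blast+

lemma smooth_bounds_mono:
  assumes u: "smooth_bounds T B u" and B: "B \<le> B'"
  shows "smooth_bounds T B' u"
proof -
  have "B * \<bar>s - t\<bar> \<le> B' * \<bar>s - t\<bar>" for s t using B by (intro mult_right_mono) auto
  then show ?thesis using u B unfolding smooth_bounds_def by (meson order_trans)
qed

lemma per_Ck_smooth_bounds: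
  assumes ab: "a < b" and u: "per_Ck (b - a) T 4 u"
  shows "\<exists>B\<ge>0. smooth_bounds T B u"
proof -
  have u: "per_Ck (b - a) T (Suc (Suc (Suc (Suc 0)))) u" using u by (simp add: eval_nat_numeral)
  note u1 = per_Ck_partial[OF u] note u2 = per_Ck_partial[OF u1] note u3 = per_Ck_partial[OF u2]
  obtain B0 where B0: "B0 \<ge> 0" "\<forall>t\<in>{0..T}. \<forall>x. \<bar>u t x\<bar> \<le> B0" using per_Ck_bounded[OF ab u] by blast
  have "\<forall>d. \<exists>B. B \<ge> 0 \<and> (\<forall>t\<in>{0..T}. \<forall>x. \<bar>partial d (u t) x\<bar> \<le> B)"
    using per_Ck_bounded[OF ab u1] by blast
  from choice[OF this] obtain B1 where B1: "\<forall>d. B1 d \<ge> 0 \<and> (\<forall>t\<in>{0..T}. \<forall>x. \<bar>partial d (u t) x\<bar> \<le> B1 d)" by blast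
  have "\<forall>d. \<exists>B. B \<ge> 0 \<and> (\<forall>t\<in>{0..T}. \<forall>x. \<bar>partial d (partial d (u t)) x\<bar> \<le> B)"
    using per_Ck_bounded[OF ab per_Ck_partial[OF u1]] by blast
  from choice[OF this] obtain B2 where B2: "\<forall>d. B2 d \<ge> 0 \<and> (\<forall>t\<in>{0..T}. \<forall>x. \<bar>partial d (partial d (u t)) x\<bar> \<le> B2 d)" by blast
  have "\<forall>d. \<exists>B. B \<ge> 0 \<and> (\<forall>t\<in>{0..T}. \<forall>x. \<bar>partial d (partial d (partial d (u t))) x\<bar> \<le> B)"
    using per_Ck_bounded[OF ab per_Ck_partial[OF per_Ck_partial[OF u1]]] by blast
  from choice[OF this] obtain B3 where B3: "\<forall>d. B3 d \<ge> 0 \<and> (\<forall>t\<in>{0..T}. \<forall>x. \<bar>partial d (partial d (partial d (u t))) x\<bar> \<le> B3 d)" by blast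
  obtain L0 where L0: "L0 \<ge> 0" "\<forall>s\<in>{0..T}. \<forall>t\<in>{0..T}. \<forall>x. \<bar>u s x - u t x\<bar> \<le> L0 * \<bar>s - t\<bar>"
    using per_Ck_time_lipschitz[OF ab u] by blast
  have "\<forall>d. \<exists>B. B \<ge> 0 \<and> (\<forall>s\<in>{0..T}. \<forall>t\<in>{0..T}. \<forall>x.
      \<bar>partial d (u s) x - partial d (u t) x\<bar> \<le> B * \<bar>s - t\<bar>)"
    using per_Ck_time_lipschitz[OF ab u1] by blast
  from choice[OF this] obtain L1 where L1: "\<forall>d. L1 d \<ge> 0 \<and> (\<forall>s\<in>{0..T}. \<forall>t\<in>{0..T}. \<forall>x.
      \<bar>partial d (u s) x - partial d (u t) x\<bar> \<le> L1 d * \<bar>s - t\<bar>)" by blast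
  have "\<forall>d. \<exists>B. B \<ge> 0 \<and> (\<forall>s\<in>{0..T}. \<forall>t\<in>{0..T}. \<forall>x.
      \<bar>partial d (partial d (u s)) x - partial d (partial d (u t)) x\<bar> \<le> B * \<bar>s - t\<bar>)"
    using per_Ck_time_lipschitz[OF ab per_Ck_partial[OF u1]] by blast
  from choice[OF this] obtain L2 where L2: "\<forall>d. L2 d \<ge> 0 \<and> (\<forall>s\<in>{0..T}. \<forall>t\<in>{0..T}. \<forall>x.
      \<bar>partial d (partial d (u s)) x - partial d (partial d (u t)) x\<bar> \<le> L2 d * \<bar>s - t\<bar>)" by blast
  define B where "B = B0 + L0 + (\<Sum>d\<in>UNIV. B1 d + B2 d + B3 d + L1 d + L2 d)"
  have nn: "0 \<le> B1 d + B2 d + B3 d + L1 d + L2 d" for d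
    using B1 B2 B3 L1 L2 by (intro add_nonneg_nonneg) auto
  have "B1 d + B2 d + B3 d + L1 d + L2 d \<le> (\<Sum>d\<in>UNIV. B1 d + B2 d + B3 d + L1 d + L2 d)" for d
    by (rule member_le_sum[where f = "\<lambda>d. B1 d + B2 d + B3 d + L1 d + L2 d"]) (use nn in auto)
  then have sum: "B1 d + B2 d + B3 d + L1 d + L2 d \<le> B - B0 - L0" for d by (simp add: B_def)
  have nn': "0 \<le> B1 d" "0 \<le> B2 d" "0 \<le> B3 d" "0 \<le> L1 d" "0 \<le> L2 d" for d
    using B1 B2 B3 L1 L2 by auto
  have le: "B0 \<le> B" "B1 d \<le> B" "B2 d \<le> B" "B3 d \<le> B" "L0 \<le> B" "L1 d \<le> B" "L2 d \<le> B" for d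
    using sum[of d] nn'[of d] B0(1) L0(1) by linarith+
  have mul: "x \<le> B * \<bar>s - t\<bar>" if "x \<le> l * \<bar>s - t\<bar>" "l \<le> B" for x l s t
    using mult_right_mono[OF that(2), of "\<bar>s - t\<bar>"] that(1) by linarith
  have "smooth_bounds T B u"
    unfolding smooth_bounds_def
  proof (intro ballI allI conjI)
    fix t x d s assume t: "t \<in> {0..T}"
    show "\<bar>u t x\<bar> \<le> B" using B0(2) t le(1) by (meson order_trans)
    show "\<bar>partial d (u t) x\<bar> \<le> B" using B1 t le(2) by (meson order_trans)
    show "\<bar>partial d (partial d (u t)) x\<bar> \<le> B" using B2 t le(3) by (meson order_trans)
    show "\<bar>partial d (partial d (partial d (u t))) x\<bar> \<le> B" using B3 t le(4) by (meson order_trans)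
    show "((\<lambda>s. u t (x + axis d s)) has_real_derivative partial d (u t) (x + axis d s)) (at s)"
      by (rule per_Ck_partial_has_derivative[OF u t])
    show "((\<lambda>s. partial d (u t) (x + axis d s)) has_real_derivative partial d (partial d (u t)) (x + axis d s)) (at s)"
      by (rule per_Ck_partial_has_derivative[OF u1 t])
    show "((\<lambda>s. partial d (partial d (u t)) (x + axis d s)) has_real_derivative
        partial d (partial d (partial d (u t))) (x + axis d s)) (at s)"
      by (rule per_Ck_partial_has_derivative[OF per_Ck_partial[OF u1] t])
    assume s: "s \<in> {0..T}"
    show "\<bar>u s x - u t x\<bar> \<le> B * \<bar>s - t\<bar>" by (rule mul[OF _ le(5)]) (use L0(2) s t in auto)
    show "\<bar>partial d (u s) x - partial d (u t) x\<bar> \<le> B * \<bar>s - t\<bar>" by (rule mul[OF _ le(6)[of d]]) (use L1 s t in auto)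
    show "\<bar>partial d (partial d (u s)) x - partial d (partial d (u t)) x\<bar> \<le> B * \<bar>s - t\<bar>"
      by (rule mul[OF _ le(7)[of d]]) (use L2 s t in auto)
  qed
  moreover have "B \<ge> 0" using le(1) B0(1) by linarith
  ultimately show ?thesis by blast
qed

text \<open>The mean value inequality for \<open>f z - z * g\<close>. With \<open>g\<close> the
  derivative at a reference point it takes the place of Taylor expansions, since errors of first
  order are sufficient throughout.\<close>

lemma linearization_bound:
  fixes f f' :: "real \<Rightarrow> real"
  assumes S: "convex S" and f: "\<And>z. z \<in> S \<Longrightarrow> (f has_real_derivative f' z) (at z within S)"
    and g: "\<And>z. z \<in> S \<Longrightarrow> \<bar>f' z - g\<bar> \<le> \<epsilon>" and xy: "x \<in> S" "y \<in> S"
  shows "\<bar>f x - f y - (x - y) * g\<bar> \<le> \<epsilon> * \<bar>x - y\<bar>"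
proof -
  have "norm ((f x - x * g) - (f y - y * g)) \<le> \<epsilon> * norm (x - y)"
    by (rule field_differentiable_bound[where f = "\<lambda>z. f z - z * g" and f' = "\<lambda>z. f' z - g" and S = S])
      (use assms in \<open>auto intro!: derivative_eq_intros\<close>)
  then show ?thesis by (simp add: algebra_simps)
qed

lemma difference_quotient_bound:
  fixes f f' :: "real \<Rightarrow> real"
  assumes S: "convex S" and f: "\<And>z. z \<in> S \<Longrightarrow> (f has_real_derivative f' z) (at z)"
    and g: "\<And>z. z \<in> S \<Longrightarrow> \<bar>f' z - g\<bar> \<le> \<epsilon>" and xy: "x \<in> S" "y \<in> S" "y < x"
  shows "\<bar>(f x - f y) / (x - y) - g\<bar> \<le> \<epsilon>"
proof -
  have "\<bar>f x - f y - (x - y) * g\<bar> \<le> \<epsilon> * \<bar>x - y\<bar>"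
    by (rule linearization_bound[OF S _ g xy(1,2)]) (rule has_field_derivative_at_within[OF f])
  moreover have "(f x - f y) / (x - y) - g = (f x - f y - (x - y) * g) / (x - y)"
    using xy(3) by (simp add: diff_divide_distrib)
  ultimately show ?thesis using xy(3) by (simp add: abs_divide divide_le_eq)
qed

lemma lipschitz_of_derivative:
  fixes f f' :: "real \<Rightarrow> real"
  assumes "\<And>z. (f has_real_derivative f' z) (at z)" "\<And>z. \<bar>f' z\<bar> \<le> B"
  shows "\<bar>f x - f y\<bar> \<le> B * \<bar>x - y\<bar>"
  using linearization_bound[of UNIV f f' 0 B x y] assms by simp

lemma smooth_bounds_space_lipschitz:
  assumes u: "smooth_bounds T B u" and t: "t \<in> {0..T}"
  shows "\<bar>u t (x + axis d r) - u t (x + axis d s)\<bar> \<le> B * \<bar>r - s\<bar>"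
    "\<bar>partial d (u t) (x + axis d r) - partial d (u t) (x + axis d s)\<bar> \<le> B * \<bar>r - s\<bar>"
    "\<bar>partial d (partial d (u t)) (x + axis d r) - partial d (partial d (u t)) (x + axis d s)\<bar> \<le> B * \<bar>r - s\<bar>"
  using lipschitz_of_derivative[OF smooth_boundsD(5)[OF u t, where x = x and d = d] smooth_boundsD(2)[OF u t]]
    lipschitz_of_derivative[OF smooth_boundsD(6)[OF u t, where x = x and d = d] smooth_boundsD(3)[OF u t]]
    lipschitz_of_derivative[OF smooth_boundsD(7)[OF u t, where x = x and d = d] smooth_boundsD(4)[OF u t]]
  by blast+

lemma first_difference_consistent:
  assumes u: "smooth_bounds T B u" and t: "t \<in> {0..T}" and h: "h > 0"
  shows "\<bar>(u t (x + axis d h) - u t x) / h - partial d (u t) (x + axis d (h / 2))\<bar> \<le> B * h"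
proof -
  have B: "B \<ge> 0" using smooth_boundsD(1)[OF u t] abs_ge_zero order_trans by blast
  have "\<bar>(u t (x + axis d h) - u t (x + axis d 0)) / (h - 0) - partial d (u t) (x + axis d (h / 2))\<bar> \<le> B * h"
  proof (rule difference_quotient_bound[where S = "{0..h}" and f = "\<lambda>s. u t (x + axis d s)"])
    fix z assume z: "z \<in> {0..h}"
    have "\<bar>partial d (u t) (x + axis d z) - partial d (u t) (x + axis d (h / 2))\<bar> \<le> B * \<bar>z - h / 2\<bar>"
      by (rule smooth_bounds_space_lipschitz[OF u t])
    also have "\<dots> \<le> B * h" using z B by (intro mult_left_mono) auto
    finally show "\<bar>partial d (u t) (x + axis d z) - partial d (u t) (x + axis d (h / 2))\<bar> \<le> B * h" .
  qed (use h smooth_boundsD(5)[OF u t] in auto)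
  then show ?thesis by simp
qed

text \<open>Two nested linearizations: the inner one for the derivative over a width
  \<open>h\<close>, the outer one for \<open>f s - f (s - h)\<close>, whose increment over [0, h] is
  the second difference.\<close>

lemma second_difference_consistent:
  assumes u: "smooth_bounds T B u" and t: "t \<in> {0..T}" and h: "h > 0"
  shows "\<bar>(u t (x + axis d h) - 2 * u t x + u t (x + axis d (- h))) / h\<^sup>2 - partial d (partial d (u t)) x\<bar> \<le> B * h"
proof -
  let ?f = "\<lambda>s. u t (x + axis d s)" and ?f' = "\<lambda>s. partial d (u t) (x + axis d s)"
    and ?g = "partial d (partial d (u t)) (x + axis d 0)"
  have B: "B \<ge> 0" using smooth_boundsD(1)[OF u t] abs_ge_zero order_trans by blast
  have inner: "\<bar>?f' r - ?f' (r - h) - (r - (r - h)) * ?g\<bar> \<le> (B * h) * \<bar>r - (r - h)\<bar>" if r: "r \<in> {0..h}" for r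
  proof (rule linearization_bound[where S = "{-h..h}" and f = ?f'])
    fix z assume z: "z \<in> {-h..h}"
    show "(?f' has_real_derivative partial d (partial d (u t)) (x + axis d z)) (at z within {-h..h})"
      by (rule has_field_derivative_at_within[OF smooth_boundsD(6)[OF u t]])
    have "\<bar>partial d (partial d (u t)) (x + axis d z) - ?g\<bar> \<le> B * \<bar>z - 0\<bar>"
      by (rule smooth_bounds_space_lipschitz[OF u t])
    also have "\<dots> \<le> B * h" using z B by (intro mult_left_mono) auto
    finally show "\<bar>partial d (partial d (u t)) (x + axis d z) - ?g\<bar> \<le> B * h" .
  qed (use r h in auto)
  have "\<bar>(?f h - ?f (h - h)) - (?f 0 - ?f (0 - h)) - (h - 0) * (h * ?g)\<bar> \<le> (B * h * h) * \<bar>h - 0\<bar>"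
  proof (rule linearization_bound[where S = "{0..h}" and f = "\<lambda>s. ?f s - ?f (s - h)"])
    fix z assume z: "z \<in> {0..h}"
    have "((\<lambda>s. ?f (s - h)) has_real_derivative ?f' (z - h)) (at z)"
      using DERIV_shift[of "?f" "?f' (z - h)" z "- h"] smooth_boundsD(5)[OF u t, of x d "z - h"]
      by (simp add: DERIV_shift add.commute)
    then show "((\<lambda>s. ?f s - ?f (s - h)) has_real_derivative ?f' z - ?f' (z - h)) (at z within {0..h})"
      by (rule has_field_derivative_at_within[OF DERIV_diff[OF smooth_boundsD(5)[OF u t]]])
    show "\<bar>?f' z - ?f' (z - h) - h * ?g\<bar> \<le> B * h * h" using inner[OF z] h by simp
  qed (use h in auto)
  then have "\<bar>(?f h - 2 * u t x + ?f (- h)) - h\<^sup>2 * ?g\<bar> / h\<^sup>2 \<le> B * h * h * h / h\<^sup>2"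
    using h by (intro divide_right_mono) (auto simp: power2_eq_square algebra_simps)
  moreover have "(?f h - 2 * u t x + ?f (- h)) / h\<^sup>2 - ?g = ((?f h - 2 * u t x + ?f (- h)) - h\<^sup>2 * ?g) / h\<^sup>2"
    using h by (simp add: field_simps)
  ultimately show ?thesis using h by (simp add: abs_divide power2_eq_square)
qed

section \<open>The continuous flux and its approximation by the Slotboom flux\<close>

definition flux_component :: "real \<Rightarrow> (real \<Rightarrow> real ^ 3 \<Rightarrow> real) \<Rightarrow> (real \<Rightarrow> real ^ 3 \<Rightarrow> real) \<Rightarrow> 3 \<Rightarrow> real \<Rightarrow> real ^ 3 \<Rightarrow> real" where
  "flux_component z c \<psi> d t x = partial d (c t) x + z * (c t x * partial d (\<psi> t) x)"

definition flux_component_deriv :: "real \<Rightarrow> (real \<Rightarrow> real ^ 3 \<Rightarrow> real) \<Rightarrow> (real \<Rightarrow> real ^ 3 \<Rightarrow> real) \<Rightarrow> 3 \<Rightarrow> real \<Rightarrow> real ^ 3 \<Rightarrow> real" where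
  "flux_component_deriv z c \<psi> d t x = partial d (partial d (c t)) x
     + z * (partial d (c t) x * partial d (\<psi> t) x + c t x * partial d (partial d (\<psi> t)) x)"

lemma abs_mult_le:
  fixes x y A B :: real
  shows "\<bar>x\<bar> \<le> A \<Longrightarrow> \<bar>y\<bar> \<le> B \<Longrightarrow> \<bar>x * y\<bar> \<le> A * B"
  unfolding abs_mult by (intro mult_mono) auto

lemma abs_sum5_le:
  fixes x1 x2 x3 x4 x5 :: real
  assumes "\<bar>x1\<bar> \<le> y1" "\<bar>x2\<bar> \<le> y2" "\<bar>x3\<bar> \<le> y3" "\<bar>x4\<bar> \<le> y4" "\<bar>x5\<bar> \<le> y5"
  shows "\<bar>x1 + x2 + x3 + x4 + x5\<bar> \<le> y1 + y2 + y3 + y4 + y5"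
  by (intro order_trans[OF abs_triangle_ineq] add_mono assms)

context
  fixes T B Q z :: real and c \<psi> :: "real \<Rightarrow> real ^ 3 \<Rightarrow> real"
  assumes c: "smooth_bounds T B c" and \<psi>: "smooth_bounds T B \<psi>" and z: "\<bar>z\<bar> \<le> Q"
begin

lemma flux_component_has_derivative:
  assumes t: "t \<in> {0..T}"
  shows "((\<lambda>s. flux_component z c \<psi> d t (x + axis d s)) has_real_derivative
    flux_component_deriv z c \<psi> d t (x + axis d r)) (at r)"
  unfolding flux_component_def flux_component_deriv_def
  by (rule derivative_eq_intros smooth_boundsD[OF c t] smooth_boundsD[OF \<psi> t] refl)+ (simp add: algebra_simps)

lemma divergence_flux:
  assumes t: "t \<in> {0..T}"
  shows "divergence (\<lambda>y. gradient (c t) y + (z * c t y) *\<^sub>R gradient (\<psi> t) y) x =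
    (\<Sum>d\<in>UNIV. flux_component_deriv z c \<psi> d t x)"
proof -
  have "partial d (\<lambda>y. (gradient (c t) y + (z * c t y) *\<^sub>R gradient (\<psi> t) y) $ d) x = flux_component_deriv z c \<psi> d t x" for d
  proof -
    have "(\<lambda>y. (gradient (c t) y + (z * c t y) *\<^sub>R gradient (\<psi> t) y) $ d) = flux_component z c \<psi> d t"
      by (simp add: fun_eq_iff gradient_def flux_component_def)
    then show ?thesis using partial_of_DERIV[OF flux_component_has_derivative[OF t, of d x 0, simplified]] by simp
  qed
  then show ?thesis by (simp add: divergence_def)
qed

text \<open>One third derivative of the concentration and four products of two bounded factors give
  the constant \<open>B + 4 * Q * B\<^sup>2\<close>. The time version has the same constant, as each
  of its two products splits into two terms.\<close>

lemma flux_component_deriv_space_lipschitz: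
  assumes t: "t \<in> {0..T}"
  shows "\<bar>flux_component_deriv z c \<psi> d t (x + axis d r) - flux_component_deriv z c \<psi> d t (x + axis d s)\<bar>
    \<le> (B + 4 * Q * B\<^sup>2) * \<bar>r - s\<bar>"
proof (rule lipschitz_of_derivative)
  fix r
  let ?x = "x + axis d r"
  let ?g = "partial d (partial d (partial d (c t))) ?x
     + z * ((partial d (partial d (c t)) ?x * partial d (\<psi> t) ?x + partial d (c t) ?x * partial d (partial d (\<psi> t)) ?x)
        + (partial d (c t) ?x * partial d (partial d (\<psi> t)) ?x + c t ?x * partial d (partial d (partial d (\<psi> t))) ?x))"
  show "((\<lambda>s. flux_component_deriv z c \<psi> d t (x + axis d s)) has_real_derivative ?g) (at r)"
    unfolding flux_component_deriv_def
    by (rule derivative_eq_intros smooth_boundsD[OF c t] smooth_boundsD[OF \<psi> t] refl)+ (simp add: algebra_simps)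
  note b = smooth_boundsD(1-4)[OF c t] smooth_boundsD(1-4)[OF \<psi> t]
  have "\<bar>(partial d (partial d (c t)) ?x * partial d (\<psi> t) ?x + partial d (c t) ?x * partial d (partial d (\<psi> t)) ?x)
        + (partial d (c t) ?x * partial d (partial d (\<psi> t)) ?x + c t ?x * partial d (partial d (partial d (\<psi> t))) ?x)\<bar>
      \<le> (B * B + B * B) + (B * B + B * B)"
    by (intro order_trans[OF abs_triangle_ineq] add_mono abs_mult_le b)
  from abs_mult_le[OF z this]
  show "\<bar>?g\<bar> \<le> B + 4 * Q * B\<^sup>2"
    using b(4)[of d ?x] by (intro order_trans[OF abs_triangle_ineq]) (simp add: power2_eq_square algebra_simps)
qed

lemma flux_component_deriv_time_lipschitz:
  assumes t: "t \<in> {0..T}" and s: "s \<in> {0..T}"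
  shows "\<bar>flux_component_deriv z c \<psi> d s x - flux_component_deriv z c \<psi> d t x\<bar> \<le> (B + 4 * Q * B\<^sup>2) * \<bar>s - t\<bar>"
proof -
  let ?e = "B * \<bar>s - t\<bar>"
  have prod: "\<bar>f1 * g1 - f0 * g0\<bar> \<le> ?e * B + B * ?e"
    if "\<bar>f1 - f0\<bar> \<le> ?e" "\<bar>g1\<bar> \<le> B" "\<bar>f0\<bar> \<le> B" "\<bar>g1 - g0\<bar> \<le> ?e" for f1 f0 g1 g0
  proof -
    have "f1 * g1 - f0 * g0 = (f1 - f0) * g1 + f0 * (g1 - g0)" by (simp add: algebra_simps)
    then show ?thesis using abs_mult_le[OF that(1,2)] abs_mult_le[OF that(3,4)] by linarith
  qed
  let ?P1 = "\<lambda>t. partial d (c t) x * partial d (\<psi> t) x" and ?P2 = "\<lambda>t. c t x * partial d (partial d (\<psi> t)) x"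
  have 1: "\<bar>?P1 s - ?P1 t\<bar> \<le> ?e * B + B * ?e"
    by (intro prod smooth_boundsD[OF c t] smooth_boundsD[OF c s] smooth_boundsD[OF \<psi> s] smooth_boundsD(9)[OF \<psi> t s]
        smooth_boundsD(9)[OF c t s])
  have 2: "\<bar>?P2 s - ?P2 t\<bar> \<le> ?e * B + B * ?e"
    by (intro prod smooth_boundsD(1)[OF c t] smooth_boundsD(3)[OF \<psi> s] smooth_boundsD(10)[OF \<psi> t s]
        smooth_boundsD(8)[OF c t s])
  have "\<bar>(?P1 s - ?P1 t) + (?P2 s - ?P2 t)\<bar> \<le> 4 * (B * ?e)" using 1 2 by (simp add: mult.commute)
  from abs_mult_le[OF z this]
  have 3: "\<bar>z * ((?P1 s - ?P1 t) + (?P2 s - ?P2 t))\<bar> \<le> Q * (4 * (B * ?e))" .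
  have "flux_component_deriv z c \<psi> d s x - flux_component_deriv z c \<psi> d t x =
     (partial d (partial d (c s)) x - partial d (partial d (c t)) x) + z * ((?P1 s - ?P1 t) + (?P2 s - ?P2 t))"
    by (simp add: flux_component_deriv_def algebra_simps)
  also have "\<bar>\<dots>\<bar> \<le> ?e + Q * (4 * (B * ?e))"
    by (intro order_trans[OF abs_triangle_ineq] add_mono 3 smooth_boundsD(10)[OF c t s])
  finally show ?thesis by (simp add: power2_eq_square algebra_simps)
qed

lemma flux_difference_consistent:
  assumes t: "t \<in> {0..T}" and h: "h > 0"
  shows "\<bar>(flux_component z c \<psi> d t (x + axis d (h / 2)) - flux_component z c \<psi> d t (x + axis d (- (h / 2)))) / h
    - flux_component_deriv z c \<psi> d t x\<bar> \<le> (B + 4 * Q * B\<^sup>2) * h"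
proof -
  let ?C = "B + 4 * Q * B\<^sup>2" and ?f = "\<lambda>s. flux_component z c \<psi> d t (x + axis d s)"
  have B: "B \<ge> 0" using smooth_boundsD(1)[OF c t] abs_ge_zero order_trans by blast
  have Q: "Q \<ge> 0" using z by linarith
  have "\<bar>(?f (h / 2) - ?f (- (h / 2))) / (h / 2 - - (h / 2)) - flux_component_deriv z c \<psi> d t (x + axis d 0)\<bar> \<le> ?C * h"
  proof (rule difference_quotient_bound[where S = "{-h/2..h/2}" and f = ?f])
    fix r assume r: "r \<in> {-h/2..h/2}"
    have "\<bar>flux_component_deriv z c \<psi> d t (x + axis d r) - flux_component_deriv z c \<psi> d t (x + axis d 0)\<bar> \<le> ?C * \<bar>r - 0\<bar>"
      by (rule flux_component_deriv_space_lipschitz[OF t])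
    also have "\<dots> \<le> ?C * h" using r B Q by (intro mult_left_mono) auto
    finally show "\<bar>flux_component_deriv z c \<psi> d t (x + axis d r) - flux_component_deriv z c \<psi> d t (x + axis d 0)\<bar> \<le> ?C * h" .
  qed (use h flux_component_has_derivative[OF t] in auto)
  then show ?thesis by simp
qed

text \<open>The equation replaces a second time derivative by the Lipschitz continuity in time of
  the flux divergence; the 3 counts the directions. The reference time is the new level, because the
  concentrations are implicit in the scheme.\<close>

lemma time_difference_consistent:
  assumes t: "t \<in> {0..T}" "t + k \<in> {0..T}" and k: "k > 0"
    and pde: "\<And>s. s \<in> {0..T} \<Longrightarrow> ((\<lambda>s. c s x) has_real_derivative
        (\<Sum>d\<in>UNIV. flux_component_deriv z c \<psi> d s x)) (at s within {0..T})"
  shows "\<bar>(c (t + k) x - c t x) / k - (\<Sum>d\<in>UNIV. flux_component_deriv z c \<psi> d (t + k) x)\<bar> \<le> 3 * (B + 4 * Q * B\<^sup>2) * k"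
proof -
  let ?C = "B + 4 * Q * B\<^sup>2" and ?G = "\<lambda>s. \<Sum>d\<in>UNIV. flux_component_deriv z c \<psi> d s x"
  have B: "B \<ge> 0" using smooth_boundsD(1)[OF c t(1)] abs_ge_zero order_trans by blast
  have Q: "Q \<ge> 0" using z by linarith
  have sub: "{t..t + k} \<subseteq> {0..T}" using t by auto
  have "\<bar>c (t + k) x - c t x - (t + k - t) * ?G (t + k)\<bar> \<le> (3 * ?C * k) * \<bar>t + k - t\<bar>"
  proof (rule linearization_bound[where S = "{t..t + k}" and f = "\<lambda>s. c s x"])
    fix s assume s: "s \<in> {t..t + k}"
    then have sT: "s \<in> {0..T}" using sub by auto
    show "((\<lambda>s. c s x) has_real_derivative ?G s) (at s within {t..t + k})"
      by (rule DERIV_subset[OF pde[OF sT] sub])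
    have "\<bar>?G s - ?G (t + k)\<bar> \<le> (\<Sum>d::3\<in>UNIV. ?C * \<bar>s - (t + k)\<bar>)"
      unfolding sum_subtractf[symmetric]
      by (intro order_trans[OF sum_abs] sum_mono flux_component_deriv_time_lipschitz t sT)
    also have "\<dots> \<le> (\<Sum>d::3\<in>UNIV. ?C * k)" using s B Q by (intro sum_mono mult_left_mono) auto
    also have "\<dots> = 3 * ?C * k" by (simp add: algebra_simps)
    finally show "\<bar>?G s - ?G (t + k)\<bar> \<le> 3 * ?C * k" .
  qed (use k in auto)
  then have "\<bar>c (t + k) x - c t x - k * ?G (t + k)\<bar> / k \<le> 3 * ?C * k * k / k"
    using k by (intro divide_right_mono) auto
  moreover have "(c (t + k) x - c t x) / k - ?G (t + k) = (c (t + k) x - c t x - k * ?G (t + k)) / k"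
    using k by (simp add: diff_divide_distrib)
  ultimately show ?thesis using k by (simp add: abs_divide)
qed

text \<open>The weights are split into their even and odd parts. The even part is 1 + O(h) and
  multiplies the difference quotient of the concentration; the odd part, divided by
  \<open>h\<close>, is the drift velocity up to O(h) and multiplies the mean concentration. The five
  terms of the constant correspond to the five summands of the identity \<open>eq\<close>, up to
  order.\<close>

lemma slotboom_flux_consistent:
  assumes t: "t \<in> {0..T}" "t + k \<in> {0..T}" and k: "0 < k" "k \<le> C\<^sub>2 * h" and h: "h > 0" and small: "Q * B * h \<le> 1"
    and cg: "cg p = c (t + k) x" "cg (p + axis d 1) = c (t + k) (x + axis d h)"
    and \<psi>g: "\<psi>g p = \<psi> t x" "\<psi>g (p + axis d 1) = \<psi> t (x + axis d h)"
  shows "\<bar>flux_component z c \<psi> d (t + k) (x + axis d (h / 2)) - slotboom_flux \<mu> h z cg \<psi>g d p\<bar>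
    \<le> (6 * Q * B\<^sup>2 + B + 6 * Q\<^sup>2 * B ^ 3 + Q * B\<^sup>2 * (1 + C\<^sub>2) + Q * B\<^sup>2) * h"
proof -
  have B: "B \<ge> 0" using smooth_boundsD(1)[OF c t(1)] abs_ge_zero order_trans by blast
  have Q: "Q \<ge> 0" using z by linarith
  let ?w = "face_weight \<mu>" and ?f = "x + axis d (h / 2)"
  define c1 c0 D\<psi> where v: "c1 = c (t + k) (x + axis d h)" "c0 = c (t + k) x"
    "D\<psi> = (\<psi> t (x + axis d h) - \<psi> t x) / h"
  define \<delta> where "\<delta> = z * (\<psi> t (x + axis d h) - \<psi> t x)"
  define Dc where "Dc = (c1 - c0) / h"
  have \<delta>h: "\<delta> / h = z * D\<psi>" by (simp add: \<delta>_def v)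
  have "\<bar>c (t + k) (x + axis d r) - c (t + k) (x + axis d s)\<bar> \<le> B * h" if "\<bar>r - s\<bar> \<le> h" for r s
    using smooth_bounds_space_lipschitz(1)[OF c t(2)] by (rule order_trans) (intro mult_left_mono that B)
  from this[of h 0] this[of h "h / 2"] this[of 0 "h / 2"]
  have Lc: "\<bar>c1 - c0\<bar> \<le> B * h" "\<bar>c1 - c (t + k) ?f\<bar> \<le> B * h" "\<bar>c0 - c (t + k) ?f\<bar> \<le> B * h"
    using h by (simp_all add: v)
  have Lp: "\<bar>\<psi> t (x + axis d h) - \<psi> t x\<bar> \<le> B * h"
    using smooth_bounds_space_lipschitz(1)[OF \<psi> t(1), of x d h 0] h by simp
  have \<delta>: "\<bar>\<delta>\<bar> \<le> Q * (B * h)" unfolding \<delta>_def by (rule abs_mult_le[OF z Lp])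
  have \<delta>1: "\<bar>\<delta>\<bar> \<le> 1" using \<delta> small by (simp add: mult.assoc)
  have Dc: "\<bar>Dc\<bar> \<le> B" unfolding Dc_def abs_divide using Lc(1) h by (simp add: divide_le_eq)
  have avg: "\<bar>(c1 + c0) / 2\<bar> \<le> B"
    using smooth_boundsD(1)[OF c t(2), of x] smooth_boundsD(1)[OF c t(2), of "x + axis d h"] by (simp add: v abs_le_iff)
  have lip: "\<bar>?w \<delta> - ?w 0\<bar> \<le> 6 * \<bar>\<delta> - 0\<bar>" "\<bar>?w (- \<delta>) - ?w 0\<bar> \<le> 6 * \<bar>- \<delta> - 0\<bar>"
    by (rule face_weight_lipschitz; use \<delta>1 in simp)+
  then have "\<bar>(?w \<delta> - 1) + (?w (- \<delta>) - 1)\<bar> \<le> 12 * (Q * (B * h))"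
    using \<delta> abs_triangle_ineq[of "?w \<delta> - 1" "?w (- \<delta>) - 1"] by simp
  moreover have "(?w \<delta> + ?w (- \<delta>)) / 2 - 1 = ((?w \<delta> - 1) + (?w (- \<delta>) - 1)) / 2" by (simp add: field_simps)
  ultimately have A: "\<bar>(?w \<delta> + ?w (- \<delta>)) / 2 - 1\<bar> \<le> 6 * (Q * (B * h))"
    by (simp only: abs_divide) simp
  have "\<delta>\<^sup>2 \<le> (Q * (B * h))\<^sup>2" using power_mono[OF \<delta>, of 2] by simp
  then have b: "\<bar>?w \<delta> - ?w (- \<delta>) - \<delta>\<bar> / h \<le> 6 * (Q * (B * h))\<^sup>2 / h"
    using face_weight_odd_part[OF \<delta>1, of \<mu>] h by (intro divide_right_mono) auto
  also have "6 * (Q * (B * h))\<^sup>2 / h = 6 * Q\<^sup>2 * B\<^sup>2 * h"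
    using h by (simp add: power2_eq_square)
  finally have b: "\<bar>(?w \<delta> - ?w (- \<delta>) - \<delta>) / h\<bar> \<le> 6 * Q\<^sup>2 * B\<^sup>2 * h" using h by (simp add: abs_divide)
  \<comment> \<open>Two errors add up: that of the difference quotient at the old time, and the lag
    of the potential by one step, which \<open>k \<le> C\<^sub>2 * h\<close> turns into order
    \<open>h\<close>.\<close>
  have dp: "\<bar>D\<psi> - partial d (\<psi> (t + k)) ?f\<bar> \<le> B * (1 + C\<^sub>2) * h"
  proof -
    have "\<bar>partial d (\<psi> t) ?f - partial d (\<psi> (t + k)) ?f\<bar> \<le> B * \<bar>t - (t + k)\<bar>"
      by (rule smooth_boundsD(9)[OF \<psi> t(2,1)])
    also have "\<dots> \<le> B * (C\<^sub>2 * h)" using k B by (intro mult_left_mono) auto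
    finally show ?thesis
      using first_difference_consistent[OF \<psi> t(1) h, of x d] unfolding v by (simp add: algebra_simps)
  qed
  have s: "slotboom_flux \<mu> h z cg \<psi>g d p = (c1 * ?w \<delta> - c0 * ?w (- \<delta>)) / h"
  proof -
    have "z * (\<psi> t x - \<psi> t (x + axis d h)) = - \<delta>" by (simp add: \<delta>_def algebra_simps)
    then show ?thesis by (simp add: slotboom_flux_def cg \<psi>g v \<delta>_def)
  qed
  let ?A = "(?w \<delta> + ?w (- \<delta>)) / 2" and ?\<beta> = "(?w \<delta> - ?w (- \<delta>) - \<delta>) / h" and ?m = "(c1 + c0) / 2"
  have "slotboom_flux \<mu> h z cg \<psi>g d p = ?A * Dc + ?m * (?\<beta> + z * D\<psi>)"
    unfolding s \<delta>h[symmetric] Dc_def using h by (simp add: field_simps)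
  then have eq: "slotboom_flux \<mu> h z cg \<psi>g d p - flux_component z c \<psi> d (t + k) ?f =
      (?A - 1) * Dc + (Dc - partial d (c (t + k)) ?f) + ?m * ?\<beta> + ?m * (z * (D\<psi> - partial d (\<psi> (t + k)) ?f))
      + (z * partial d (\<psi> (t + k)) ?f) * (?m - c (t + k) ?f)"
    by (simp add: flux_component_def algebra_simps)
  have "\<bar>(?A - 1) * Dc\<bar> \<le> 6 * (Q * (B * h)) * B" by (rule abs_mult_le[OF A Dc])
  moreover have "\<bar>Dc - partial d (c (t + k)) ?f\<bar> \<le> B * h"
    using first_difference_consistent[OF c t(2) h, of x d] by (simp add: Dc_def v)
  moreover have "\<bar>?m * ?\<beta>\<bar> \<le> B * (6 * Q\<^sup>2 * B\<^sup>2 * h)" by (rule abs_mult_le[OF avg b])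
  moreover have "\<bar>?m * (z * (D\<psi> - partial d (\<psi> (t + k)) ?f))\<bar> \<le> B * (Q * (B * (1 + C\<^sub>2) * h))"
    by (rule abs_mult_le[OF avg abs_mult_le[OF z dp]])
  moreover have "\<bar>(z * partial d (\<psi> (t + k)) ?f) * (?m - c (t + k) ?f)\<bar> \<le> (Q * B) * (B * h)"
    by (rule abs_mult_le[OF abs_mult_le[OF z smooth_boundsD(2)[OF \<psi> t(2)]]])
      (use Lc(2,3) in \<open>simp add: abs_le_iff field_simps\<close>)
  ultimately have "\<bar>slotboom_flux \<mu> h z cg \<psi>g d p - flux_component z c \<psi> d (t + k) ?f\<bar> \<le>
      6 * (Q * (B * h)) * B + B * h + B * (6 * Q\<^sup>2 * B\<^sup>2 * h) + B * (Q * (B * (1 + C\<^sub>2) * h)) + (Q * B) * (B * h)"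
    unfolding eq by (rule abs_sum5_le)
  also have "\<dots> = (6 * Q * B\<^sup>2 + B + 6 * Q\<^sup>2 * B ^ 3 + Q * B\<^sup>2 * (1 + C\<^sub>2) + Q * B\<^sup>2) * h"
    by (simp add: power2_eq_square power3_eq_cube algebra_simps)
  finally show ?thesis by (simp add: abs_minus_commute)
qed

end

section \<open>The error equations of the scheme\<close>

lemma mesh_pos: "a < b \<Longrightarrow> mesh a b K > 0"
  by (simp add: mesh_def)

lemma cell_centre_plus: "cell_centre a b K (p + axis d n) = cell_centre a b K p + axis d (real_of_int n * mesh a b K)"
  by (auto simp: cell_centre_def vec_eq_iff axis_def algebra_simps)

lemma C_per_cell_centre:
  assumes u: "space_periodic (b - a) u"
  shows "(\<lambda>p. u (cell_centre a b K p + y)) \<in> C_per K"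
proof -
  have "real (num_points K) * mesh a b K = b - a" by (simp add: mesh_def)
  then have "cell_centre a b K (p + axis d (int (num_points K))) + y = (cell_centre a b K p + y) + axis d (b - a)" for p d
    by (simp add: cell_centre_plus ac_simps)
  moreover have "u (x + axis d (b - a)) = u x" for x d using u by (simp add: space_periodic_def)
  ultimately have "u (cell_centre a b K (p + axis d (int (num_points K))) + y) = u (cell_centre a b K p + y)" for p d
    by (simp only:)
  then show ?thesis by (simp add: C_per_def)
qed

lemma C_per_grid_restrict: "space_periodic (b - a) u \<Longrightarrow> grid_restrict a b K u \<in> C_per K"
  using C_per_cell_centre[of b a u K 0] by (simp add: grid_restrict_def[abs_def])

lemma grid_restrict_plus:
  "grid_restrict a b K u (p + axis d 1) = u (cell_centre a b K p + axis d (mesh a b K))"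
  "grid_restrict a b K u (p - axis d 1) = u (cell_centre a b K p + axis d (- mesh a b K))"
proof -
  have eq: "p - axis d 1 = p + axis d (- 1)" by (simp add: vec_eq_iff axis_def)
  show "grid_restrict a b K u (p - axis d 1) = u (cell_centre a b K p + axis d (- mesh a b K))"
    unfolding grid_restrict_def eq cell_centre_plus by simp
qed (simp add: grid_restrict_def cell_centre_plus)

lemma fourier_proj_periodic: "a < b \<Longrightarrow> space_periodic (b - a) (fourier_proj a b K u)"
  by (simp add: space_periodic_def fourier_proj_eq fourier_sum_def fourier_mode_periodic)

lemma abs_sum_UNIV_3_le: "(\<And>d. \<bar>f d\<bar> \<le> B) \<Longrightarrow> \<bar>\<Sum>d\<in>UNIV. f d\<bar> \<le> 3 * B" for f :: "3 \<Rightarrow> real"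
  using sum_norm_le[of UNIV f "\<lambda>_. B"] by simp

lemma slotboom_step_flux:
  assumes "slotboom_step \<mu> a b \<kappa> M q \<rho> K \<Delta>t c \<psi> c' \<psi>'"
  shows "l \<in> {1..M} \<Longrightarrow> c' l \<in> C_per K" "\<psi>' \<in> C_per K"
    "l \<in> {1..M} \<Longrightarrow> (c' l p - c l p) / \<Delta>t =
      div_h (mesh a b K) (slotboom_flux \<mu> (mesh a b K) (q l) (c' l) \<psi>) p"
    "- \<kappa> * laplace_h (mesh a b K) \<psi>' p =
      (\<Sum>l=1..M. q l * c' l p) + grid_restrict a b K (fourier_proj a b K \<rho>) p"
  using assms unfolding slotboom_step_def Let_def slotboom_flux_eq by (auto simp: C_per0_def)

lemma error_system_slotboom:
  fixes K :: nat and \<Delta>t :: real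
  assumes ab: "a < b" and \<kappa>: "\<kappa> > 0" and Q: "Q \<ge> 0" and B: "B \<ge> 0" and P: "P \<ge> 0" and dt: "\<Delta>t > 0"
    and q: "\<And>l. l \<in> {1..M} \<Longrightarrow> \<bar>q l\<bar> \<le> Q"
    and pnp: "PNP_solution a b T \<kappa> M q \<rho> c\<^sub>i\<^sub>n c \<psi>"
    and \<psi>: "smooth_bounds T B \<psi>" and c: "\<And>l. l \<in> {1..M} \<Longrightarrow> smooth_bounds T B (c l)"
    and h1: "mesh a b K \<le> 1" and small: "Q * B * mesh a b K \<le> 1" and dth: "\<Delta>t \<le> C\<^sub>2 * mesh a b K"
    and C2: "C\<^sub>2 \<ge> 0"
    and P\<psi>: "\<And>x. \<bar>fourier_proj a b K (\<psi> 0) x - \<psi> 0 x\<bar> \<le> P * (mesh a b K)\<^sup>2"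
    and Pc: "\<And>l x. l \<in> {1..M} \<Longrightarrow> \<bar>fourier_proj a b K (c l 0) x - c l 0 x\<bar> \<le> P * (mesh a b K)\<^sup>2"
    and P\<rho>: "\<And>x. \<bar>fourier_proj a b K \<rho> x - \<rho> x\<bar> \<le> P * (mesh a b K)\<^sup>2"
    and sol: "slotboom_solution \<mu> a b T \<kappa> M q \<rho> c \<psi> K \<Delta>t cn \<psi>n"
    and R: "P + (6 * Q * B\<^sup>2 + B + 6 * Q\<^sup>2 * B ^ 3 + Q * B\<^sup>2 * (1 + C\<^sub>2) + Q * B\<^sup>2)
        + 3 * (B + 4 * Q * B\<^sup>2) * (1 + C\<^sub>2) + 3 * \<kappa> * B \<le> R"
  shows "\<exists>r s. error_system \<mu> a b T \<kappa> Q B R \<Delta>t M K q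
    (\<lambda>l n. grid_restrict a b K (c l (real n * \<Delta>t))) cn (\<lambda>n. grid_restrict a b K (\<psi> (real n * \<Delta>t))) \<psi>n r s"
proof -
  let ?h = "mesh a b K" and ?x = "cell_centre a b K" and ?G = "B + 4 * Q * B\<^sup>2"
  let ?R1 = "6 * Q * B\<^sup>2 + B + 6 * Q\<^sup>2 * B ^ 3 + Q * B\<^sup>2 * (1 + C\<^sub>2) + Q * B\<^sup>2"
  define ce where "ce l n = grid_restrict a b K (c l (real n * \<Delta>t))" for l n
  define \<psi>e where "\<psi>e n = grid_restrict a b K (\<psi> (real n * \<Delta>t))" for n
  \<comment> \<open>The exact flux at the faces and at the new time, where the residual is cut in
    two. The numerical flux of the exact solution is compared with \<open>J\<close> under the
    divergence, so that the error is not divided by \<open>h\<close>; the difference between the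
    time quotient and the divergence of \<open>J\<close> is pointwise small by the equation.\<close>
  define J where "J l n d p = flux_component (q l) (c l) \<psi> d (real (Suc n) * \<Delta>t) (?x p + axis d (?h / 2))" for l n d p
  define r where "r l n d p = J l n d p - slotboom_flux \<mu> ?h (q l) (ce l (Suc n)) (\<psi>e n) d p" for l n d p
  define s where "s l n p = (ce l (Suc n) p - ce l n p) / \<Delta>t - div_h ?h (J l n) p" for l n p
  have h: "?h > 0" by (rule mesh_pos[OF ab])
  have parts: "0 \<le> ?R1" "0 \<le> 3 * ?G * (1 + C\<^sub>2)" "0 \<le> 3 * \<kappa> * B"
    using Q B C2 \<kappa> by (auto intro!: add_nonneg_nonneg mult_nonneg_nonneg)
  have RP: "P \<le> R" and R1: "?R1 \<le> R" and R2: "3 * ?G * (1 + C\<^sub>2) \<le> R" and R3: "3 * \<kappa> * B + P \<le> R"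
    using R parts P by linarith+
  have R0: "R \<ge> 0" using RP P by linarith
  have tT: "real n * \<Delta>t \<in> {0..T}" if "real n * \<Delta>t \<le> T" for n using that dt by simp
  have nT: "real n * \<Delta>t \<le> T" if "real (Suc n) * \<Delta>t \<le> T" for n
    using that dt by (simp add: algebra_simps)
  have step: "slotboom_step \<mu> a b \<kappa> M q \<rho> K \<Delta>t (\<lambda>l. cn l n) (\<psi>n n) (\<lambda>l. cn l (Suc n)) (\<psi>n (Suc n))"
    if "real (Suc n) * \<Delta>t \<le> T" for n
    using sol that unfolding slotboom_solution_def by blast
  have cn0: "cn l 0 = grid_restrict a b K (fourier_proj a b K (c l 0))" if "l \<in> {1..M}" for l
    using sol that unfolding slotboom_solution_def by blast
  have \<psi>n0: "\<psi>n 0 = grid_restrict a b K (fourier_proj a b K (\<psi> 0))"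
    using sol unfolding slotboom_solution_def by blast
  have cper: "space_periodic (b - a) (c l t)" if "t \<in> {0..T}" "l \<in> {1..M}" for l t
    using pnp that unfolding PNP_solution_def by blast
  have \<psi>per: "space_periodic (b - a) (\<psi> t)" if "t \<in> {0..T}" for t
    using pnp that unfolding PNP_solution_def by blast
  have "error_system \<mu> a b T \<kappa> Q B R \<Delta>t M K q ce cn \<psi>e \<psi>n r s"
  proof
    fix n assume n: "real n * \<Delta>t \<le> T"
    show "\<psi>e n \<in> C_per K" unfolding \<psi>e_def by (intro C_per_grid_restrict \<psi>per tT n)
    show "\<psi>n n \<in> C_per K"
    proof (cases n)
      case 0
      then show ?thesis using ab by (simp add: \<psi>n0 C_per_grid_restrict fourier_proj_periodic)
    next
      case (Suc m)
      then show ?thesis using slotboom_step_flux(2)[OF step[of m]] n by simp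
    qed
    show "\<bar>grad_h ?h (\<psi>e n) d p\<bar> \<le> B" for d p
    proof -
      have "\<bar>\<psi>e n (p + axis d 1) - \<psi>e n p\<bar> \<le> B * ?h"
        using smooth_bounds_space_lipschitz(1)[OF \<psi> tT[OF n], of "?x p" d ?h 0] h
        by (simp add: \<psi>e_def grid_restrict_plus) (simp add: grid_restrict_def)
      then show ?thesis using h by (simp add: grad_h_def abs_divide divide_le_eq)
    qed
    fix l assume l: "l \<in> {1..M}"
    show "ce l n \<in> C_per K" unfolding ce_def by (intro C_per_grid_restrict cper tT n l)
    show "cn l n \<in> C_per K"
    proof (cases n)
      case 0
      then show ?thesis using ab l by (simp add: cn0 C_per_grid_restrict fourier_proj_periodic)
    next
      case (Suc m)
      then show ?thesis using slotboom_step_flux(1)[OF step[of m] l] n by simp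
    qed
    show "\<bar>ce l n p\<bar> \<le> B" for p
      unfolding ce_def grid_restrict_def by (rule smooth_boundsD(1)[OF c[OF l] tT[OF n]])
  next
    have PR: "P * ?h\<^sup>2 \<le> R * ?h\<^sup>2" using RP by (intro mult_right_mono) auto
    show "\<bar>ce l 0 p - cn l 0 p\<bar> \<le> R * ?h\<^sup>2" if "l \<in> {1..M}" for l p
      using Pc[OF that, of "?x p"] PR by (simp add: ce_def cn0[OF that] grid_restrict_def abs_minus_commute)
    show "\<bar>\<psi>e 0 p - \<psi>n 0 p\<bar> \<le> R * ?h\<^sup>2" for p
      using P\<psi>[of "?x p"] PR by (simp add: \<psi>e_def \<psi>n0 grid_restrict_def abs_minus_commute)
  next
    fix n assume n: "real (Suc n) * \<Delta>t \<le> T"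
    let ?t = "real n * \<Delta>t" and ?t' = "real (Suc n) * \<Delta>t"
    have t: "?t \<in> {0..T}" by (rule tT[OF nT[OF n]])
    have t': "?t' \<in> {0..T}" by (rule tT[OF n])
    have tt: "?t + \<Delta>t = ?t'" by (simp add: algebra_simps)
    have t'': "?t + \<Delta>t \<in> {0..T}" unfolding tt by (rule t')
    show "\<bar>\<kappa> * laplace_h ?h (\<lambda>p. \<psi>e (Suc n) p - \<psi>n (Suc n) p) p
        + (\<Sum>l=1..M. q l * (ce l (Suc n) p - cn l (Suc n) p))\<bar> \<le> R * ?h" for p
    proof -
      let ?lap = "\<Sum>d\<in>UNIV. partial d (partial d (\<psi> ?t')) (?x p)"
      have 1: "- \<kappa> * ?lap = (\<Sum>l=1..M. q l * ce l (Suc n) p) + \<rho> (?x p)"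
      proof -
        have "laplacian (\<psi> ?t') (?x p) = ?lap"
          by (simp add: laplacian_def divergence_def gradient_def)
        moreover have "- \<kappa> * laplacian (\<psi> ?t') (?x p) = (\<Sum>l=1..M. q l * c l ?t' (?x p)) + \<rho> (?x p)"
          using pnp t' unfolding PNP_solution_def by blast
        ultimately show ?thesis by (simp add: ce_def grid_restrict_def)
      qed
      have 2: "- \<kappa> * laplace_h ?h (\<psi>n (Suc n)) p = (\<Sum>l=1..M. q l * cn l (Suc n) p) + fourier_proj a b K \<rho> (?x p)"
        using slotboom_step_flux(4)[OF step[OF n], of p] by (simp add: grid_restrict_def)
      have 3: "\<bar>laplace_h ?h (\<psi>e (Suc n)) p - ?lap\<bar> \<le> 3 * (B * ?h)"
      proof -
        have "laplace_h ?h (\<psi>e (Suc n)) p = (\<Sum>d\<in>UNIV. (\<psi> ?t' (?x p + axis d ?h) - 2 * \<psi> ?t' (?x p)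
            + \<psi> ?t' (?x p + axis d (- ?h))) / ?h\<^sup>2)"
          unfolding laplace_h_fdiff sum_divide_distrib
          by (intro sum.cong refl) (simp add: bdiff_def fdiff_def \<psi>e_def grid_restrict_plus, simp add: grid_restrict_def)
        then have "laplace_h ?h (\<psi>e (Suc n)) p - ?lap = (\<Sum>d\<in>UNIV. (\<psi> ?t' (?x p + axis d ?h) - 2 * \<psi> ?t' (?x p)
            + \<psi> ?t' (?x p + axis d (- ?h))) / ?h\<^sup>2 - partial d (partial d (\<psi> ?t')) (?x p))"
          by (simp add: sum_subtractf)
        also have "\<bar>\<dots>\<bar> \<le> 3 * (B * ?h)"
          by (intro abs_sum_UNIV_3_le second_difference_consistent[OF \<psi> t' h])
        finally show ?thesis .
      qed
      have "laplace_h ?h (\<lambda>p. \<psi>e (Suc n) p - \<psi>n (Suc n) p) p = laplace_h ?h (\<psi>e (Suc n)) p - laplace_h ?h (\<psi>n (Suc n)) p"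
        by (simp add: laplace_h_fdiff bdiff_def fdiff_def sum_subtractf flip: diff_divide_distrib)
          (simp add: sum.distrib sum_subtractf)
      then have "\<kappa> * laplace_h ?h (\<lambda>p. \<psi>e (Suc n) p - \<psi>n (Suc n) p) p
          + (\<Sum>l=1..M. q l * (ce l (Suc n) p - cn l (Suc n) p))
        = \<kappa> * (laplace_h ?h (\<psi>e (Suc n)) p - ?lap) + (fourier_proj a b K \<rho> (?x p) - \<rho> (?x p))"
        using 1 2 by (simp add: right_diff_distrib sum_subtractf)
      also have "\<bar>\<dots>\<bar> \<le> \<kappa> * (3 * (B * ?h)) + P * ?h"
      proof (intro order_trans[OF abs_triangle_ineq] add_mono)
        show "\<bar>\<kappa> * (laplace_h ?h (\<psi>e (Suc n)) p - ?lap)\<bar> \<le> \<kappa> * (3 * (B * ?h))"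
          using \<kappa> by (intro abs_mult_le 3) simp
        have "P * ?h\<^sup>2 \<le> P * ?h" using h h1 P
          by (intro mult_left_mono) (auto simp: power2_eq_square mult_left_le)
        then show "\<bar>fourier_proj a b K \<rho> (?x p) - \<rho> (?x p)\<bar> \<le> P * ?h" using P\<rho>[of "?x p"] by linarith
      qed
      also have "\<dots> = (3 * \<kappa> * B + P) * ?h" by (simp add: algebra_simps)
      also have "\<dots> \<le> R * ?h" using R3 h by (intro mult_right_mono) auto
      finally show ?thesis .
    qed
    fix l assume l: "l \<in> {1..M}"
    have Jper: "J l n d \<in> C_per K" for d
    proof -
      have "space_periodic (b - a) (flux_component (q l) (c l) \<psi> d ?t')"
        using cper[OF t' l] \<psi>per[OF t'] partial_periodic[OF cper[OF t' l]] partial_periodic[OF \<psi>per[OF t']]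
        by (simp add: space_periodic_def flux_component_def)
      then show ?thesis unfolding J_def[abs_def] by (rule C_per_cell_centre)
    qed
    show "r l n d \<in> C_per K" for d
    proof -
      have "slotboom_flux \<mu> ?h (q l) (ce l (Suc n)) (\<psi>e n) d \<in> C_per K"
        unfolding ce_def \<psi>e_def by (intro C_per_slotboom_flux C_per_grid_restrict cper \<psi>per t t' l)
      with Jper show ?thesis unfolding r_def[abs_def] by (rule C_per_compose2[where f = "(-)"])
    qed
    show "(ce l (Suc n) p - ce l n p) / \<Delta>t =
        div_h ?h (\<lambda>d p. slotboom_flux \<mu> ?h (q l) (ce l (Suc n)) (\<psi>e n) d p + r l n d p) p + s l n p" for p
      by (simp add: r_def s_def)
    show "(cn l (Suc n) p - cn l n p) / \<Delta>t = div_h ?h (slotboom_flux \<mu> ?h (q l) (cn l (Suc n)) (\<psi>n n)) p" for p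
      by (rule slotboom_step_flux(3)[OF step[OF n] l])
    show "\<bar>r l n d p\<bar> \<le> R * ?h" for d p
    proof -
      have "\<bar>r l n d p\<bar> \<le> ?R1 * ?h"
        unfolding r_def J_def tt[symmetric]
        by (rule slotboom_flux_consistent[OF c[OF l] \<psi> q[OF l] t t'' dt dth h small])
          (simp_all add: ce_def \<psi>e_def grid_restrict_plus tt, simp_all add: grid_restrict_def)
      also have "\<dots> \<le> R * ?h" using R1 h by (intro mult_right_mono) auto
      finally show ?thesis .
    qed
    show "\<bar>s l n p\<bar> \<le> R * ?h" for p
    proof -
      let ?g = "\<lambda>d. flux_component_deriv (q l) (c l) \<psi> d ?t' (?x p)"
      have 1: "\<bar>(ce l (Suc n) p - ce l n p) / \<Delta>t - (\<Sum>d\<in>UNIV. ?g d)\<bar> \<le> 3 * ?G * \<Delta>t"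
      proof -
        have "((\<lambda>s. c l s (?x p)) has_real_derivative (\<Sum>d\<in>UNIV. flux_component_deriv (q l) (c l) \<psi> d s (?x p)))
            (at s within {0..T})" if s: "s \<in> {0..T}" for s
          using pnp s l unfolding PNP_solution_def divergence_flux[OF c[OF l] \<psi> q[OF l] s, symmetric] by blast
        from time_difference_consistent[OF c[OF l] \<psi> q[OF l] t t'' dt this]
        show ?thesis unfolding tt by (simp add: ce_def grid_restrict_def)
      qed
      have 2: "\<bar>div_h ?h (J l n) p - (\<Sum>d\<in>UNIV. ?g d)\<bar> \<le> 3 * (?G * ?h)"
      proof -
        have "?x (p - axis d 1) + axis d (?h / 2) = ?x p + axis d (- (?h / 2))" for d
          using cell_centre_plus[of a b K p d "- 1"]
          by (simp add: vec_eq_iff axis_def cell_centre_def algebra_simps)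
        then have "div_h ?h (J l n) p - (\<Sum>d\<in>UNIV. ?g d) =
          (\<Sum>d\<in>UNIV. (flux_component (q l) (c l) \<psi> d ?t' (?x p + axis d (?h / 2))
            - flux_component (q l) (c l) \<psi> d ?t' (?x p + axis d (- (?h / 2)))) / ?h - ?g d)"
          by (simp add: div_h_def J_def sum_subtractf)
        also have "\<bar>\<dots>\<bar> \<le> 3 * (?G * ?h)"
          by (intro abs_sum_UNIV_3_le flux_difference_consistent[OF c[OF l] \<psi> q[OF l] t' h])
        finally show ?thesis .
      qed
      have "3 * ?G * \<Delta>t \<le> 3 * ?G * (C\<^sub>2 * ?h)" using dth B Q by (intro mult_left_mono) auto
      then have "\<bar>s l n p\<bar> \<le> 3 * ?G * (C\<^sub>2 * ?h) + 3 * (?G * ?h)"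
        unfolding s_def using 1 2 by linarith
      also have "\<dots> = (3 * ?G * (1 + C\<^sub>2)) * ?h" by (simp add: algebra_simps)
      also have "\<dots> \<le> R * ?h" using R2 h by (intro mult_right_mono) auto
      finally show ?thesis .
    qed
  qed (use ab \<kappa> B R0 dt Q q in auto)
  then show ?thesis unfolding ce_def[abs_def] \<psi>e_def[abs_def] by blast
qed

text \<open>Passes from the exact to the projected solution inside the flux: the accuracy h^2 of the
  projection leaves one power of \<open>h\<close> after the difference quotient.\<close>

lemma discrete_flux_perturbation:
  assumes h: "0 < h" "h \<le> 1" and z: "\<bar>z\<bar> \<le> Q" and B: "B \<ge> 0" and P: "P \<ge> 0"
    and c: "\<And>p. \<bar>c p\<bar> \<le> B" and \<psi>: "\<And>d p. \<bar>grad_h h \<psi> d p\<bar> \<le> B"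
    and cP: "\<And>p. \<bar>cP p - c p\<bar> \<le> P * h\<^sup>2" and \<psi>P: "\<And>p. \<bar>\<psi>P p - \<psi> p\<bar> \<le> P * h\<^sup>2"
  shows "\<bar>discrete_flux h z cP \<psi>P d p - discrete_flux h z c \<psi> d p\<bar> \<le> (2 * P + Q * ((B + P) * (2 * P) + P * B)) * h"
proof -
  let ?p = "p + axis d 1"
  have Q: "Q \<ge> 0" using z by linarith
  have hh: "P * h\<^sup>2 \<le> P * h" "P * h \<le> P" using h P by (auto simp: power2_eq_square mult_left_le intro!: mult_left_mono)
  have grad: "\<bar>grad_h h u d p - grad_h h v d p\<bar> \<le> 2 * P * h" if uv: "\<And>p. \<bar>u p - v p\<bar> \<le> P * h\<^sup>2" for u v :: cell_fun
  proof -
    have "\<bar>(u ?p - v ?p) - (u p - v p)\<bar> \<le> 2 * (P * h\<^sup>2)" using uv[of p] uv[of ?p] by linarith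
    then have "\<bar>(u ?p - v ?p) - (u p - v p)\<bar> / h \<le> 2 * (P * h\<^sup>2) / h" using h by (intro divide_right_mono) auto
    moreover have "grad_h h u d p - grad_h h v d p = ((u ?p - v ?p) - (u p - v p)) / h"
      by (simp add: grad_h_def diff_divide_distrib)
    ultimately show ?thesis using h by (simp add: power2_eq_square abs_divide)
  qed
  have avg: "\<bar>face_avg cP d p - face_avg c d p\<bar> \<le> P * h"
  proof -
    have "face_avg cP d p - face_avg c d p = ((cP ?p - c ?p) + (cP p - c p)) / 2"
      by (simp add: face_avg_def field_simps)
    moreover have "\<bar>(cP ?p - c ?p) + (cP p - c p)\<bar> \<le> 2 * (P * h)"
      using cP[of p] cP[of ?p] hh(1) by linarith
    ultimately show ?thesis by (simp only: abs_divide) simp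
  qed
  have "\<bar>face_avg c d p\<bar> \<le> B" using c[of p] c[of ?p] by (simp add: face_avg_def abs_le_iff)
  then have avgP: "\<bar>face_avg cP d p\<bar> \<le> B + P" using avg hh(2) by linarith
  have eq: "discrete_flux h z cP \<psi>P d p - discrete_flux h z c \<psi> d p =
      (grad_h h cP d p - grad_h h c d p) + z * (face_avg cP d p * (grad_h h \<psi>P d p - grad_h h \<psi> d p)
        + (face_avg cP d p - face_avg c d p) * grad_h h \<psi> d p)"
    by (simp add: discrete_flux_def algebra_simps)
  have "\<bar>face_avg cP d p * (grad_h h \<psi>P d p - grad_h h \<psi> d p)
      + (face_avg cP d p - face_avg c d p) * grad_h h \<psi> d p\<bar> \<le> (B + P) * (2 * P * h) + (P * h) * B"
    by (rule order_trans[OF abs_triangle_ineq add_mono[OF abs_mult_le[OF avgP grad[OF \<psi>P]] abs_mult_le[OF avg \<psi>]]])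
  from order_trans[OF abs_triangle_ineq add_mono[OF grad[OF cP] abs_mult_le[OF z this]]]
show ?thesis unfolding eq by (simp add: algebra_simps)
qed

section \<open>Choice of the uniform constants and conclusion\<close>

lemma periodic_smooth_mono: "periodic_smooth L m B u \<Longrightarrow> B \<le> B' \<Longrightarrow> periodic_smooth L m B' u"
  unfolding periodic_smooth_def by (meson order_trans)

text \<open>For \<open>K \<ge> 1\<close> the period \<open>h * (2 * K + 1)\<close> is at most
  \<open>3 * h * K\<close>, which trades K^-2 for h^2; the constant 243 is 27 * 9.\<close>

lemma fourier_proj_error_mesh:
  assumes ab: "a < b" and u: "periodic_smooth (b - a) 6 B u" and K: "K \<ge> 1"
  shows "\<bar>fourier_proj a b K u x - u x\<bar> \<le> 243 * B * (b - a) ^ 4 * (mesh a b K)\<^sup>2"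
proof -
  let ?L = "b - a" and ?h = "mesh a b K"
  have B: "B \<ge> 0" using u unfolding periodic_smooth_def by (meson abs_ge_zero order_trans)
  have "?L = ?h * real (num_points K)" by (simp add: mesh_def)
  then have "?L = ?h * (2 * real K + 1)" by (simp add: num_points_def add.commute)
  also have "\<dots> \<le> ?h * (3 * real K)" using K mesh_pos[OF ab, of K] by (intro mult_left_mono) auto
  finally have "?L\<^sup>2 \<le> (?h * (3 * real K))\<^sup>2" using ab by (intro power_mono) auto
  then have "?L\<^sup>2 / (real K)\<^sup>2 \<le> 9 * ?h\<^sup>2" using K by (simp add: power_mult_distrib divide_le_eq)
  then have le: "27 * B * ?L ^ 4 * (?L\<^sup>2 / (real K)\<^sup>2) \<le> 27 * B * ?L ^ 4 * (9 * ?h\<^sup>2)"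
    using B by (intro mult_left_mono) auto
  have "?L ^ 6 = ?L ^ 4 * ?L\<^sup>2" by (simp flip: power_add)
  then have "27 * B * ?L ^ 6 / (real K)\<^sup>2 = 27 * B * ?L ^ 4 * (?L\<^sup>2 / (real K)\<^sup>2)"
    by (simp only: times_divide_eq_right mult.assoc)
  with fourier_proj_error[OF ab u K, of x] le show ?thesis by linarith
qed

lemma small_mesh:
  fixes L :: real
  assumes L: "L > 0"
  shows "\<exists>\<delta>>0. \<forall>h. 0 < h \<and> h < \<delta> \<longrightarrow> h < L \<and> h < 1 \<and> A1 * h < 1 \<and> A2 * h < 1 \<and> A3 * h < 1 \<and> A4 * sqrt (L * h) < 1"
proof -
  have lim: "((\<lambda>h. A * h) \<longlongrightarrow> 0) (at_right 0)" "((\<lambda>h. A * sqrt (L * h)) \<longlongrightarrow> 0) (at_right 0)" for A :: real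
    by (rule tendsto_eq_intros refl | simp)+
  have "\<forall>\<^sub>F h in at_right 0. (1 * h < L \<and> 1 * h < 1 \<and> A1 * h < 1 \<and> A2 * h < 1 \<and> A3 * h < 1 \<and> A4 * sqrt (L * h) < 1)"
    by (intro eventually_conj order_tendstoD(2)[OF lim(1)] order_tendstoD(2)[OF lim(2)] L zero_less_one)
  then show ?thesis by (auto simp: eventually_at_right_field)
qed

theorem corollary4p4:
  "\<exists>m::nat. \<forall>(\<mu>::mobility) (a::real) (b::real) (T::real) (\<kappa>::real) (M::nat) (q::nat \<Rightarrow> real)
      (\<rho>::real ^ 3 \<Rightarrow> real) (c\<^sub>i\<^sub>n::nat \<Rightarrow> real ^ 3 \<Rightarrow> real)
      (c::nat \<Rightarrow> real \<Rightarrow> real ^ 3 \<Rightarrow> real) (\<psi>::real \<Rightarrow> real ^ 3 \<Rightarrow> real) (C\<^sub>1::real) (C\<^sub>2::real).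
     a < b \<and> 0 < T \<and> 0 < \<kappa> \<and> 1 \<le> M \<and> 0 < C\<^sub>1 \<and> 0 < C\<^sub>2 \<and>
     PNP_solution a b T \<kappa> M q \<rho> c\<^sub>i\<^sub>n c \<psi> \<and> smooth_data m T M \<rho> c \<psi> \<longrightarrow>
     (\<exists>C>0. \<exists>\<delta>>0. \<forall>(K::nat) (\<Delta>t::real) (cn::nat \<Rightarrow> nat \<Rightarrow> cell_fun) (\<psi>n::nat \<Rightarrow> cell_fun).
        0 < \<Delta>t \<and> \<Delta>t < \<delta> \<and> mesh a b K < \<delta> \<and>
        C\<^sub>1 * mesh a b K \<le> \<Delta>t \<and> \<Delta>t \<le> C\<^sub>2 * mesh a b K \<and>
        slotboom_solution \<mu> a b T \<kappa> M q \<rho> c \<psi> K \<Delta>t cn \<psi>n \<longrightarrow>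
        (\<forall>n\<ge>1. real n * \<Delta>t \<le> T \<longrightarrow>
           sqrt (\<Delta>t * (\<Sum>l=1..M. \<Sum>k=1..n.
              (face_norm a b K (flux_error a b q c \<psi> K \<Delta>t cn \<psi>n l k))\<^sup>2))
           \<le> C * (\<Delta>t + (mesh a b K)\<^sup>2)))"
proof (rule exI[of _ 6], intro allI impI, elim conjE)
  fix \<mu> a b T \<kappa> M q \<rho> c\<^sub>i\<^sub>n c \<psi> and C\<^sub>1 C\<^sub>2 :: real
  assume ab: "a < b" and T: "0 < T" and \<kappa>: "0 < \<kappa>" and C1: "0 < C\<^sub>1" and C2: "0 < C\<^sub>2"
    and pnp: "PNP_solution a b T \<kappa> M q \<rho> c\<^sub>i\<^sub>n c \<psi>" and smooth: "smooth_data 6 T M \<rho> c \<psi>"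
  let ?L = "b - a"
  define Q where "Q = (\<Sum>l=1..M. \<bar>q l\<bar>)"
  have Q: "Q \<ge> 0" by (simp add: Q_def sum_nonneg)
  have q: "\<bar>q l\<bar> \<le> Q" if "l \<in> {1..M}" for l
    unfolding Q_def by (rule member_le_sum[OF that]) auto
  \<comment> \<open>The projection estimate uses all six derivatives, the consistency bounds use
    four.\<close>
  have per: "per_Ck ?L T 6 \<psi>" "\<And>l. l \<in> {1..M} \<Longrightarrow> per_Ck ?L T 6 (c l)" "per_Ck ?L T 6 (\<lambda>_. \<rho>)"
    using pnp smooth Ck_on_snd[of 6 \<rho> "{0..T} \<times> UNIV"]
    unfolding per_Ck_def PNP_solution_def smooth_data_def by (simp_all add: split_def)
  \<comment> \<open>One constant for all species: for a property that is monotone in its constant,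
    the sum of the individual constants serves every species.\<close>
  have common: "\<exists>B\<ge>0. \<forall>l\<in>{1..M}. P l B" if "\<And>l. l \<in> {1..M} \<Longrightarrow> \<exists>B\<ge>0. P l B"
    and mono: "\<And>l B B'. P l B \<Longrightarrow> B \<le> B' \<Longrightarrow> P l B'" for P :: "nat \<Rightarrow> real \<Rightarrow> bool"
  proof -
    have "\<forall>l\<in>{1..M}. \<exists>B. B \<ge> 0 \<and> P l B" using that(1) by blast
    from bchoice[OF this] obtain B where B: "\<forall>l\<in>{1..M}. B l \<ge> 0 \<and> P l (B l)" by blast
    have "P l (\<Sum>l=1..M. B l)" if l: "l \<in> {1..M}" for l
    proof (rule mono)
      show "P l (B l)" using B l by blast
      show "B l \<le> (\<Sum>l=1..M. B l)" by (rule member_le_sum[OF l]) (use B in auto)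
    qed
    then show ?thesis using B by (intro exI[of _ "\<Sum>l=1..M. B l"]) (auto intro: sum_nonneg)
  qed
  obtain B1 where B1: "B1 \<ge> 0" "smooth_bounds T B1 \<psi>"
    using per_Ck_smooth_bounds[OF ab per_Ck_mono[OF per(1)]] by auto
  have "\<exists>B\<ge>0. \<forall>l\<in>{1..M}. smooth_bounds T B (c l)"
    by (rule common[OF per_Ck_smooth_bounds[OF ab per_Ck_mono[OF per(2)]]]) (auto intro: smooth_bounds_mono)
  then obtain B2 where B2: "B2 \<ge> 0" "\<And>l. l \<in> {1..M} \<Longrightarrow> smooth_bounds T B2 (c l)" by blast
  define B where "B = B1 + B2"
  have B: "B \<ge> 0" using B1 B2 by (simp add: B_def)
  have \<psi>B: "smooth_bounds T B \<psi>" by (rule smooth_bounds_mono[OF B1(2)]) (use B2 in \<open>simp add: B_def\<close>)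
  have cB: "smooth_bounds T B (c l)" if "l \<in> {1..M}" for l
    by (rule smooth_bounds_mono[OF B2(2)[OF that]]) (use B1 in \<open>simp add: B_def\<close>)
  obtain S1 where S1: "S1 \<ge> 0" "\<And>t. t \<in> {0..T} \<Longrightarrow> periodic_smooth ?L 6 S1 (\<psi> t)"
    using per_Ck_periodic_smooth[OF ab per(1)] by blast
  have "\<exists>S\<ge>0. \<forall>l\<in>{1..M}. \<forall>t\<in>{0..T}. periodic_smooth ?L 6 S (c l t)"
    by (rule common[OF per_Ck_periodic_smooth[OF ab per(2)]]) (auto intro: periodic_smooth_mono)
  then obtain S2 where S2: "S2 \<ge> 0" "\<And>l t. l \<in> {1..M} \<Longrightarrow> t \<in> {0..T} \<Longrightarrow> periodic_smooth ?L 6 S2 (c l t)"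
    by blast
  obtain S3 where S3: "S3 \<ge> 0" "periodic_smooth ?L 6 S3 \<rho>"
    using per_Ck_periodic_smooth[OF ab per(3)] T by auto
  define P where "P = 243 * (S1 + S2 + S3) * ?L ^ 4"
  have P: "P \<ge> 0" using S1 S2 S3 by (simp add: P_def)
  have proj: "\<bar>fourier_proj a b K u x - u x\<bar> \<le> P * (mesh a b K)\<^sup>2"
    if "periodic_smooth ?L 6 S u" "S \<le> S1 + S2 + S3" "K \<ge> 1" for S u K x
    unfolding P_def by (rule fourier_proj_error_mesh[OF ab periodic_smooth_mono[OF that(1,2)] that(3)])
  \<comment> \<open>The sum of the constant of \<open>error_system_slotboom\<close> and that of
    \<open>discrete_flux_perturbation\<close>, so that a single \<open>R\<close> serves the error
    equations and the slack in \<open>error_system.flux_error_le\<close>.\<close>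
  define R where "R = P + (6 * Q * B\<^sup>2 + B + 6 * Q\<^sup>2 * B ^ 3 + Q * B\<^sup>2 * (1 + C\<^sub>2) + Q * B\<^sup>2)
      + 3 * (B + 4 * Q * B\<^sup>2) * (1 + C\<^sub>2) + 3 * \<kappa> * B + (2 * P + Q * ((B + P) * (2 * P) + P * B))"
  have Rp: "0 \<le> 2 * P + Q * ((B + P) * (2 * P) + P * B)"
    using P Q B by (intro add_nonneg_nonneg mult_nonneg_nonneg) auto
  have Rq: "0 \<le> P + (6 * Q * B\<^sup>2 + B + 6 * Q\<^sup>2 * B ^ 3 + Q * B\<^sup>2 * (1 + C\<^sub>2) + Q * B\<^sup>2)
      + 3 * (B + 4 * Q * B\<^sup>2) * (1 + C\<^sub>2) + 3 * \<kappa> * B"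
    using P Q B C2 \<kappa> by (intro add_nonneg_nonneg mult_nonneg_nonneg) auto
  \<comment> \<open>The constants are taken out of the locale before \<open>K\<close> and
    \<open>\<Delta>t\<close> are fixed. Neither is among their parameters, which makes
    \<open>C\<close> and \<open>\<delta>\<close> uniform in the discretization.\<close>
  let ?CE = "error_system.C\<^sub>E a b \<kappa> Q B R M" and ?CW = "error_system.C\<^sub>W a b T \<kappa> Q B R M"
    and ?CF = "error_system.C\<^sub>F a b T \<kappa> Q B R M"
  obtain \<delta> where \<delta>: "\<delta> > 0" "\<And>h. 0 < h \<Longrightarrow> h < \<delta> \<Longrightarrow> h < ?L \<and> h < 1 \<and> Q * (B + 1) * h < 1 \<and>
      (2 * R) * h < 1 \<and> (2 * ?CE) * h < 1 \<and> (7 * (?CW * ?L ^ 3)) * sqrt (?L * h) < 1"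
    using small_mesh[of ?L "Q * (B + 1)" "2 * R" "2 * ?CE" "7 * (?CW * ?L ^ 3)"] ab by auto
  \<comment> \<open>The division by \<open>C\<^sub>1\<close> comes from replacing \<open>h\<close>
    by \<open>\<Delta>t / C\<^sub>1\<close>. The absolute value avoids a sign argument, and the
    summand 1 makes \<open>C\<close> positive in any case.\<close>
  define C where "C = sqrt \<bar>?CF\<bar> / C\<^sub>1 + 1"
  have C: "C > 0" using C1 by (auto simp: C_def intro!: add_nonneg_pos)
  show "\<exists>C>0. \<exists>\<delta>>0. \<forall>(K::nat) (\<Delta>t::real) cn \<psi>n.
        0 < \<Delta>t \<and> \<Delta>t < \<delta> \<and> mesh a b K < \<delta> \<and>
        C\<^sub>1 * mesh a b K \<le> \<Delta>t \<and> \<Delta>t \<le> C\<^sub>2 * mesh a b K \<and>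
        slotboom_solution \<mu> a b T \<kappa> M q \<rho> c \<psi> K \<Delta>t cn \<psi>n \<longrightarrow>
        (\<forall>n\<ge>1. real n * \<Delta>t \<le> T \<longrightarrow>
           sqrt (\<Delta>t * (\<Sum>l=1..M. \<Sum>k=1..n.
              (face_norm a b K (flux_error a b q c \<psi> K \<Delta>t cn \<psi>n l k))\<^sup>2))
           \<le> C * (\<Delta>t + (mesh a b K)\<^sup>2))"
  proof (rule exI[of _ C], rule conjI[OF C], rule exI[of _ \<delta>], rule conjI[OF \<delta>(1)], intro allI impI, elim conjE)
    fix K \<Delta>t cn \<psi>n n
    assume dt: "0 < \<Delta>t" "\<Delta>t < \<delta>" and h\<delta>: "mesh a b K < \<delta>" and dt1: "C\<^sub>1 * mesh a b K \<le> \<Delta>t"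
      and dt2: "\<Delta>t \<le> C\<^sub>2 * mesh a b K" and sol: "slotboom_solution \<mu> a b T \<kappa> M q \<rho> c \<psi> K \<Delta>t cn \<psi>n"
      and n: "real n * \<Delta>t \<le> T"
    let ?h = "mesh a b K"
    have h: "0 < ?h" by (rule mesh_pos[OF ab])
    note hs = \<delta>(2)[OF h h\<delta>]
    \<comment> \<open>A single grid point would mean that the mesh size equals the period, which the
      condition \<open>h < ?L\<close> in the choice of \<open>\<delta>\<close> excludes. The
      projection estimate needs \<open>K \<ge> 1\<close>.\<close>
    have K: "K \<ge> 1"
    proof (rule ccontr)
      assume "\<not> K \<ge> 1"
      then have "K = 0" by simp
      then have "?h = ?L" by (simp add: mesh_def num_points_def)
      with hs show False by simp
    qed
    have T0: "0 \<in> {0..T}" using T by simp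
    have QB: "Q * B * ?h \<le> 1"
    proof -
      have "Q * B * ?h \<le> Q * (B + 1) * ?h" using Q h by (intro mult_right_mono mult_left_mono) auto
      then show ?thesis using hs by linarith
    qed
    obtain r s where es: "error_system \<mu> a b T \<kappa> Q B R \<Delta>t M K q
        (\<lambda>l n. grid_restrict a b K (c l (real n * \<Delta>t))) cn (\<lambda>n. grid_restrict a b K (\<psi> (real n * \<Delta>t))) \<psi>n r s"
      using error_system_slotboom[OF ab \<kappa> Q B P dt(1) q pnp \<psi>B cB _ QB dt2 _
          proj[OF S1(2)[OF T0] _ K] proj[OF S2(2)[OF _ T0] _ K] proj[OF S3(2) _ K] sol, of R]
        hs S1(1) S2(1) S3(1) C2 Rp by (auto simp: R_def)
    have "\<Delta>t * (\<Sum>l=1..M. \<Sum>k=1..n. (face_norm a b K (flux_error a b q c \<psi> K \<Delta>t cn \<psi>n l k))\<^sup>2) \<le> ?CF * ?h\<^sup>2"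
    proof (rule error_system.flux_error_le[OF es])
      fix l k d p assume k: "real k * \<Delta>t \<le> T" and l: "l \<in> {1..M}"
      let ?t = "real k * \<Delta>t"
      have t: "?t \<in> {0..T}" using k dt by simp
      let ?R = "grid_restrict a b K"
      have "\<bar>discrete_flux ?h (q l) (?R (fourier_proj a b K (c l ?t))) (?R (fourier_proj a b K (\<psi> ?t))) d p
          - discrete_flux ?h (q l) (?R (c l ?t)) (?R (\<psi> ?t)) d p\<bar> \<le> (2 * P + Q * ((B + P) * (2 * P) + P * B)) * ?h"
      proof (rule discrete_flux_perturbation[OF h _ q[OF l] B P])
        show "\<bar>?R (c l ?t) p\<bar> \<le> B" for p
          using smooth_boundsD(1)[OF cB[OF l] t] by (simp add: grid_restrict_def)
        show "\<bar>grad_h ?h (?R (\<psi> ?t)) d p\<bar> \<le> B" for d p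
          using error_system.\<psi>e_bd[OF es k] by simp
        show "\<bar>?R (fourier_proj a b K (c l ?t)) p - ?R (c l ?t) p\<bar> \<le> P * ?h\<^sup>2" for p
          using proj[OF S2(2)[OF l t] _ K] S1 S3 by (simp add: grid_restrict_def)
        show "\<bar>?R (fourier_proj a b K (\<psi> ?t)) p - ?R (\<psi> ?t) p\<bar> \<le> P * ?h\<^sup>2" for p
          using proj[OF S1(2)[OF t] _ K] S2 S3 by (simp add: grid_restrict_def)
      qed (use hs in auto)
      also have "\<dots> \<le> R * ?h" using Rq h by (intro mult_right_mono) (auto simp: R_def)
      finally show "\<bar>flux_error a b q c \<psi> K \<Delta>t cn \<psi>n l k d p
          - (discrete_flux ?h (q l) (?R (c l ?t)) (?R (\<psi> ?t)) d p - discrete_flux ?h (q l) (cn l k) (\<psi>n k) d p)\<bar> \<le> R * ?h"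
        by (simp add: flux_error_def)
    next
      \<comment> \<open>The smallness statement for \<open>\<delta>\<close> is used here with the
        time step in the place of the mesh size.\<close>
      show "2 * (?CE * \<Delta>t) \<le> 1" using \<delta>(2)[OF dt] by simp
    qed (use hs n in auto)
    also have "\<dots> \<le> \<bar>?CF\<bar> * ?h\<^sup>2" by (intro mult_right_mono) auto
    finally have "sqrt (\<Delta>t * (\<Sum>l=1..M. \<Sum>k=1..n. (face_norm a b K (flux_error a b q c \<psi> K \<Delta>t cn \<psi>n l k))\<^sup>2))
        \<le> sqrt (\<bar>?CF\<bar> * ?h\<^sup>2)" by (rule real_sqrt_le_mono)
    also have "\<dots> = sqrt \<bar>?CF\<bar> / C\<^sub>1 * (C\<^sub>1 * ?h)" using h C1 by (simp add: real_sqrt_mult)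
    also have "\<dots> \<le> sqrt \<bar>?CF\<bar> / C\<^sub>1 * \<Delta>t" using dt1 C1 by (intro mult_left_mono) auto
    also have "\<dots> \<le> C * (\<Delta>t + ?h\<^sup>2)"
      using dt C1 unfolding C_def by (intro mult_mono) auto
    finally show "sqrt (\<Delta>t * (\<Sum>l=1..M. \<Sum>k=1..n. (face_norm a b K (flux_error a b q c \<psi> K \<Delta>t cn \<psi>n l k))\<^sup>2))
        \<le> C * (\<Delta>t + ?h\<^sup>2)" .
  qed
qed

end
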